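(* Let $G$ be a connected unicyclic graph with a cycle of size $c$ and exactly one non-trivial rooted tree $T$ attached to the cycle, and let $v$ be the root of $T$. Label the edges of the cycle consecutively $\varepsilon_1,\varepsilon_2,\dots,\varepsilon_c$ around the cycle so that $\varepsilon_1$ and $\varepsilon_c$ are the two cycle edges incident to $v$. Let $T'$ be the tree obtained from $G$ by deleting the edge $\varepsilon_1$. Suppose that $T'$ has $p$ deep vertices $u_1,\dots,u_p$, and let $d_i=\deg_{T'}(u_i)$ for all $i$. Let $c_{\lambda_{\mathrm{lead}}}$ be the leading coefficient of $\mathbf{X}_G$. \begin{enumerate} \item If the root $v$ is a sprout in $G$ (in which case the deep vertices of $T'$ are indexed so that $v=u_1$), then \[c_{\lambda_{\mathrm{lead}}}=(-1)^p\left[(c-2)\prod_{i=1}^p(d_i-1)+\prod_{i=2}^p(d_i-1)\right].\] \item If the root $v$ is not a sprout in $G$, then \[c_{\lambda_{\mathrm{lead}}}=(-1)^p(c-2)\prod_{i=1}^p(d_i-1).\] \end{enumerate}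
   Context: All graphs are finite and simple. The chromatic symmetric function of a graph $G$ with vertices $v_1,\dots,v_n$ is $\mathbf{X}_G=\sum_\kappa x_{\kappa(v_1)}\cdots x_{\kappa(v_n)}$, summed over all proper colorings $\kappa:V(G)\to\mathbb{N}$. The star graph $\mathsf{St}_k$ on $k$ vertices is the tree with one central vertex adjacent to $k-1$ leaves ($\mathsf{St}_1$ is a single vertex); $\mathfrak{st}_k:=\mathbf{X}_{\mathsf{St}_k}$, and for a partition $\lambda=(\lambda_1,\dots,\lambda_\ell)$, $\mathfrak{st}_\lambda:=\mathfrak{st}_{\lambda_1}\cdots\mathfrak{st}_{\lambda_\ell}$. The set $\{\mathfrak{st}_\lambda:\lambda\vdash n\}$ is a $\mathbb{Q}$-basis (the star-basis) of the space of homogeneous symmetric functions of degree $n$, so $\mathbf{X}_G=\sum_{\lambda\vdash n}c_\lambda\mathfrak{st}_\lambda$ with uniquely determined coefficients $c_\lambda$. Partitions of $n$ are ordered lexicographically: $\mu\le\lambda$ if $\mu=\lambda$ or, for some $j$, $\mu_i=\lambda_i$ for $i<j$ and $\mu_j<\lambda_j$. The leading partition $\lambda_{\mathrm{lead}}$ is the smallest partition $\lambda$ in lexicographic order with $c_\lambda\ne0$, and $c_{\lambda_{\mathrm{lead}}}$ is the leading coefficient. A unicyclic graph is a graph containing exactly one cycle. If $G$ is connected unicyclic with cycle vertices $v_1,\dots,v_c$, then deleting the edges of the cycle leaves $c$ trees $T_1,\dots,T_c$ with $T_i$ containing (and rooted at) $v_i$; $T_i$ is non-trivial if it has more than one vertex.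 A leaf is a vertex of degree one; an internal vertex is a vertex of degree at least two; a deep vertex is an internal vertex with no adjacent leaves. A sprout of $G$ is a deep vertex of $G$ that lies on the cycle and has degree at least three. Empty products equal $1$. *)

theory Defs
  imports Complex_Main "HOL-Library.Multiset" "HOL-Library.FuncSet"
begin

section \<open>Finite simple graphs\<close>

text \<open>A graph is given by its vertex set \<open>V\<close> and its edge set \<open>E\<close>, whose members are
  two-element subsets of \<open>V\<close>.\<close>

definition simple_graph :: "'a set \<Rightarrow> 'a set set \<Rightarrow> bool" where
  "simple_graph V E \<longleftrightarrow> finite V \<and> (\<forall>e\<in>E. e \<subseteq> V \<and> card e = 2)"

definition adj_rel :: "'a set set \<Rightarrow> ('a \<times> 'a) set" where
  "adj_rel E = {(x, y). {x, y} \<in> E}"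

definition component :: "'a set \<Rightarrow> 'a set set \<Rightarrow> 'a \<Rightarrow> 'a set" where
  "component V E x = {y \<in> V. (x, y) \<in> (adj_rel E)\<^sup>*}"

definition connected_graph :: "'a set \<Rightarrow> 'a set set \<Rightarrow> bool" where
  "connected_graph V E \<longleftrightarrow> V \<noteq> {} \<and> (\<forall>x\<in>V. \<forall>y\<in>V. (x, y) \<in> (adj_rel E)\<^sup>*)"

definition degree :: "'a set set \<Rightarrow> 'a \<Rightarrow> nat" where
  "degree E x = card {e \<in> E. x \<in> e}"

text \<open>A cycle is presented by the cyclic list of its vertices. The same cycle, as a subgraph, has
  several such lists (choice of starting point and direction); it is determined by its edge set.\<close>

definition cycle_edge :: "'a list \<Rightarrow> nat \<Rightarrow> 'a set" where
  "cycle_edge vs i = {vs ! i, vs ! (Suc i mod length vs)}"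

definition cycle_edges :: "'a list \<Rightarrow> 'a set set" where
  "cycle_edges vs = cycle_edge vs ` {..<length vs}"

definition is_cycle :: "'a set \<Rightarrow> 'a set set \<Rightarrow> 'a list \<Rightarrow> bool" where
  "is_cycle V E vs \<longleftrightarrow>
     length vs \<ge> 3 \<and> distinct vs \<and> set vs \<subseteq> V \<and> cycle_edges vs \<subseteq> E"

definition unicyclic :: "'a set \<Rightarrow> 'a set set \<Rightarrow> bool" where
  "unicyclic V E \<longleftrightarrow> (\<exists>!C. \<exists>vs. is_cycle V E vs \<and> C = cycle_edges vs)"

definition deep_vertex :: "'a set \<Rightarrow> 'a set set \<Rightarrow> 'a \<Rightarrow> bool" where
  "deep_vertex V E x \<longleftrightarrow>
     x \<in> V \<and> degree E x \<ge> 2 \<and> \<not> (\<exists>y\<in>V. {x, y} \<in> E \<and> degree E y = 1)"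

definition sprout :: "'a set \<Rightarrow> 'a set set \<Rightarrow> 'a \<Rightarrow> bool" where
  "sprout V E x \<longleftrightarrow>
     deep_vertex V E x \<and> (\<exists>vs. is_cycle V E vs \<and> x \<in> set vs) \<and> degree E x \<ge> 3"

section \<open>Chromatic symmetric functions\<close>

text \<open>A formal power series over \<open>\<rat>\<close> in the variables \<open>x\<^sub>0, x\<^sub>1, \<dots>\<close> is represented by its
  coefficient function: a monomial is the multiset of the indices of its variables, with
  multiplicity.\<close>

type_synonym power_series = "nat multiset \<Rightarrow> rat"

definition ps_one :: power_series where
  "ps_one m = (if m = {#} then 1 else 0)"

definition ps_mult :: "power_series \<Rightarrow> power_series \<Rightarrow> power_series" where
  "ps_mult f g m = (\<Sum>a | a \<subseteq># m. f a * g (m - a))"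

definition proper_colorings :: "'a set \<Rightarrow> 'a set set \<Rightarrow> ('a \<Rightarrow> nat) set" where
  "proper_colorings V E =
     {\<kappa> \<in> V \<rightarrow>\<^sub>E UNIV. \<forall>x\<in>V. \<forall>y\<in>V. {x, y} \<in> E \<longrightarrow> \<kappa> x \<noteq> \<kappa> y}"

text \<open>The coefficient of \<open>m\<close> in the formal sum of the monomials of all proper colorings is the
  (finite) number of proper colorings whose monomial is \<open>m\<close>.\<close>

definition chrom_sym :: "'a set \<Rightarrow> 'a set set \<Rightarrow> power_series" where
  "chrom_sym V E m =
     of_nat (card {\<kappa> \<in> proper_colorings V E. image_mset \<kappa> (mset_set V) = m})"

section \<open>The star basis\<close>

definition star :: "nat \<Rightarrow> power_series" where
  "star k = chrom_sym {..<k} {{0, i} | i. 0 < i \<and> i < k}"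

definition star_part :: "nat list \<Rightarrow> power_series" where
  "star_part l = foldr ps_mult (map star l) ps_one"

definition partitions :: "nat \<Rightarrow> nat list set" where
  "partitions n = {l. sorted_wrt (\<ge>) l \<and> (\<forall>k\<in>set l. 0 < k) \<and> sum_list l = n}"

text \<open>\<open>lexord\<close> also puts proper prefixes first; this never happens between two partitions
  of the same number.\<close>

definition part_le :: "nat list \<Rightarrow> nat list \<Rightarrow> bool" where
  "part_le k l \<longleftrightarrow> k = l \<or> (k, l) \<in> lexord less_than"

text \<open>Coefficients in the star basis of a series \<open>f\<close> that is a homogeneous symmetric function of
  degree \<open>n\<close>, extended by zero to lists that are not partitions of \<open>n\<close>.\<close>

definition star_coeffs :: "nat \<Rightarrow> power_series \<Rightarrow> nat list \<Rightarrow> rat" where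
  "star_coeffs n f =
     (THE c. (\<forall>l. l \<notin> partitions n \<longrightarrow> c l = 0) \<and>
             f = (\<lambda>m. \<Sum>l\<in>partitions n. c l * star_part l m))"

definition lead_partition :: "nat \<Rightarrow> power_series \<Rightarrow> nat list" where
  "lead_partition n f =
     (THE l. l \<in> partitions n \<and> star_coeffs n f l \<noteq> 0 \<and>
             (\<forall>k\<in>partitions n. star_coeffs n f k \<noteq> 0 \<longrightarrow> part_le l k))"

definition lead_coeff :: "nat \<Rightarrow> power_series \<Rightarrow> rat" where
  "lead_coeff n f = star_coeffs n f (lead_partition n f)"

end

theory Submission
  imports Defs "HOL-Library.Multiset_Order"
begin

text \<open>Let \<open>L(F)\<close> be the set of edges of a forest \<open>F\<close> with an endpoint of degree one; its components
  are stars. If \<open>ab\<close> is an edge of \<open>F\<close> outside \<open>L(F)\<close>, then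
  \<open>X_F = X_(F - ab) - X_F' + X_(F' + ab)\<close>, where \<open>F'\<close> arises from \<open>F - ab\<close> by moving all
  neighbours of \<open>b\<close> to \<open>a\<close>. Induction on the number of edges outside \<open>L(F)\<close> shows that the star
  coefficients of \<open>X_F\<close> vanish below the partition formed by the component sizes of \<open>L(F)\<close>, and that
  the coefficient there is the product of \<open>1 - deg u\<close> over all deep vertices \<open>u\<close>.

  Let \<open>e_1, \<dots>, e_c\<close> be the edges of the cycle. Since a colouring that is
  monochromatic on all but one of them is monochromatic on the last one, \<open>X_G\<close> is the sum of \<open>(-1)^(|S| - 1) X_(G - S)\<close> over the
  nonempty subsets \<open>S\<close> of \<open>{e_1, \<dots>, e_(c-1)}\<close>, and each \<open>G - S\<close> is a forest. The least partition
  that survives is that of \<open>T' = G - e_1\<close>, and it is contributed only by \<open>S = {e_1, \<dots>, e_j}\<close>: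
  each \<open>j \<le> c - 2\<close> yields the leading coefficient of \<open>T'\<close>, and \<open>j = c - 1\<close> contributes iff the
  root is a sprout.\<close>

section \<open>Component sizes\<close>

definition kernel_sizes :: "'a set \<Rightarrow> ('a \<Rightarrow> 'b) \<Rightarrow> nat multiset" where
  "kernel_sizes V r = image_mset (\<lambda>z. card {x \<in> V. r x = z}) (mset_set (r ` V))"

abbreviation comp_sizes :: "'a set \<Rightarrow> 'a set set \<Rightarrow> nat multiset" where
  "comp_sizes V L \<equiv> kernel_sizes V (component V L)"

lemma kernel_sizes_cong:
  assumes "\<And>x y. x \<in> V \<Longrightarrow> y \<in> V \<Longrightarrow> r x = r y \<longleftrightarrow> r' x = r' y"
  shows "kernel_sizes V r = kernel_sizes V r'"
proof -
  define g where "g z = r' (SOME x. x \<in> V \<and> r x = z)" for z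
  have g: "g (r x) = r' x" if "x \<in> V" for x
  proof -
    have "\<exists>y. y \<in> V \<and> r y = r x" using that by blast
    then have "(SOME y. y \<in> V \<and> r y = r x) \<in> V \<and> r (SOME y. y \<in> V \<and> r y = r x) = r x"
      by (rule someI_ex)
    then show ?thesis using assms that unfolding g_def by blast
  qed
  have inj: "inj_on g (r ` V)"
    using assms g by (auto simp: inj_on_def)
  have im: "r' ` V = g ` r ` V"
    using g by (auto simp: image_iff)
  have "kernel_sizes V r' = image_mset (\<lambda>z. card {x \<in> V. r' x = z}) (image_mset g (mset_set (r ` V)))"
    unfolding kernel_sizes_def im using inj by (simp add: image_mset_mset_set)
  also have "\<dots> = image_mset (\<lambda>z. card {x \<in> V. r' x = g z}) (mset_set (r ` V))"
    by (simp add: multiset.map_comp comp_def)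
  also have "\<dots> = kernel_sizes V r"
    unfolding kernel_sizes_def
  proof (rule image_mset_cong)
    fix z assume "z \<in># mset_set (r ` V)"
    then have "z \<in> r ` V"
      by (metis elem_mset_set empty_iff mset_set.infinite set_mset_empty)
    then obtain y where y: "y \<in> V" "z = r y" by blast
    have "{x \<in> V. r' x = g z} = {x \<in> V. r x = z}" using y g assms by auto
    then show "card {x \<in> V. r' x = g z} = card {x \<in> V. r x = z}" by simp
  qed
  finally show ?thesis by simp
qed

lemma kernel_sizes_merge:
  assumes "finite V" "a \<in> V" "b \<in> V" "r a \<noteq> r b"
    and k: "\<And>x y. x \<in> V \<Longrightarrow> y \<in> V \<Longrightarrow>
      r' x = r' y \<longleftrightarrow> r x = r y \<or> r x = r a \<and> r y = r b \<or> r x = r b \<and> r y = r a"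
  shows "kernel_sizes V r' + {#card {x \<in> V. r x = r a}, card {x \<in> V. r x = r b}#} =
    kernel_sizes V r + {#card {x \<in> V. r x = r a} + card {x \<in> V. r x = r b}#}"
proof -
  define q where "q x = (if r x = r b then r a else r x)" for x
  define Z where "Z = r ` V - {r a, r b}"
  have fin: "finite Z" using assms(1) by (simp add: Z_def)
  have 1: "r ` V = insert (r a) (insert (r b) Z)" using assms by (auto simp: Z_def)
  have 2: "q ` V = insert (r a) Z" using assms by (auto simp: Z_def q_def)
  have nZ: "r a \<notin> Z" "r b \<notin> Z" by (auto simp: Z_def)
  have "kernel_sizes V r' = kernel_sizes V q"
  proof (rule kernel_sizes_cong)
    fix x y assume "x \<in> V" "y \<in> V"
    from k[OF this] show "r' x = r' y \<longleftrightarrow> q x = q y" by (auto simp: q_def)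
  qed
  also have "\<dots> = add_mset (card {x \<in> V. q x = r a}) (image_mset (\<lambda>z. card {x \<in> V. q x = z}) (mset_set Z))"
    unfolding kernel_sizes_def 2 using fin nZ by simp
  also have "image_mset (\<lambda>z. card {x \<in> V. q x = z}) (mset_set Z) = image_mset (\<lambda>z. card {x \<in> V. r x = z}) (mset_set Z)"
  proof (rule image_mset_cong)
    fix z assume "z \<in># mset_set Z"
    then have "z \<in> Z" using fin by simp
    then have "{x \<in> V. q x = z} = {x \<in> V. r x = z}" using nZ by (auto simp: q_def)
    then show "card {x \<in> V. q x = z} = card {x \<in> V. r x = z}" by simp
  qed
  also have "card {x \<in> V. q x = r a} = card {x \<in> V. r x = r a} + card {x \<in> V. r x = r b}"
  proof -
    have "{x \<in> V. q x = r a} = {x \<in> V. r x = r a} \<union> {x \<in> V. r x = r b}" by (auto simp: q_def)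
    moreover have "{x \<in> V. r x = r a} \<inter> {x \<in> V. r x = r b} = {}" using assms by auto
    ultimately show ?thesis using assms(1) by (simp add: card_Un_disjoint)
  qed
  finally have 3: "kernel_sizes V r' = add_mset (card {x \<in> V. r x = r a} + card {x \<in> V. r x = r b})
      (image_mset (\<lambda>z. card {x \<in> V. r x = z}) (mset_set Z))" .
  have 4: "kernel_sizes V r = {#card {x \<in> V. r x = r a}, card {x \<in> V. r x = r b}#} +
      image_mset (\<lambda>z. card {x \<in> V. r x = z}) (mset_set Z)"
    unfolding kernel_sizes_def 1 using fin nZ assms by simp
  show ?thesis unfolding 3 4 by simp
qed

lemma sym_adj_rel: "sym (adj_rel E)"
  by (auto simp: sym_def adj_rel_def insert_commute)

lemma adj_rel_rtrancl_sym: "(x, y) \<in> (adj_rel E)\<^sup>* \<Longrightarrow> (y, x) \<in> (adj_rel E)\<^sup>*"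
  by (rule symD[OF sym_rtrancl[OF sym_adj_rel]])

lemma component_eq_iff:
  assumes "x \<in> V" "y \<in> V"
  shows "component V E x = component V E y \<longleftrightarrow> (x, y) \<in> (adj_rel E)\<^sup>*"
proof
  assume "component V E x = component V E y"
  then have "y \<in> component V E x" using assms by (auto simp: component_def)
  then show "(x, y) \<in> (adj_rel E)\<^sup>*" by (simp add: component_def)
next
  assume "(x, y) \<in> (adj_rel E)\<^sup>*"
  then show "component V E x = component V E y"
    by (auto simp: component_def intro: rtrancl_trans dest: adj_rel_rtrancl_sym)
qed

lemma adj_rel_rtrancl_mono: "E \<subseteq> E' \<Longrightarrow> (x, y) \<in> (adj_rel E)\<^sup>* \<Longrightarrow> (x, y) \<in> (adj_rel E')\<^sup>*"
  by (rule subsetD[OF rtrancl_mono]) (auto simp: adj_rel_def)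

lemma adj_rel_closed:
  assumes "(x, y) \<in> (adj_rel E)\<^sup>*" "x \<in> S"
    and "\<And>u w. u \<in> S \<Longrightarrow> {u, w} \<in> E \<Longrightarrow> w \<in> S"
  shows "y \<in> S"
  using assms(1) by induction (use assms in \<open>auto simp: adj_rel_def\<close>)

lemma adj_rel_rtrancl_insert:
  "(x, y) \<in> (adj_rel (insert {a, b} E))\<^sup>* \<longleftrightarrow>
    (x, y) \<in> (adj_rel E)\<^sup>* \<or>
    (x, a) \<in> (adj_rel E)\<^sup>* \<and> (b, y) \<in> (adj_rel E)\<^sup>* \<or>
    (x, b) \<in> (adj_rel E)\<^sup>* \<and> (a, y) \<in> (adj_rel E)\<^sup>*" (is "?l \<longleftrightarrow> ?r")
proof
  assume ?l
  then show ?r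
  proof induction
    case (step y z)
    then have "(y, z) \<in> adj_rel E \<or> y = a \<and> z = b \<or> y = b \<and> z = a"
      by (auto simp: adj_rel_def doubleton_eq_iff)
    with step.IH show ?case
      by (blast intro: rtrancl_into_rtrancl dest: adj_rel_rtrancl_sym)
  qed simp
next
  have m: "(u, w) \<in> (adj_rel E)\<^sup>* \<Longrightarrow> (u, w) \<in> (adj_rel (insert {a, b} E))\<^sup>*" for u w
    by (rule adj_rel_rtrancl_mono) auto
  have "(a, b) \<in> (adj_rel (insert {a, b} E))\<^sup>*" "(b, a) \<in> (adj_rel (insert {a, b} E))\<^sup>*"
    by (rule r_into_rtrancl, simp add: adj_rel_def insert_commute)+
  then show "?r \<Longrightarrow> ?l" by (blast intro: m rtrancl_trans)
qed

lemma component_vertices: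
  assumes "x \<in> V"
  shows "{y \<in> V. component V E y = component V E x} = component V E x"
proof -
  have "component V E y = component V E x \<longleftrightarrow> (x, y) \<in> (adj_rel E)\<^sup>*" if "y \<in> V" for y
    by (subst eq_commute) (rule component_eq_iff[OF assms that])
  then have "{y \<in> V. component V E y = component V E x} = {y \<in> V. (x, y) \<in> (adj_rel E)\<^sup>*}"
    by blast
  then show ?thesis by (simp add: component_def)
qed

lemma comp_sizes_insert:
  assumes "finite V" "a \<in> V" "b \<in> V" "(a, b) \<notin> (adj_rel E)\<^sup>*"
  shows "comp_sizes V (insert {a, b} E) + {#card (component V E a), card (component V E b)#} =
    comp_sizes V E + {#card (component V E a) + card (component V E b)#}"
proof -
  have "component V E a \<noteq> component V E b" using assms by (simp add: component_eq_iff)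
  note merge = kernel_sizes_merge[where r = "component V E" and r' = "component V (insert {a, b} E)",
    OF assms(1-3) this]
  have "component V (insert {a, b} E) x = component V (insert {a, b} E) y \<longleftrightarrow>
      component V E x = component V E y \<or>
      component V E x = component V E a \<and> component V E y = component V E b \<or>
      component V E x = component V E b \<and> component V E y = component V E a"
    if "x \<in> V" "y \<in> V" for x y
    using that assms(2,3) adj_rel_rtrancl_sym[of a y E] adj_rel_rtrancl_sym[of y a E]
      adj_rel_rtrancl_sym[of b y E] adj_rel_rtrancl_sym[of y b E]
    by (simp add: component_eq_iff adj_rel_rtrancl_insert) blast
  from merge[OF this] show ?thesis using assms(2,3) by (simp add: component_vertices)
qed

lemma comp_sizes_insert_connected:
  assumes "a \<in> V" "b \<in> V" "(a, b) \<in> (adj_rel E)\<^sup>*"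
  shows "comp_sizes V (insert {a, b} E) = comp_sizes V E"
proof (rule kernel_sizes_cong)
  fix x y assume "x \<in> V" "y \<in> V"
  then show "component V (insert {a, b} E) x = component V (insert {a, b} E) y \<longleftrightarrow>
      component V E x = component V E y"
    using assms(3) adj_rel_rtrancl_sym[OF assms(3)]
    by (simp add: component_eq_iff adj_rel_rtrancl_insert) (blast intro: rtrancl_trans)
qed

lemma component_card_pos: "finite V \<Longrightarrow> x \<in> V \<Longrightarrow> card (component V E x) > 0"
  by (auto simp: card_gt_0_iff component_def)

lemma comp_sizes_insert_less:
  assumes "finite V" "a \<in> V" "b \<in> V" "(a, b) \<notin> (adj_rel E)\<^sup>*"
  shows "comp_sizes V E < comp_sizes V (insert {a, b} E)"
proof -
  let ?a = "card (component V E a)" and ?b = "card (component V E b)"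
  have "{#?a, ?b#} < {#?a + ?b#}"
    using component_card_pos[OF assms(1)] assms by (intro ex_gt_imp_less_multiset) auto
  then have "comp_sizes V E + {#?a, ?b#} < comp_sizes V E + {#?a + ?b#}" by simp
  also have "\<dots> = comp_sizes V (insert {a, b} E) + {#?a, ?b#}"
    using comp_sizes_insert[OF assms] by simp
  finally show ?thesis by (metis add_less_cancel_right)
qed

lemma comp_sizes_mono:
  assumes "finite V" "finite L'" "L \<subseteq> L'" "\<forall>e\<in>L'. \<exists>a\<in>V. \<exists>b\<in>V. e = {a, b}"
  shows "comp_sizes V L \<le> comp_sizes V L'"
proof -
  have "comp_sizes V L \<le> comp_sizes V (L \<union> D)" if "finite D" "D \<subseteq> L'" for D
    using that
  proof (induction D rule: finite_induct)
    case (insert e D)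
    then obtain a b where ab: "a \<in> V" "b \<in> V" "e = {a, b}" using assms(4) by blast
    then have "comp_sizes V (L \<union> D) \<le> comp_sizes V (insert e (L \<union> D))"
      using comp_sizes_insert_less[OF assms(1) ab(1,2)] comp_sizes_insert_connected[OF ab(1,2)]
      by (metis order.order_iff_strict)
    with insert show ?case by auto
  qed simp
  from this[OF assms(2) order.refl] show ?thesis using assms(3) by (simp add: Un_absorb1)
qed

lemma comp_sizes_less:
  assumes "finite V" "finite L'" "L \<subseteq> L'" "\<forall>e\<in>L'. \<exists>a\<in>V. \<exists>b\<in>V. e = {a, b}"
    and "{a, b} \<in> L'" "a \<in> V" "b \<in> V" "(a, b) \<notin> (adj_rel L)\<^sup>*"
  shows "comp_sizes V L < comp_sizes V L'"
proof -
  have "comp_sizes V L < comp_sizes V (insert {a, b} L)"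
    using assms by (intro comp_sizes_insert_less)
  also have "\<dots> \<le> comp_sizes V L'" using assms by (intro comp_sizes_mono) auto
  finally show ?thesis .
qed

lemma rtrancl_isolated:
  assumes "(x, y) \<in> (adj_rel E)\<^sup>*" "x \<notin> \<Union>E"
  shows "y = x"
  using adj_rel_closed[of x y E "{x}"] assms by auto

lemma component_isolated: "x \<in> V \<Longrightarrow> x \<notin> \<Union>E \<Longrightarrow> component V E x = {x}"
  by (auto simp: component_def dest: rtrancl_isolated)

section \<open>Weighted chromatic functions and stars\<close>

definition wchrom :: "'a set \<Rightarrow> 'a set set \<Rightarrow> ('a \<Rightarrow> nat) \<Rightarrow> power_series" where
  "wchrom V E w m =
     of_nat (card {\<kappa> \<in> proper_colorings V E. (\<Sum>v\<in>V. replicate_mset (w v) (\<kappa> v)) = m})"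

lemma sum_singleton_mset: "(\<Sum>v\<in>A. {#f v#}) = image_mset f (mset_set A)"
  by (cases "finite A") (simp_all add: sum_unfold_sum_mset)

lemma chrom_sym_eq_wchrom: "chrom_sym V E = wchrom V E (\<lambda>_. 1)"
  by (simp add: fun_eq_iff chrom_sym_def wchrom_def sum_singleton_mset)

lemma finite_subset_mset: "finite {a. a \<subseteq># m}"
proof (induction m)
  case (add x m)
  have "{a. a \<subseteq># add_mset x m} \<subseteq> {a. a \<subseteq># m} \<union> add_mset x ` {a. a \<subseteq># m}"
  proof
    fix a assume "a \<in> {a. a \<subseteq># add_mset x m}"
    then have a: "a \<subseteq># add_mset x m" by simp
    show "a \<in> {a. a \<subseteq># m} \<union> add_mset x ` {a. a \<subseteq># m}"
    proof (cases "x \<in># a")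
      case True
      then obtain b where "a = add_mset x b" by (meson mset_add)
      with a show ?thesis by auto
    next
      case False
      have "count a y \<le> count m y" for y
        using mset_subset_eq_count[OF a, of y] False by (cases "y = x") (auto simp: not_in_iff)
      then show ?thesis by (simp add: subseteq_mset_def)
    qed
  qed
  then show ?case using add by (auto intro: finite_subset)
qed simp

lemma finite_wcolorings:
  assumes "finite V" "\<forall>v\<in>V. 0 < w v"
  shows "finite {\<kappa> \<in> proper_colorings V E. (\<Sum>v\<in>V. replicate_mset (w v) (\<kappa> v)) = m}"
proof (rule finite_subset)
  show "{\<kappa> \<in> proper_colorings V E. (\<Sum>v\<in>V. replicate_mset (w v) (\<kappa> v)) = m} \<subseteq> V \<rightarrow>\<^sub>E set_mset m"
  proof
    fix \<kappa> assume k: "\<kappa> \<in> {\<kappa> \<in> proper_colorings V E. (\<Sum>v\<in>V. replicate_mset (w v) (\<kappa> v)) = m}"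
    have "\<kappa> v \<in># m" if "v \<in> V" for v
    proof -
      have "\<kappa> v \<in># (\<Sum>v\<in>V. replicate_mset (w v) (\<kappa> v))"
        using assms that by (subst sum.remove[OF assms(1) that]) auto
      then show ?thesis using k by simp
    qed
    then show "\<kappa> \<in> V \<rightarrow>\<^sub>E set_mset m" using k by (auto simp: proper_colorings_def PiE_iff)
  qed
  show "finite (V \<rightarrow>\<^sub>E set_mset m)" using assms(1) by (intro finite_PiE) auto
qed

lemma wchrom_iso:
  assumes f: "bij_betw f V V'"
    and E: "\<And>x y. x \<in> V \<Longrightarrow> y \<in> V \<Longrightarrow> {x, y} \<in> E \<longleftrightarrow> {f x, f y} \<in> E'"
    and w: "\<And>v. v \<in> V \<Longrightarrow> w' (f v) = w v"
  shows "wchrom V E w = wchrom V' E' w'"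
proof
  fix m
  define A where "A = {\<kappa> \<in> proper_colorings V E. (\<Sum>v\<in>V. replicate_mset (w v) (\<kappa> v)) = m}"
  define B where "B = {\<kappa> \<in> proper_colorings V' E'. (\<Sum>v\<in>V'. replicate_mset (w' v) (\<kappa> v)) = m}"
  define g where "g = the_inv_into V f"
  have im: "f ` V = V'" and inj: "inj_on f V" using f by (auto simp: bij_betw_def)
  have gf: "g (f v) = v" if "v \<in> V" for v
    using that inj by (simp add: g_def the_inv_into_f_f)
  have fg: "f (g v) = v" "g v \<in> V" if "v \<in> V'" for v
    using that gf im by auto
  have sumeq: "(\<Sum>v\<in>V'. replicate_mset (w' v) (\<kappa> v)) = (\<Sum>v\<in>V. replicate_mset (w v) (\<kappa> (f v)))" for \<kappa>
    using w by (subst sum.reindex_bij_betw[OF f, symmetric]) simp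
  have "bij_betw (\<lambda>\<kappa>. restrict (\<kappa> \<circ> f) V) B A"
  proof (rule bij_betw_byWitness[where f' = "\<lambda>\<kappa>. restrict (\<kappa> \<circ> g) V'"])
    show "\<forall>\<kappa>\<in>B. restrict (restrict (\<kappa> \<circ> f) V \<circ> g) V' = \<kappa>"
      using fg by (auto simp: B_def proper_colorings_def PiE_iff extensional_def fun_eq_iff)
    show "\<forall>\<kappa>\<in>A. restrict (restrict (\<kappa> \<circ> g) V' \<circ> f) V = \<kappa>"
      using gf im by (auto simp: A_def proper_colorings_def PiE_iff extensional_def fun_eq_iff)
    show "(\<lambda>\<kappa>. restrict (\<kappa> \<circ> f) V) ` B \<subseteq> A"
      using E im by (auto simp: A_def B_def proper_colorings_def PiE_iff sumeq)
    show "(\<lambda>\<kappa>. restrict (\<kappa> \<circ> g) V') ` A \<subseteq> B"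
    proof (intro image_subsetI)
      fix \<kappa> assume k: "\<kappa> \<in> A"
      have "(\<Sum>v\<in>V'. replicate_mset (w' v) (restrict (\<kappa> \<circ> g) V' v)) = m"
      proof -
        have "(\<Sum>v\<in>V. replicate_mset (w v) (restrict (\<kappa> \<circ> g) V' (f v))) = (\<Sum>v\<in>V. replicate_mset (w v) (\<kappa> v))"
          using gf im by (intro sum.cong) auto
        moreover have "(\<Sum>v\<in>V. replicate_mset (w v) (\<kappa> v)) = m" using k by (simp add: A_def)
        ultimately show ?thesis by (simp only: sumeq)
      qed
      moreover have "\<kappa> (g x) \<noteq> \<kappa> (g y)" if "x \<in> V'" "y \<in> V'" "{x, y} \<in> E'" for x y
        using k E[of "g x" "g y"] fg[OF that(1)] fg[OF that(2)] that by (auto simp: A_def proper_colorings_def)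
      ultimately show "restrict (\<kappa> \<circ> g) V' \<in> B"
        by (simp add: B_def proper_colorings_def)
    qed
  qed
  then have "card B = card A" by (rule bij_betw_same_card)
  then show "wchrom V E w m = wchrom V' E' w' m" by (simp add: wchrom_def A_def B_def)
qed

lemma wchrom_disjoint_union:
  assumes fin: "finite V1" "finite V2" and dis: "V1 \<inter> V2 = {}"
    and E1: "\<forall>e\<in>E1. e \<subseteq> V1" "{} \<notin> E1" and E2: "\<forall>e\<in>E2. e \<subseteq> V2" "{} \<notin> E2"
    and w: "\<forall>v\<in>V1 \<union> V2. 0 < w v"
  shows "wchrom (V1 \<union> V2) (E1 \<union> E2) w = ps_mult (wchrom V1 E1 w) (wchrom V2 E2 w)"
proof
  fix m
  define s where "s V \<kappa> = (\<Sum>v\<in>V. replicate_mset (w v) (\<kappa> v :: nat))" for V \<kappa>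
  define A where "A a = {\<kappa> \<in> proper_colorings V1 E1. s V1 \<kappa> = a}" for a
  define B where "B b = {\<kappa> \<in> proper_colorings V2 E2. s V2 \<kappa> = b}" for b
  define C where "C = {\<kappa> \<in> proper_colorings (V1 \<union> V2) (E1 \<union> E2). s (V1 \<union> V2) \<kappa> = m}"
  define S where "S = (SIGMA a:{a. a \<subseteq># m}. A a \<times> B (m - a))"
  have finAB: "finite (A a)" "finite (B a)" for a
    unfolding A_def B_def s_def using fin w by (auto intro!: finite_wcolorings)
  have sC: "s (V1 \<union> V2) \<kappa> = s V1 \<kappa> + s V2 \<kappa>" for \<kappa>
    unfolding s_def using fin dis by (rule sum.union_disjoint)
  have sr: "s V (restrict \<kappa> V) = s V \<kappa>" for V \<kappa>
    unfolding s_def by (intro sum.cong) auto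
  define F where "F \<kappa> = (s V1 \<kappa>, restrict \<kappa> V1, restrict \<kappa> V2)" for \<kappa>
  define G where "G t = (case t of (a :: nat multiset, k1, k2) \<Rightarrow> (\<lambda>x. if x \<in> V1 then k1 x else k2 x :: nat))" for t
  have "bij_betw F C S"
  proof (rule bij_betw_byWitness[where f' = G])
    show "\<forall>\<kappa>\<in>C. G (F \<kappa>) = \<kappa>"
      by (auto simp: G_def F_def C_def proper_colorings_def PiE_iff extensional_def fun_eq_iff)
    show "F ` C \<subseteq> S"
    proof (intro image_subsetI)
      fix \<kappa> assume k: "\<kappa> \<in> C"
      then have m: "m = s V1 \<kappa> + s V2 \<kappa>" by (simp add: C_def sC)
      have "restrict \<kappa> V1 \<in> A (s V1 \<kappa>)" "restrict \<kappa> V2 \<in> B (s V2 \<kappa>)"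
        using k by (auto simp: A_def B_def C_def sr proper_colorings_def)
      then show "F \<kappa> \<in> S" by (simp add: S_def F_def m)
    qed
    have G12: "s V1 (G (a, k1, k2)) = s V1 k1" "s V2 (G (a, k1, k2)) = s V2 k2" for a k1 k2
      unfolding s_def G_def using dis by (auto intro!: sum.cong)
    show "\<forall>t\<in>S. F (G t) = t"
    proof
      fix t assume "t \<in> S"
      then obtain a k1 k2 where t: "t = (a, k1, k2)" "a \<subseteq># m" "k1 \<in> A a" "k2 \<in> B (m - a)"
        by (auto simp: S_def)
      have "restrict (G t) V1 = k1"
        using t(3) by (auto simp: t(1) G_def A_def proper_colorings_def PiE_iff extensional_def fun_eq_iff)
      moreover have "restrict (G t) V2 = k2"
        using t(4) dis by (auto simp: t(1) G_def B_def proper_colorings_def PiE_iff extensional_def fun_eq_iff)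
      moreover have "s V1 (G t) = a" using t(3) by (simp add: t(1) G12 A_def)
      ultimately show "F (G t) = t" by (simp add: F_def t(1))
    qed
    show "G ` S \<subseteq> C"
    proof (intro image_subsetI)
      fix t assume "t \<in> S"
      then obtain a k1 k2 where t: "t = (a, k1, k2)" "a \<subseteq># m" "k1 \<in> A a" "k2 \<in> B (m - a)"
        by (auto simp: S_def)
      have "s (V1 \<union> V2) (G t) = m"
        using t(2-4) by (simp add: sC t(1) G12 A_def B_def)
      moreover have "G t \<in> (V1 \<union> V2) \<rightarrow>\<^sub>E UNIV"
        using t(4) by (auto simp: t(1) G_def B_def proper_colorings_def PiE_iff extensional_def)
      moreover have "G t x \<noteq> G t y" if "{x, y} \<in> E1 \<union> E2" for x y
      proof (cases "{x, y} \<in> E1")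
        case True
        then have "x \<in> V1" "y \<in> V1" using E1 by auto
        with True t(3) show ?thesis by (simp add: t(1) G_def A_def proper_colorings_def)
      next
        case False
        with that have E: "{x, y} \<in> E2" by simp
        then have "x \<in> V2" "y \<in> V2" using E2 by auto
        moreover from this have "x \<notin> V1" "y \<notin> V1" using dis by auto
        ultimately show ?thesis using E t(4) by (simp add: t(1) G_def B_def proper_colorings_def)
      qed
      ultimately show "G t \<in> C" by (simp add: C_def proper_colorings_def)
    qed
  qed
  then have "card C = card S" by (rule bij_betw_same_card)
  also have "\<dots> = (\<Sum>a | a \<subseteq># m. card (A a) * card (B (m - a)))"
    unfolding S_def using finAB finite_subset_mset[of m] by (subst card_SigmaI) (auto simp: card_cartesian_product)
  finally show "wchrom (V1 \<union> V2) (E1 \<union> E2) w m = ps_mult (wchrom V1 E1 w) (wchrom V2 E2 w) m"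
    by (simp add: wchrom_def ps_mult_def C_def A_def B_def s_def)
qed

lemma chrom_sym_star:
  assumes "finite F" "c \<notin> F"
  shows "chrom_sym (insert c F) ((\<lambda>y. {y, c}) ` F) = star (Suc (card F))"
proof -
  obtain g where g: "bij_betw g F {1..card F}"
    using assms(1) by (metis ex_bij_betw_nat_finite_1 bij_betw_inv)
  define f where "f = g(c := 0)"
  have fc: "f c = 0" and fF: "\<And>x. x \<in> F \<Longrightarrow> f x = g x" using assms by (auto simp: f_def)
  have gp: "1 \<le> g x" "g x \<le> card F" if "x \<in> F" for x
    using bij_betwE[OF g] that by auto
  have "bij_betw f F {1..card F}" using g by (subst bij_betw_cong[where g = g]) (auto simp: fF)
  then have "bij_betw f (insert c F) (insert 0 {1..card F})"
    using assms(2) by (subst fc[symmetric], subst notIn_Un_bij_betw3[symmetric, where b = c, simplified]) (auto simp: fc)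
  also have "insert 0 {1..card F} = {..<Suc (card F)}" by auto
  finally have bij: "bij_betw f (insert c F) {..<Suc (card F)}" .
  show ?thesis unfolding star_def chrom_sym_eq_wchrom
  proof (rule wchrom_iso[OF bij])
    fix x y assume xy: "x \<in> insert c F" "y \<in> insert c F"
    have "{x, y} \<in> (\<lambda>y. {y, c}) ` F \<longleftrightarrow> x = c \<and> y \<in> F \<or> y = c \<and> x \<in> F"
      by (auto simp: doubleton_eq_iff)
    also have "\<dots> \<longleftrightarrow> {f x, f y} \<in> {{0, i} |i. 0 < i \<and> i < Suc (card F)}"
      using xy assms(2) gp by (auto simp: doubleton_eq_iff fc fF) (force dest: gp)+
    finally show "{x, y} \<in> (\<lambda>y. {y, c}) ` F \<longleftrightarrow> {f x, f y} \<in> {{0, i} |i. 0 < i \<and> i < Suc (card F)}" .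
  qed simp
qed

lemma chrom_sym_star_forest:
  assumes "finite C" "finite Y" "C \<inter> Y = {}" "r ` Y \<subseteq> C"
    and "mset l = image_mset (\<lambda>c. Suc (card {y \<in> Y. r y = c})) (mset_set C)"
  shows "chrom_sym (C \<union> Y) ((\<lambda>y. {y, r y}) ` Y) = star_part l"
  using assms
proof (induction l arbitrary: C Y)
  case Nil
  then have "C = {}" "Y = {}" by (auto simp: mset_set_empty_iff)
  moreover have "{\<kappa>. \<kappa> = (\<lambda>_. undefined)} = {\<lambda>_. undefined}" by simp
  ultimately show ?case
    by (auto simp: chrom_sym_def star_part_def ps_one_def proper_colorings_def simp flip: fun_eq_iff)
next
  case (Cons k l)
  then have "k \<in># image_mset (\<lambda>c. Suc (card {y \<in> Y. r y = c})) (mset_set C)"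
    by (metis list.set_intros(1) set_mset_mset)
  then obtain c where c: "c \<in> C" "k = Suc (card {y \<in> Y. r y = c})" using Cons.prems(1) by auto
  define F where "F = {y \<in> Y. r y = c}"
  have F: "finite F" "c \<notin> F" using Cons.prems c by (auto simp: F_def)
  have CY: "C \<union> Y = insert c F \<union> ((C - {c}) \<union> (Y - F))" using c by (auto simp: F_def)
  have E: "(\<lambda>y. {y, r y}) ` Y = (\<lambda>y. {y, c}) ` F \<union> (\<lambda>y. {y, r y}) ` (Y - F)" by (auto simp: F_def)
  have "mset l = image_mset (\<lambda>c. Suc (card {y \<in> Y. r y = c})) (mset_set (C - {c}))"
    using Cons.prems(1,5) c by (simp add: mset_set.remove[of C c])
  also have "\<dots> = image_mset (\<lambda>c. Suc (card {y \<in> Y - F. r y = c})) (mset_set (C - {c}))"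
    using Cons.prems(1) by (intro image_mset_cong arg_cong[where f = Suc] arg_cong[where f = card]) (auto simp: F_def)
  finally have l: "mset l = \<dots>" .
  have rest: "chrom_sym ((C - {c}) \<union> (Y - F)) ((\<lambda>y. {y, r y}) ` (Y - F)) = star_part l"
    using Cons.prems by (intro Cons.IH l) (auto simp: F_def)
  have "chrom_sym (C \<union> Y) ((\<lambda>y. {y, r y}) ` Y) =
     ps_mult (chrom_sym (insert c F) ((\<lambda>y. {y, c}) ` F))
       (chrom_sym ((C - {c}) \<union> (Y - F)) ((\<lambda>y. {y, r y}) ` (Y - F)))"
    unfolding CY E chrom_sym_eq_wchrom
    by (rule wchrom_disjoint_union) (use Cons.prems F c(1) in \<open>auto simp: F_def\<close>)
  also have "\<dots> = star_part (k # l)"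
    unfolding rest chrom_sym_star[OF F] by (simp add: star_part_def c(2) F_def)
  finally show ?case .
qed

section \<open>Linear independence of the star basis\<close>

lemma finite_partitions: "finite (partitions n)"
proof (rule finite_subset)
  show "partitions n \<subseteq> {l. set l \<subseteq> {..n} \<and> length l \<le> n}"
  proof
    fix l assume l: "l \<in> partitions n"
    then have "k \<le> n" if "k \<in> set l" for k
      using member_le_sum_list[OF that] by (simp add: partitions_def)
    moreover have "length l \<le> sum_list l"
      using l sum_list_mono[of l "\<lambda>_. 1" "\<lambda>k. k"] by (fastforce simp: partitions_def sum_list_triv Suc_le_eq)
    ultimately show "l \<in> {l. set l \<subseteq> {..n} \<and> length l \<le> n}"
      using l by (auto simp: partitions_def)
  qed
  show "finite {l. set l \<subseteq> {..n} \<and> length l \<le> n}"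
    by (rule finite_lists_length_le) simp
qed

lemma partition_of_mset:
  assumes "0 \<notin># M"
  obtains l where "l \<in> partitions (sum_mset M)" "mset l = M"
proof
  let ?l = "rev (sorted_list_of_multiset M)"
  show "mset ?l = M" by simp
  have "sum_list ?l = sum_mset M" by (metis mset_rev mset_sorted_list_of_multiset sum_mset_sum_list)
  moreover have "set ?l = set_mset M" by simp
  ultimately show "?l \<in> partitions (sum_mset M)"
    using assms by (auto simp: partitions_def sorted_wrt_rev sorted_sorted_list_of_multiset intro!: gr0I)
qed

lemma partition_eqI:
  assumes "l \<in> partitions n" "k \<in> partitions n" "mset l = mset k"
  shows "l = k"
proof -
  have "sorted (rev l)" "sorted (rev k)" using assms by (auto simp: partitions_def sorted_wrt_rev)
  then show ?thesis using assms(3) by (metis mset_rev properties_for_sort rev_rev_ident)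
qed

definition pp :: "nat list \<Rightarrow> power_series" where
  "pp l = wchrom {..<length l} {} ((!) l)"

lemma mset_nth: "mset l = image_mset ((!) l) (mset_set {..<length l})"
  by (metis atLeast0LessThan map_nth mset_map mset_set_upto_eq_mset_upto)

lemma wchrom_edgeless:
  assumes "finite C" "mset xs = image_mset w (mset_set C)"
  shows "wchrom C {} w = pp xs"
proof -
  have "\<exists>cs. mset cs = A \<and> map w cs = xs" if "mset xs = image_mset w A" for A
    using that
  proof (induction xs arbitrary: A)
    case (Cons x xs)
    then obtain A' c where A': "A = add_mset c A'" "w c = x" "image_mset w A' = mset xs"
      using msed_map_invR[of w A x "mset xs"] by auto
    obtain cs where "mset cs = A'" "map w cs = xs" using Cons.IH[OF A'(3)[symmetric]] by blast
    then show ?case by (intro exI[of _ "c # cs"]) (simp add: A')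
  qed simp
  then obtain cs where cs: "mset cs = mset_set C" "map w cs = xs" using assms(2) by blast
  have set: "set cs = C" by (metis assms(1) cs(1) finite_set_mset_mset_set set_mset_mset)
  have "distinct cs"
    by (metis assms(1) cs(1) set count_mset_set(1) count_mset_set(3) distinct_count_atmost_1)
  then have bij: "bij_betw ((!) cs) {..<length xs} C"
    using set cs(2) by (intro bij_betw_nth) auto
  have "wchrom {..<length xs} {} ((!) xs) = wchrom C {} w"
    by (rule wchrom_iso[OF bij]) (use cs(2) in auto)
  then show ?thesis by (simp add: pp_def)
qed

definition pspan :: "nat \<Rightarrow> nat \<Rightarrow> power_series \<Rightarrow> bool" where
  "pspan n k f \<longleftrightarrow> (\<exists>d. f = (\<lambda>m. \<Sum>l\<in>partitions n. d l * pp l m) \<and> (\<forall>l. length l \<le> k \<longrightarrow> d l = 0))"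

lemma pspan_pp:
  assumes "l \<in> partitions n" "k < length l"
  shows "pspan n k (pp l)"
  unfolding pspan_def
proof (intro exI conjI)
  show "pp l = (\<lambda>m. \<Sum>l'\<in>partitions n. of_bool (l' = l) * pp l' m)"
    using assms(1) finite_partitions[of n] by (auto simp: fun_eq_iff of_bool_def if_distrib[of "\<lambda>x. x * _"] cong: if_cong)
qed (use assms in auto)

lemma pspan_zero: "pspan n k (\<lambda>_. 0)"
  unfolding pspan_def by (rule exI[of _ "\<lambda>_. 0"]) simp

lemma pspan_linear:
  assumes "pspan n k f" "pspan n k g"
  shows "pspan n k (\<lambda>m. a * f m + b * g m)"
proof -
  obtain d e where "f = (\<lambda>m. \<Sum>l\<in>partitions n. d l * pp l m)" "\<forall>l. length l \<le> k \<longrightarrow> d l = 0"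
    "g = (\<lambda>m. \<Sum>l\<in>partitions n. e l * pp l m)" "\<forall>l. length l \<le> k \<longrightarrow> e l = 0"
    using assms by (auto simp: pspan_def)
  then show ?thesis unfolding pspan_def
    by (intro exI[of _ "\<lambda>l. a * d l + b * e l"])
      (simp add: sum_distrib_left sum.distrib[symmetric] algebra_simps)
qed

lemma pspan_mono: "pspan n k f \<Longrightarrow> k' \<le> k \<Longrightarrow> pspan n k' f"
  unfolding pspan_def by (elim exE conjE, rule exI) auto

text \<open>Colourings that give the leaf and its neighbour the same colour are colourings of the
  graph without the leaf in which the neighbour carries both weights.\<close>

lemma wchrom_leaf:
  assumes "finite V" "y \<in> V" "z \<in> V" "y \<noteq> z" "\<forall>e\<in>E. y \<notin> e" "\<forall>v\<in>V. 0 < w v"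
  shows "wchrom V (insert {y, z} E) w m =
    wchrom V E w m - wchrom (V - {y}) E (w(z := w z + w y)) m"
proof -
  define s where "s U w \<kappa> = (\<Sum>v\<in>U. replicate_mset (w v) (\<kappa> v :: nat))" for U w and \<kappa> :: "'a \<Rightarrow> nat"
  let ?w = "w(z := w z + w y)"
  define A where "A = {\<kappa> \<in> proper_colorings V (insert {y, z} E). s V w \<kappa> = m}"
  define B where "B = {\<kappa> \<in> proper_colorings V E. s V w \<kappa> = m}"
  define D where "D = {\<kappa> \<in> proper_colorings (V - {y}) E. s (V - {y}) ?w \<kappa> = m}"
  define N where "N = {\<kappa> \<in> B. \<kappa> y = \<kappa> z}"
  have fin: "finite A" "finite B"
    unfolding A_def B_def s_def using assms by (auto intro!: finite_wcolorings)
  have A: "A = B - N"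
    using assms(2-4) by (auto simp: A_def B_def N_def proper_colorings_def doubleton_eq_iff)
  have s: "s V w \<kappa> = s (V - {y}) ?w \<kappa>" if "\<kappa> y = \<kappa> z" for \<kappa>
  proof -
    have z: "z \<in> V - {y}" using assms by simp
    have "s V w \<kappa> = replicate_mset (w y) (\<kappa> y) + (replicate_mset (w z) (\<kappa> z) + s (V - {y} - {z}) w \<kappa>)"
      unfolding s_def using assms(1,2) z by (subst sum.remove[OF assms(1,2)], subst sum.remove[OF _ z]) auto
    also have "s (V - {y} - {z}) w \<kappa> = s (V - {y} - {z}) ?w \<kappa>"
      unfolding s_def by (intro sum.cong) auto
    also have "replicate_mset (w y) (\<kappa> y) + (replicate_mset (w z) (\<kappa> z) + \<dots>) =
       replicate_mset (?w z) (\<kappa> z) + \<dots>"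
      using that by (simp add: multiset_eq_iff)
    also have "\<dots> = s (V - {y}) ?w \<kappa>"
      unfolding s_def using assms(1) z by (subst (2) sum.remove[of _ z]) auto
    finally show ?thesis .
  qed
  have sr: "s (V - {y}) ?w (restrict \<kappa> (V - {y})) = s (V - {y}) ?w \<kappa>" for \<kappa>
    unfolding s_def by (intro sum.cong) auto
  have su: "s (V - {y}) ?w (\<kappa>(y := c)) = s (V - {y}) ?w \<kappa>" for \<kappa> c
    unfolding s_def by (intro sum.cong) auto
  have "bij_betw (\<lambda>\<kappa>. restrict \<kappa> (V - {y})) N D"
  proof (rule bij_betw_byWitness[where f' = "\<lambda>\<kappa>. \<kappa>(y := \<kappa> z)"])
    show "\<forall>\<kappa>\<in>N. (restrict \<kappa> (V - {y}))(y := restrict \<kappa> (V - {y}) z) = \<kappa>"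
      using assms(2-4) by (auto simp: N_def B_def proper_colorings_def PiE_iff extensional_def fun_eq_iff)
    show "\<forall>\<kappa>\<in>D. restrict (\<kappa>(y := \<kappa> z)) (V - {y}) = \<kappa>"
      by (auto simp: D_def proper_colorings_def PiE_iff extensional_def fun_eq_iff)
    show "(\<lambda>\<kappa>. restrict \<kappa> (V - {y})) ` N \<subseteq> D"
      using s by (auto simp: N_def B_def D_def proper_colorings_def sr)
    show "(\<lambda>\<kappa>. \<kappa>(y := \<kappa> z)) ` D \<subseteq> N"
    proof (intro image_subsetI)
      fix \<kappa> assume k: "\<kappa> \<in> D"
      have "s V w (\<kappa>(y := \<kappa> z)) = m"
        using k s[of "\<kappa>(y := \<kappa> z)"] assms(4) by (simp add: D_def su)
      moreover have "\<kappa>(y := \<kappa> z) \<in> V \<rightarrow>\<^sub>E UNIV"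
        using k assms(2) by (auto simp: D_def proper_colorings_def PiE_iff extensional_def)
      moreover have "(\<kappa>(y := \<kappa> z)) p \<noteq> (\<kappa>(y := \<kappa> z)) q" if "p \<in> V" "q \<in> V" "{p, q} \<in> E" for p q
      proof -
        have "p \<noteq> y" "q \<noteq> y" using assms(5) that(3) by auto
        then show ?thesis using k that by (auto simp: D_def proper_colorings_def)
      qed
      ultimately show "\<kappa>(y := \<kappa> z) \<in> N"
        using assms(4) by (simp add: N_def B_def proper_colorings_def)
    qed
  qed
  then have "card N = card D" by (rule bij_betw_same_card)
  moreover have "card A = card B - card N" "card N \<le> card B"
    using fin by (auto simp: A N_def card_Diff_subset intro!: card_mono)
  ultimately have "(of_nat (card A) :: rat) = of_nat (card B) - of_nat (card D)"
    by (simp add: of_nat_diff)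
  then show ?thesis by (simp add: wchrom_def A_def B_def D_def s_def)
qed

lemma wchrom_star_forest_pspan:
  assumes "finite Y" "finite C" "C \<inter> Y = {}" "r ` Y \<subseteq> C" "\<forall>v\<in>C \<union> Y. 0 < w v" "l \<in> partitions n"
    and "mset l = image_mset (\<lambda>c. w c + (\<Sum>y | y \<in> Y \<and> r y = c. w y)) (mset_set C)"
  shows "\<exists>g. pspan n (card C) g \<and>
    wchrom (C \<union> Y) ((\<lambda>y. {y, r y}) ` Y) w = (\<lambda>m. (- 1) ^ card Y * pp l m + g m)"
  using assms
proof (induction Y arbitrary: C w l rule: finite_induct)
  case empty
  then have "wchrom C {} w = pp l" by (intro wchrom_edgeless) simp_all
  then show ?case using pspan_zero by (intro exI[of _ "\<lambda>_. 0"]) simp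
next
  case (insert y Y)
  let ?E = "(\<lambda>y. {y, r y}) ` Y" and ?w = "w(r y := w (r y) + w y)"
  have ry: "r y \<in> C" "r y \<noteq> y" "r y \<notin> Y" "y \<notin> C" using insert.prems by auto
  have fib: "{y' \<in> insert y Y. r y' = c} = (if c = r y then insert y {y' \<in> Y. r y' = c} else {y' \<in> Y. r y' = c})" for c
    by auto
  have n: "n = (\<Sum>v\<in>C \<union> insert y Y. w v)"
  proof -
    have "n = sum_mset (mset l)" using insert.prems(5) by (simp add: partitions_def sum_mset_sum_list)
    also have "\<dots> = (\<Sum>c\<in>C. w c + (\<Sum>y' | y' \<in> insert y Y \<and> r y' = c. w y'))"
      unfolding insert.prems(6) by (rule sum_unfold_sum_mset[symmetric])
    also have "\<dots> = (\<Sum>c\<in>C. w c) + (\<Sum>y\<in>insert y Y. w y)"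
      using insert.prems(1,3) insert.hyps(1) by (simp only: sum.distrib) (subst sum.group, auto)
    also have "\<dots> = (\<Sum>v\<in>C \<union> insert y Y. w v)"
      using insert.prems insert.hyps by (subst sum.union_disjoint) auto
    finally show ?thesis .
  qed
  let ?M = "image_mset (\<lambda>c. w c + (\<Sum>y' | y' \<in> Y \<and> r y' = c. w y')) (mset_set (insert y C))"
  have "\<forall>c\<in>insert y C. w c \<noteq> 0" using insert.prems(4) by fastforce
  then have "0 \<notin># ?M" using insert.prems(1) by auto
  then obtain l1 where l1: "l1 \<in> partitions (sum_mset ?M)" "mset l1 = ?M" by (rule partition_of_mset)
  have "sum_mset ?M = (\<Sum>c\<in>insert y C. w c + (\<Sum>y' | y' \<in> Y \<and> r y' = c. w y'))"
    by (rule sum_unfold_sum_mset[symmetric])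
  also have "\<dots> = (\<Sum>c\<in>insert y C. w c) + (\<Sum>y'\<in>Y. w y')"
    using insert.prems(1,3) insert.hyps(1) by (simp only: sum.distrib) (subst sum.group, auto)
  also have "\<dots> = n"
    unfolding n using insert.prems insert.hyps by (subst sum.union_disjoint) auto
  finally have l1n: "l1 \<in> partitions n" using l1(1) by simp
  have len: "length l1 = card (insert y C)"
    using arg_cong[OF l1(2), of size] by simp
  obtain g1 where g1: "pspan n (card (insert y C)) g1"
    "wchrom (insert y C \<union> Y) ?E w = (\<lambda>m. (- 1) ^ card Y * pp l1 m + g1 m)"
    using insert.IH[of "insert y C" w l1] insert.prems insert.hyps l1n l1(2) by auto
  have lw: "mset l = image_mset (\<lambda>c. ?w c + (\<Sum>y' | y' \<in> Y \<and> r y' = c. ?w y')) (mset_set C)"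
    unfolding insert.prems(6)
  proof (rule image_mset_cong)
    fix c assume "c \<in># mset_set C"
    then have c: "c \<in> C" using insert.prems(1) by simp
    have "(\<Sum>y' | y' \<in> Y \<and> r y' = c. ?w y') = (\<Sum>y' | y' \<in> Y \<and> r y' = c. w y')"
      using ry by (intro sum.cong) auto
    then show "w c + (\<Sum>y' | y' \<in> insert y Y \<and> r y' = c. w y') = ?w c + (\<Sum>y' | y' \<in> Y \<and> r y' = c. ?w y')"
      using insert.hyps unfolding fib by simp
  qed
  have "\<exists>g. pspan n (card C) g \<and> wchrom (C \<union> Y) ?E ?w = (\<lambda>m. (- 1) ^ card Y * pp l m + g m)"
    by (rule insert.IH[OF _ _ _ _ _ lw]) (use insert.prems(1-5) in auto)
  then obtain g2 where g2: "pspan n (card C) g2"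
    "wchrom (C \<union> Y) ?E ?w = (\<lambda>m. (- 1) ^ card Y * pp l m + g2 m)" by blast
  have V: "C \<union> insert y Y = insert y C \<union> Y" "insert y C \<union> Y - {y} = C \<union> Y"
    using insert.hyps ry by auto
  have "wchrom (insert y C \<union> Y) (insert {y, r y} ?E) w m =
      wchrom (insert y C \<union> Y) ?E w m - wchrom (insert y C \<union> Y - {y}) ?E ?w m" for m
    using insert.prems insert.hyps ry by (intro wchrom_leaf) auto
  then have "wchrom (C \<union> insert y Y) ((\<lambda>y. {y, r y}) ` insert y Y) w m =
      ((- 1) ^ card Y * pp l1 m + g1 m) - ((- 1) ^ card Y * pp l m + g2 m)" for m
    unfolding V image_insert g1(2) g2(2) by blast
  then have "wchrom (C \<union> insert y Y) ((\<lambda>y. {y, r y}) ` insert y Y) w =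
      (\<lambda>m. (- 1) ^ card (insert y Y) * pp l m + ((- 1) ^ card Y * pp l1 m + 1 * (1 * g1 m + (-1) * g2 m)))"
    using insert.hyps(1,2) by (simp add: fun_eq_iff)
  moreover have "pspan n (card C) (\<lambda>m. (- 1) ^ card Y * pp l1 m + 1 * (1 * g1 m + (-1) * g2 m))"
    using insert.prems(1) ry(4) by (intro pspan_linear pspan_pp[OF l1n] g2(1) pspan_mono[OF g1(1)]) (auto simp: len)
  ultimately show ?case by blast
qed

lemma star_part_pspan:
  assumes "l \<in> partitions n"
  shows "\<exists>g \<epsilon>. \<epsilon> \<noteq> 0 \<and> pspan n (length l) g \<and> star_part l = (\<lambda>m. \<epsilon> * pp l m + g m)"
proof -
  define C where "C = (\<lambda>i. (i, 0::nat)) ` {..<length l}"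
  define Y where "Y = (SIGMA i:{..<length l}. {1..<l ! i})"
  define r where "r = (\<lambda>(i :: nat, j :: nat). (i, 0 :: nat))"
  have fin: "finite C" "finite Y" and CY: "C \<inter> Y = {}" "r ` Y \<subseteq> C"
    by (auto simp: C_def Y_def r_def)
  have inj: "inj_on (\<lambda>i. (i, 0::nat)) {..<length l}" by (auto simp: inj_on_def)
  have fib: "{y \<in> Y. r y = (i, 0)} = {i} \<times> {1..<l ! i}" if "i < length l" for i
    using that by (auto simp: Y_def r_def)
  have "image_mset (\<lambda>c. Suc (card {y \<in> Y. r y = c})) (mset_set C) =
    image_mset (\<lambda>i. Suc (card {y \<in> Y. r y = (i, 0)})) (mset_set {..<length l})"
    unfolding C_def by (simp flip: image_mset_mset_set[OF inj] add: multiset.map_comp comp_def)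
  also have "\<dots> = image_mset ((!) l) (mset_set {..<length l})"
  proof (rule image_mset_cong)
    fix i assume "i \<in># mset_set {..<length l}"
    then have "i < length l" by simp
    moreover from this have "0 < l ! i" using assms nth_mem by (auto simp: partitions_def)
    ultimately show "Suc (card {y \<in> Y. r y = (i, 0)}) = l ! i"
      by (simp add: fib card_cartesian_product)
  qed
  also have "\<dots> = mset l"
    by (rule mset_nth[symmetric])
  finally have M: "mset l = image_mset (\<lambda>c. Suc (card {y \<in> Y. r y = c})) (mset_set C)" ..
  have "card C = length l" using inj by (simp add: C_def card_image)
  moreover have "star_part l = wchrom (C \<union> Y) ((\<lambda>y. {y, r y}) ` Y) (\<lambda>_. 1)"
    using chrom_sym_star_forest[OF fin CY M] by (simp add: chrom_sym_eq_wchrom)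
  ultimately show ?thesis
    using wchrom_star_forest_pspan[OF fin(2,1) CY, of "\<lambda>_. 1" l n] assms M
    by (auto intro!: exI[of _ "(- 1) ^ card Y"])
qed

text \<open>The monomial in which every part of \<open>l\<close> has its own variable occurs in \<open>pp k\<close> only if
  \<open>k\<close> refines \<open>l\<close>.\<close>

lemma pp_triangular:
  assumes l: "l \<in> partitions n" and k: "k \<in> partitions n" "length k \<le> length l"
    and m: "m = (\<Sum>i<length l. replicate_mset (l ! i) i)"
  shows "pp k m \<noteq> 0 \<longleftrightarrow> k = l"
proof -
  define A where "A = {\<kappa> \<in> proper_colorings {..<length k} {}. (\<Sum>v\<in>{..<length k}. replicate_mset (k ! v) (\<kappa> v)) = m}"
  have pos: "0 < l ! i" if "i < length l" for i
    using l that nth_mem by (auto simp: partitions_def)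
  have posk: "0 < k ! i" if "i < length k" for i
    using k(1) that nth_mem by (auto simp: partitions_def)
  have fin: "finite A" unfolding A_def using posk by (intro finite_wcolorings) auto
  have cnt: "count m i = l ! i" if "i < length l" for i
  proof -
    have "count m i = (\<Sum>j<length l. if i = j then l ! j else 0)"
      by (simp add: m count_sum if_distrib eq_commute cong: if_cong)
    then show ?thesis using that by simp
  qed
  have setm: "i \<in># m \<longleftrightarrow> i < length l" for i
  proof -
    have "count m i = (\<Sum>j<length l. if i = j then l ! j else 0)"
      by (simp add: m count_sum if_distrib eq_commute cong: if_cong)
    then have "count m i = (if i < length l then l ! i else 0)" by simp
    then show ?thesis using pos by (auto simp flip: count_greater_zero_iff)
  qed
  have "A \<noteq> {} \<longleftrightarrow> k = l"
  proof
    assume "k = l"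
    then have "restrict id {..<length k} \<in> A"
      by (auto simp: A_def m proper_colorings_def intro!: sum.cong)
    then show "A \<noteq> {}" by blast
  next
    assume "A \<noteq> {}"
    then obtain \<kappa> where "\<kappa> \<in> A" by blast
    then have sum: "(\<Sum>v<length k. replicate_mset (k ! v) (\<kappa> v)) = m" by (simp add: A_def)
    have "i \<in> \<kappa> ` {..<length k}" if "i < length l" for i
    proof -
      have "i \<in># (\<Sum>v<length k. replicate_mset (k ! v) (\<kappa> v))" using that by (simp add: sum setm)
      then show ?thesis by (auto simp: set_mset_sum split: if_splits)
    qed
    then have sub: "{..<length l} \<subseteq> \<kappa> ` {..<length k}" by blast
    then have "length l \<le> card (\<kappa> ` {..<length k})"
      by (metis card_lessThan card_mono finite_imageI finite_lessThan)
    moreover have "card (\<kappa> ` {..<length k}) \<le> length k" by (metis card_image_le card_lessThan finite_lessThan)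
    ultimately have len: "length k = length l" and c: "card (\<kappa> ` {..<length k}) = length k"
      using k(2) by auto
    have inj: "inj_on \<kappa> {..<length k}" by (rule eq_card_imp_inj_on) (simp_all add: c)
    have "{..<length l} = \<kappa> ` {..<length k}"
      by (rule card_subset_eq) (simp, fact sub, simp add: c len[symmetric])
    then have im: "\<kappa> ` {..<length k} = {..<length k}" unfolding len[symmetric] by (rule sym)
    have "l ! (\<kappa> v) = k ! v" if "v < length k" for v
    proof -
      have "\<kappa> v \<in> \<kappa> ` {..<length k}" using that by simp
      then have "\<kappa> v < length l" unfolding im by (simp add: len)
      then have "l ! (\<kappa> v) = count m (\<kappa> v)" by (simp add: cnt)
      also have "\<dots> = (\<Sum>u<length k. if u = v then k ! u else 0)"
        using inj that unfolding sum[symmetric] count_sum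
        by (intro sum.cong) (auto simp: inj_on_def)
      finally show ?thesis using that by simp
    qed
    then have "mset k = image_mset (\<lambda>v. l ! (\<kappa> v)) (mset_set {..<length k})"
      unfolding mset_nth by (intro image_mset_cong) simp
    also have "\<dots> = image_mset ((!) l) (image_mset \<kappa> (mset_set {..<length k}))"
      by (simp add: multiset.map_comp comp_def)
    also have "\<dots> = mset l"
      unfolding image_mset_mset_set[OF inj] im by (simp only: len mset_nth[symmetric])
    finally show "k = l" using k(1) l by (intro partition_eqI)
  qed
  moreover have "pp k m = of_nat (card A)" by (simp add: pp_def wchrom_def A_def)
  ultimately show ?thesis using fin by simp
qed

lemma pp_independent:
  assumes "\<And>m. (\<Sum>l\<in>partitions n. d l * pp l m) = 0" "l \<in> partitions n"
  shows "d l = 0"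
proof (rule ccontr)
  assume "d l \<noteq> 0"
  define D where "D = {l \<in> partitions n. d l \<noteq> 0}"
  have D: "finite D" "D \<noteq> {}" using assms(2) \<open>d l \<noteq> 0\<close> finite_partitions[of n] by (auto simp: D_def)
  then have "Max (length ` D) \<in> length ` D" by (intro Max_in) auto
  then obtain k where "k \<in> D" "length k = Max (length ` D)" by auto
  then have k: "k \<in> D" "\<And>k'. k' \<in> D \<Longrightarrow> length k' \<le> length k"
    using D(1) by auto
  let ?m = "\<Sum>i<length k. replicate_mset (k ! i) i"
  have tri: "pp k' ?m \<noteq> 0 \<longleftrightarrow> k' = k" if "k' \<in> D" for k'
    using pp_triangular[of k n k' ?m] k that by (auto simp: D_def)
  have "(\<Sum>l\<in>partitions n. d l * pp l ?m) = (\<Sum>l\<in>D. d l * pp l ?m)"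
    using finite_partitions[of n] by (intro sum.mono_neutral_right) (auto simp: D_def)
  also have "\<dots> = (\<Sum>l\<in>D. if l = k then d k * pp k ?m else 0)"
    using tri by (intro sum.cong) auto
  also have "\<dots> = d k * pp k ?m" using D(1) k(1) by simp
  finally show False using assms(1)[of ?m] k(1) tri[OF k(1)] by (simp add: D_def)
qed

lemma star_part_independent:
  assumes zero: "\<And>m. (\<Sum>l\<in>partitions n. c l * star_part l m) = 0" and "l \<in> partitions n"
  shows "c l = 0"
proof (rule ccontr)
  assume "c l \<noteq> 0"
  define D where "D = {l \<in> partitions n. c l \<noteq> 0}"
  have D: "finite D" "D \<noteq> {}" using assms(2) \<open>c l \<noteq> 0\<close> finite_partitions[of n] by (auto simp: D_def)
  then have "Min (length ` D) \<in> length ` D" by (intro Min_in) auto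
  then obtain k where "k \<in> D" "length k = Min (length ` D)" by auto
  then have k: "k \<in> D" "\<And>k'. k' \<in> D \<Longrightarrow> length k \<le> length k'"
    using D(1) by auto
  have "\<exists>\<epsilon> d. \<epsilon> \<noteq> 0 \<and> (\<forall>l'. length l' \<le> length l \<longrightarrow> d l' = 0) \<and>
      star_part l = (\<lambda>m. \<epsilon> * pp l m + (\<Sum>l'\<in>partitions n. d l' * pp l' m))"
    if "l \<in> partitions n" for l
    using star_part_pspan[OF that] unfolding pspan_def by blast
  then have "\<forall>l\<in>partitions n. \<exists>e. fst e \<noteq> (0 :: rat) \<and> (\<forall>l'. length l' \<le> length l \<longrightarrow> snd e l' = 0) \<and>
      star_part l = (\<lambda>m. fst e * pp l m + (\<Sum>l'\<in>partitions n. snd e l' * pp l' m))"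
    by fastforce
  from bchoice[OF this] obtain e where e: "\<forall>l\<in>partitions n. fst (e l) \<noteq> (0 :: rat) \<and>
      (\<forall>l'. length l' \<le> length l \<longrightarrow> snd (e l) l' = 0) \<and>
      star_part l = (\<lambda>m. fst (e l) * pp l m + (\<Sum>l'\<in>partitions n. snd (e l) l' * pp l' m))" ..
  define \<epsilon> d where "\<epsilon> l = fst (e l)" and "d l = snd (e l)" for l
  have d: "\<And>l. l \<in> partitions n \<Longrightarrow> \<epsilon> l \<noteq> 0"
    "\<And>l l'. l \<in> partitions n \<Longrightarrow> length l' \<le> length l \<Longrightarrow> d l l' = 0"
    "\<And>l. l \<in> partitions n \<Longrightarrow> star_part l = (\<lambda>m. \<epsilon> l * pp l m + (\<Sum>l'\<in>partitions n. d l l' * pp l' m))"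
    using e unfolding \<epsilon>_def d_def by blast+
  have "(\<Sum>l'\<in>partitions n. (c l' * \<epsilon> l' + (\<Sum>l\<in>partitions n. c l * d l l')) * pp l' m) = 0" for m
  proof -
    have "(\<Sum>l'\<in>partitions n. (c l' * \<epsilon> l' + (\<Sum>l\<in>partitions n. c l * d l l')) * pp l' m) =
      (\<Sum>l'\<in>partitions n. c l' * \<epsilon> l' * pp l' m) + (\<Sum>l'\<in>partitions n. \<Sum>l\<in>partitions n. c l * d l l' * pp l' m)"
      by (simp add: distrib_right sum.distrib sum_distrib_right)
    also have "(\<Sum>l'\<in>partitions n. \<Sum>l\<in>partitions n. c l * d l l' * pp l' m) =
      (\<Sum>l\<in>partitions n. \<Sum>l'\<in>partitions n. c l * d l l' * pp l' m)" by (rule sum.swap)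
    also have "(\<Sum>l'\<in>partitions n. c l' * \<epsilon> l' * pp l' m) + \<dots> = (\<Sum>l\<in>partitions n. c l * star_part l m)"
      by (simp add: d(3) algebra_simps sum.distrib sum_distrib_left)
    finally show ?thesis using zero by simp
  qed
  from pp_independent[OF this, of k] k(1)
  have "c k * \<epsilon> k + (\<Sum>l\<in>partitions n. c l * d l k) = 0" by (simp add: D_def)
  moreover have "(\<Sum>l\<in>partitions n. c l * d l k) = 0"
    using k(2) d(2) by (intro sum.neutral) (auto simp: D_def)
  ultimately show False using k(1) d(1) by (simp add: D_def)
qed

section \<open>Leading coefficients\<close>

text \<open>On the partitions of a number, the multiset order is the lexicographic order of the statement
  (\<open>lexord_if_mset_less\<close> below).\<close>

definition star_lead :: "nat \<Rightarrow> power_series \<Rightarrow> nat multiset \<Rightarrow> rat \<Rightarrow> bool" where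
  "star_lead n f \<Lambda> a \<longleftrightarrow> (\<exists>c. (\<forall>l. l \<notin> partitions n \<longrightarrow> c l = 0) \<and>
     f = (\<lambda>m. \<Sum>l\<in>partitions n. c l * star_part l m) \<and>
     (\<forall>l. mset l < \<Lambda> \<longrightarrow> c l = 0) \<and> (\<forall>l\<in>partitions n. mset l = \<Lambda> \<longrightarrow> c l = a))"

lemma star_lead_star_part:
  assumes "l \<in> partitions n"
  shows "star_lead n (star_part l) (mset l) 1"
  unfolding star_lead_def
proof (intro exI conjI)
  let ?c = "\<lambda>k. if k = l then 1 else 0 :: rat"
  show "star_part l = (\<lambda>m. \<Sum>k\<in>partitions n. ?c k * star_part k m)"
    using assms finite_partitions[of n] by (simp add: fun_eq_iff if_distrib[of "\<lambda>x. x * _"] cong: if_cong)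
  show "\<forall>k\<in>partitions n. mset k = mset l \<longrightarrow> ?c k = 1"
    using assms by (auto intro: partition_eqI)
qed (use assms in auto)

lemma star_lead_zero: "star_lead n (\<lambda>_. 0) \<Lambda> 0"
  unfolding star_lead_def by (rule exI[of _ "\<lambda>_. 0"]) simp

lemma star_lead_linear:
  assumes "star_lead n f \<Lambda> a" "star_lead n g \<Lambda> b"
  shows "star_lead n (\<lambda>m. s * f m + t * g m) \<Lambda> (s * a + t * b)"
proof -
  from assms(1) obtain c where c: "\<forall>l. l \<notin> partitions n \<longrightarrow> c l = 0"
    "f = (\<lambda>m. \<Sum>l\<in>partitions n. c l * star_part l m)"
    "\<forall>l. mset l < \<Lambda> \<longrightarrow> c l = 0" "\<forall>l\<in>partitions n. mset l = \<Lambda> \<longrightarrow> c l = a"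
    unfolding star_lead_def by blast
  from assms(2) obtain d where d: "\<forall>l. l \<notin> partitions n \<longrightarrow> d l = 0"
    "g = (\<lambda>m. \<Sum>l\<in>partitions n. d l * star_part l m)"
    "\<forall>l. mset l < \<Lambda> \<longrightarrow> d l = 0" "\<forall>l\<in>partitions n. mset l = \<Lambda> \<longrightarrow> d l = b"
    unfolding star_lead_def by blast
  show ?thesis unfolding star_lead_def
  proof (intro exI conjI)
    show "(\<lambda>m. s * f m + t * g m) = (\<lambda>m. \<Sum>l\<in>partitions n. (s * c l + t * d l) * star_part l m)"
      by (simp add: c(2) d(2) distrib_right sum.distrib sum_distrib_left mult.assoc)
  qed (use c d in auto)
qed

lemma star_lead_sum:
  assumes "finite I" "\<And>i. i \<in> I \<Longrightarrow> star_lead n (f i) \<Lambda> (a i)"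
  shows "star_lead n (\<lambda>m. \<Sum>i\<in>I. s i * f i m) \<Lambda> (\<Sum>i\<in>I. s i * a i)"
  using assms
proof (induction I rule: finite_induct)
  case (insert i I)
  then show ?case
    using star_lead_linear[of n "f i" \<Lambda> "a i" "\<lambda>m. \<Sum>i\<in>I. s i * f i m" "\<Sum>i\<in>I. s i * a i" "s i" 1] by simp
qed (simp add: star_lead_zero)

lemma star_lead_less:
  assumes "star_lead n f \<Lambda>' a" "\<Lambda> < \<Lambda>'"
  shows "star_lead n f \<Lambda> 0"
proof -
  from assms(1) obtain c where c: "\<forall>l. l \<notin> partitions n \<longrightarrow> c l = 0"
    "f = (\<lambda>m. \<Sum>l\<in>partitions n. c l * star_part l m)" "\<forall>l. mset l < \<Lambda>' \<longrightarrow> c l = 0"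
    unfolding star_lead_def by blast
  have "\<forall>l. mset l < \<Lambda> \<longrightarrow> c l = 0" "\<forall>l\<in>partitions n. mset l = \<Lambda> \<longrightarrow> c l = 0"
    using c(3) assms(2) by (auto dest: less_trans)
  then show ?thesis using c(1,2) unfolding star_lead_def by blast
qed

lemma lexord_if_mset_less:
  fixes l k :: "nat list"
  assumes "sorted_wrt (\<ge>) l" "sorted_wrt (\<ge>) k" "mset l < mset k"
  shows "(l, k) \<in> lexord less_than"
  using assms
proof (induction l arbitrary: k)
  case Nil
  then show ?case by (cases k) auto
next
  case (Cons x l)
  obtain y k' where k: "k = y # k'" using Cons.prems(3) by (cases k) auto
  consider "x < y" | "x = y" | "y < x" by linarith
  then show ?case
  proof cases
    case 2
    then show ?thesis using Cons k by auto
  next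
    case 3
    then have "\<forall>z. z \<in># mset k \<longrightarrow> z < x" using Cons.prems(2) by (auto simp: k)
    then have "mset k < mset (x # l)" by (intro ex_gt_imp_less_multiset) auto
    then show ?thesis using Cons.prems(3) by auto
  qed (auto simp: k)
qed

lemma lead_coeff_eqI:
  assumes "star_lead n f (mset l) a" "l \<in> partitions n" "a \<noteq> 0"
  shows "lead_coeff n f = a"
proof -
  from assms(1) obtain c where c: "\<forall>k. k \<notin> partitions n \<longrightarrow> c k = 0"
    "f = (\<lambda>m. \<Sum>k\<in>partitions n. c k * star_part k m)"
    "\<forall>k. mset k < mset l \<longrightarrow> c k = 0" "\<forall>k\<in>partitions n. mset k = mset l \<longrightarrow> c k = a"
    unfolding star_lead_def by blast
  have coeffs: "star_coeffs n f = c"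
    unfolding star_coeffs_def
  proof (rule the_equality)
    fix d assume d: "(\<forall>k. k \<notin> partitions n \<longrightarrow> d k = 0) \<and> f = (\<lambda>m. \<Sum>k\<in>partitions n. d k * star_part k m)"
    have "(\<Sum>k\<in>partitions n. (d k - c k) * star_part k m) = 0" for m
    proof -
      have "(\<Sum>k\<in>partitions n. d k * star_part k m) = (\<Sum>k\<in>partitions n. c k * star_part k m)"
        using c(2) d by (metis (no_types))
      then show ?thesis by (simp add: left_diff_distrib sum_subtractf)
    qed
    then have "d k - c k = 0" if "k \<in> partitions n" for k
      using star_part_independent[where n = n and c = "\<lambda>k. d k - c k"] that by blast
    then have "d k = c k" for k using c(1) d by (cases "k \<in> partitions n") auto
    then show "d = c" by blast
  qed (use c in auto)
  have cl: "c l = a" using c(4) assms(2) by blast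
  have less: "(l, k) \<in> lexord less_than" if "k \<in> partitions n" "c k \<noteq> 0" "k \<noteq> l" for k
  proof (rule lexord_if_mset_less)
    show "mset l < mset k"
      using c(3) that partition_eqI[OF that(1) assms(2)] by (metis linorder_less_linear)
  qed (use that assms(2) in \<open>auto simp: partitions_def\<close>)
  have "lead_partition n f = l"
    unfolding lead_partition_def coeffs
  proof (rule the_equality)
    show "l \<in> partitions n \<and> c l \<noteq> 0 \<and> (\<forall>k\<in>partitions n. c k \<noteq> 0 \<longrightarrow> part_le l k)"
      using assms(2,3) cl less by (auto simp: part_le_def)
    fix k assume k: "k \<in> partitions n \<and> c k \<noteq> 0 \<and> (\<forall>k'\<in>partitions n. c k' \<noteq> 0 \<longrightarrow> part_le k k')"
    show "k = l"
    proof (rule ccontr)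
      assume "k \<noteq> l"
      then have "(l, k) \<in> lexord less_than" "(k, l) \<in> lexord less_than"
        using k less assms(2,3) cl by (auto simp: part_le_def)
      then have "(l, l) \<in> lexord less_than"
        by (meson lexord_trans trans_less_than)
      then show False using lexord_irreflexive[of less_than l] by simp
    qed
  qed
  then show ?thesis by (simp add: lead_coeff_def coeffs cl)
qed

lemma sum_kernel_sizes:
  assumes "finite V"
  shows "sum_mset (kernel_sizes V r) = card V"
proof -
  have "sum_mset (kernel_sizes V r) = (\<Sum>z\<in>r ` V. card {x \<in> V. r x = z})"
    unfolding kernel_sizes_def by (rule sum_unfold_sum_mset[symmetric])
  also have "\<dots> = (\<Sum>z\<in>r ` V. \<Sum>x | x \<in> V \<and> r x = z. 1)" by simp
  also have "\<dots> = (\<Sum>x\<in>V. 1)" using assms by (intro sum.group) auto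
  finally show ?thesis by simp
qed

lemma kernel_sizes_pos:
  assumes "finite V"
  shows "0 \<notin># kernel_sizes V r"
  using assms by (auto simp: kernel_sizes_def)

lemma partition_of_kernel_sizes:
  assumes "finite V"
  obtains l where "l \<in> partitions (card V)" "mset l = kernel_sizes V r"
  using partition_of_mset[OF kernel_sizes_pos[OF assms, of r]] sum_kernel_sizes[OF assms, of r] by metis

section \<open>Deletion and near-contraction\<close>

lemma simple_graph_finite_edges: "simple_graph V E \<Longrightarrow> finite E"
  unfolding simple_graph_def by (rule finite_subset[of E "Pow V"]) auto

lemma simple_graph_edgeE:
  assumes "simple_graph V E" "e \<in> E"
  obtains x y where "e = {x, y}" "x \<in> V" "y \<in> V" "x \<noteq> y"
  using assms unfolding simple_graph_def by (metis card_2_iff insert_subset)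

lemma simple_graph_edgeD:
  assumes "simple_graph V E" "{x, y} \<in> E"
  shows "x \<in> V" "y \<in> V" "x \<noteq> y"
proof -
  have "{x, y} \<subseteq> V" "card {x, y} = 2" using assms unfolding simple_graph_def by blast+
  then show "x \<in> V" "y \<in> V" "x \<noteq> y" by (auto simp: card_insert_if split: if_splits)
qed

lemma simple_graph_subset: "simple_graph V E \<Longrightarrow> F \<subseteq> E \<Longrightarrow> simple_graph V F"
  by (auto simp: simple_graph_def)

lemma simple_graph_edge_at:
  assumes "simple_graph V E" "e \<in> E" "x \<in> e"
  obtains y where "e = {x, y}" "x \<noteq> y"
  using simple_graph_edgeE[OF assms(1,2)] assms(3) by (metis insertE insert_commute singletonD)

lemma proper_colorings_iff:
  assumes "simple_graph V E"
  shows "proper_colorings V E = {\<kappa> \<in> V \<rightarrow>\<^sub>E UNIV. \<forall>e\<in>E. card (\<kappa> ` e) = 2}"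
proof -
  have "(\<forall>x\<in>V. \<forall>y\<in>V. {x, y} \<in> E \<longrightarrow> \<kappa> x \<noteq> \<kappa> y) \<longleftrightarrow> (\<forall>e\<in>E. card (\<kappa> ` e) = 2)" for \<kappa> :: "'a \<Rightarrow> nat"
  proof safe
    fix e assume *: "\<forall>x\<in>V. \<forall>y\<in>V. {x, y} \<in> E \<longrightarrow> \<kappa> x \<noteq> \<kappa> y" and "e \<in> E"
    then obtain x y where "e = {x, y}" "x \<in> V" "y \<in> V" using simple_graph_edgeE[OF assms] by metis
    then show "card (\<kappa> ` e) = 2" using * \<open>e \<in> E\<close> by simp
  next
    fix x y assume "\<forall>e\<in>E. card (\<kappa> ` e) = 2" "{x, y} \<in> E" "\<kappa> x = \<kappa> y"
    then have "card (\<kappa> ` {x, y}) = 2" by blast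
    then show False using \<open>\<kappa> x = \<kappa> y\<close> by simp
  qed
  then show ?thesis by (auto simp: proper_colorings_def)
qed

definition contract_edge :: "'a \<Rightarrow> 'a \<Rightarrow> 'a set \<Rightarrow> 'a set" where
  "contract_edge a b f = (if b \<in> f then insert a (f - {b}) else f)"

text \<open>The contraction of \<open>{a, b}\<close> to \<open>a\<close>; the vertex \<open>b\<close> stays behind, isolated.\<close>

definition contracted :: "'a \<Rightarrow> 'a \<Rightarrow> 'a set set \<Rightarrow> 'a set set" where
  "contracted a b E = contract_edge a b ` (E - {{a, b}})"

lemma mem_contracted_iff:
  assumes "simple_graph V E" "a \<noteq> b"
  shows "{x, y} \<in> contracted a b E \<longleftrightarrow>
    x \<noteq> b \<and> y \<noteq> b \<and> x \<noteq> y \<and> ({x, y} \<in> E \<or> x = a \<and> {b, y} \<in> E \<or> y = a \<and> {b, x} \<in> E)"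
    (is "?l \<longleftrightarrow> ?r")
proof
  assume ?l
  then obtain f where f: "f \<in> E" "f \<noteq> {a, b}" "{x, y} = contract_edge a b f"
    by (auto simp: contracted_def)
  show ?r
  proof (cases "b \<in> f")
    case True
    then obtain z where z: "f = {b, z}" "b \<noteq> z" using simple_graph_edge_at[OF assms(1) f(1)] by metis
    then have "z \<noteq> a" using f(2) by (auto simp: insert_commute)
    have "{x, y} = {a, z}" using f(3) z by (auto simp: contract_edge_def)
    then show ?thesis using z f(1) \<open>z \<noteq> a\<close> assms(2) by (auto simp: doubleton_eq_iff)
  next
    case False
    then have "{x, y} = f" using f(3) by (simp add: contract_edge_def)
    then show ?thesis using False f(1) simple_graph_edgeD[OF assms(1)] by auto
  qed
next
  have "{a, z} \<in> contracted a b E" if "z \<noteq> b" "z \<noteq> a" "{b, z} \<in> E" for z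
  proof -
    have "contract_edge a b {b, z} = {a, z}" "{b, z} \<noteq> {a, b}"
      using that assms(2) by (auto simp: contract_edge_def doubleton_eq_iff)
    then show ?thesis using that(3) unfolding contracted_def by (metis Diff_iff image_eqI singletonD)
  qed
  moreover have "{x, y} \<in> contracted a b E" if "x \<noteq> b" "y \<noteq> b" "{x, y} \<in> E"
  proof -
    have "contract_edge a b {x, y} = {x, y}" "{x, y} \<noteq> {a, b}"
      using that by (auto simp: contract_edge_def doubleton_eq_iff)
    then show ?thesis using that(3) unfolding contracted_def by (metis Diff_iff image_eqI singletonD)
  qed
  ultimately show "?r \<Longrightarrow> ?l" by (metis insert_commute)
qed

lemma simple_graph_contracted:
  assumes "simple_graph V E" "a \<in> V" "a \<noteq> b"
  shows "simple_graph V (contracted a b E)"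
  unfolding simple_graph_def
proof (intro conjI ballI)
  show "finite V" using assms(1) by (simp add: simple_graph_def)
  fix e assume "e \<in> contracted a b E"
  then obtain f where f: "f \<in> E" "f \<noteq> {a, b}" "e = contract_edge a b f"
    by (auto simp: contracted_def)
  have "e \<subseteq> V \<and> card e = 2"
  proof (cases "b \<in> f")
    case True
    then obtain z where z: "f = {b, z}" "b \<noteq> z" using simple_graph_edge_at[OF assms(1) f(1)] by metis
    then have "z \<noteq> a" using f(2) by (auto simp: insert_commute)
    moreover have "e = {a, z}" using f(3) z by (auto simp: contract_edge_def)
    moreover have "z \<in> V" using simple_graph_edgeD[OF assms(1), of b z] f(1) z by simp
    ultimately show ?thesis using assms(2) by simp
  next
    case False
    then show ?thesis using f assms(1) by (auto simp: contract_edge_def simple_graph_def)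
  qed
  then show "e \<subseteq> V" "card e = 2" by auto
qed

lemma chrom_sym_insert_edge:
  assumes "finite V" "a \<in> V" "b \<in> V"
  shows "chrom_sym V (insert {a, b} F) m = chrom_sym V F m -
    of_nat (card {\<kappa> \<in> proper_colorings V F. \<kappa> a = \<kappa> b \<and> image_mset \<kappa> (mset_set V) = m})"
proof -
  define A where "A = {\<kappa> \<in> proper_colorings V F. image_mset \<kappa> (mset_set V) = m}"
  define N where "N = {\<kappa> \<in> proper_colorings V F. \<kappa> a = \<kappa> b \<and> image_mset \<kappa> (mset_set V) = m}"
  have "finite A"
    using finite_wcolorings[OF assms(1), of "\<lambda>_. 1" F m] by (simp add: A_def sum_singleton_mset)
  moreover have "N \<subseteq> A" by (auto simp: A_def N_def)
  ultimately have "of_nat (card (A - N)) = (of_nat (card A) - of_nat (card N) :: rat)"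
    by (simp add: card_Diff_subset finite_subset of_nat_diff card_mono)
  moreover have "{\<kappa> \<in> proper_colorings V (insert {a, b} F). image_mset \<kappa> (mset_set V) = m} = A - N"
    using assms(2,3) by (auto simp: A_def N_def proper_colorings_def doubleton_eq_iff)
  ultimately show ?thesis by (simp add: chrom_sym_def A_def N_def)
qed

text \<open>Deletion and near-contraction: a colouring that gives \<open>a\<close> and \<open>b\<close> the same colour is proper
  for the graph without the edge \<open>{a, b}\<close> iff it is proper for the contracted graph.\<close>

lemma chrom_sym_dnc:
  assumes "simple_graph V E" "{a, b} \<in> E"
  shows "chrom_sym V E m = chrom_sym V (E - {{a, b}}) m - chrom_sym V (contracted a b E) m +
    chrom_sym V (insert {a, b} (contracted a b E)) m"
proof -
  have V: "finite V" "a \<in> V" "b \<in> V" "a \<noteq> b"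
    using assms simple_graph_edgeD[OF assms] by (auto simp: simple_graph_def)
  have "simple_graph V (E - {{a, b}})" using assms(1) by (rule simple_graph_subset) auto
  note pc = proper_colorings_iff[OF this] proper_colorings_iff[OF simple_graph_contracted[OF assms(1) V(2,4)]]
  have im: "\<kappa> ` contract_edge a b f = \<kappa> ` f" if "\<kappa> a = \<kappa> b" for \<kappa> :: "'a \<Rightarrow> nat" and f
    using that unfolding contract_edge_def by auto
  have "\<kappa> \<in> proper_colorings V (contracted a b E) \<longleftrightarrow> \<kappa> \<in> proper_colorings V (E - {{a, b}})"
    if "\<kappa> a = \<kappa> b" for \<kappa> unfolding pc using that by (simp add: contracted_def im)
  then have "{\<kappa> \<in> proper_colorings V (contracted a b E). \<kappa> a = \<kappa> b \<and> image_mset \<kappa> (mset_set V) = m} =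
      {\<kappa> \<in> proper_colorings V (E - {{a, b}}). \<kappa> a = \<kappa> b \<and> image_mset \<kappa> (mset_set V) = m}" by blast
  moreover have "E = insert {a, b} (E - {{a, b}})" using assms(2) by blast
  ultimately show ?thesis
    using chrom_sym_insert_edge[OF V(1-3), of "E - {{a, b}}" m]
      chrom_sym_insert_edge[OF V(1-3), of "contracted a b E" m] by simp
qed

text \<open>\<open>h\<close> is the depth in a rooted forest: the neighbours of a vertex are its children and at
  most one parent.\<close>

definition forest :: "'a set set \<Rightarrow> bool" where
  "forest E \<longleftrightarrow> (\<exists>h :: 'a \<Rightarrow> nat. (\<forall>x y. {x, y} \<in> E \<longrightarrow> h x \<noteq> h y) \<and>
     (\<forall>x y z. {x, y} \<in> E \<longrightarrow> {x, z} \<in> E \<longrightarrow> h y < h x \<longrightarrow> h z < h x \<longrightarrow> y = z))"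

lemma forestI:
  fixes h :: "'a \<Rightarrow> nat"
  assumes "\<And>x y. {x, y} \<in> E \<Longrightarrow> h x \<noteq> h y"
    and "\<And>x y z. {x, y} \<in> E \<Longrightarrow> {x, z} \<in> E \<Longrightarrow> h y < h x \<Longrightarrow> h z < h x \<Longrightarrow> y = z"
  shows "forest E"
  using assms unfolding forest_def by blast

lemma forestE:
  assumes "forest E"
  obtains h :: "'a \<Rightarrow> nat" where "\<And>x y. {x, y} \<in> E \<Longrightarrow> h x \<noteq> h y"
    "\<And>x y z. {x, y} \<in> E \<Longrightarrow> {x, z} \<in> E \<Longrightarrow> h y < h x \<Longrightarrow> h z < h x \<Longrightarrow> y = z"
  using assms unfolding forest_def by blast

lemma forest_subset: "forest E \<Longrightarrow> F \<subseteq> E \<Longrightarrow> forest F"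
  unfolding forest_def by blast

lemma forest_no_triangle:
  assumes "forest E" "{a, b} \<in> E" "{a, y} \<in> E" "{b, y} \<in> E"
  shows False
proof -
  obtain h :: "'a \<Rightarrow> nat" where h: "\<And>x y. {x, y} \<in> E \<Longrightarrow> h x \<noteq> h y"
    "\<And>x y z. {x, y} \<in> E \<Longrightarrow> {x, z} \<in> E \<Longrightarrow> h y < h x \<Longrightarrow> h z < h x \<Longrightarrow> y = z"
    using forestE[OF assms(1)] by metis
  have E: "{b, a} \<in> E" "{y, a} \<in> E" "{y, b} \<in> E" using assms by (simp_all add: insert_commute)
  have ne: "h a \<noteq> h b" "h a \<noteq> h y" "h b \<noteq> h y" using h(1) assms by blast+
  then consider "h b < h a" "h y < h a" | "h a < h b" "h y < h b" | "h a < h y" "h b < h y"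
    by linarith
  then show False
    by cases (use h(2) assms E ne in metis)+
qed

lemma forest_contracted:
  assumes "simple_graph V E" "forest E" "{a, b} \<in> E"
  shows "forest (insert {a, b} (contracted a b E))"
proof -
  obtain h :: "'a \<Rightarrow> nat" where h: "\<And>x y. {x, y} \<in> E \<Longrightarrow> h x \<noteq> h y"
    "\<And>x y z. {x, y} \<in> E \<Longrightarrow> {x, z} \<in> E \<Longrightarrow> h y < h x \<Longrightarrow> h z < h x \<Longrightarrow> y = z"
    using forestE[OF assms(2)] by metis
  have ab: "a \<noteq> b" using simple_graph_edgeD[OF assms(1,3)] by simp
  have comm: "{x, y} \<in> E \<longleftrightarrow> {y, x} \<in> E" for x y by (simp add: insert_commute)
  define k where "k = (if h a < h b then h else h(a := h b, b := h a))"
  have nb: "{x, y} \<in> insert {a, b} (contracted a b E) \<longleftrightarrow>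
      x = a \<and> y = b \<or> x = b \<and> y = a \<or>
      x \<noteq> b \<and> y \<noteq> b \<and> x \<noteq> y \<and> ({x, y} \<in> E \<or> x = a \<and> {b, y} \<in> E \<or> y = a \<and> {b, x} \<in> E)" for x y
    using mem_contracted_iff[OF assms(1) ab, of x y] by (auto simp: doubleton_eq_iff)
  have hab: "h a \<noteq> h b" using h(1) assms(3) by blast
  have kab: "k a < k b" using hab ab by (auto simp: k_def)
  have ko: "k x = h x" if "x \<noteq> a" "x \<noteq> b" for x using that by (simp add: k_def)
  have b_child: "h b < h x" if "h a < h b" "{b, x} \<in> E" "x \<noteq> a" for x
    using h(2)[of b a x] h(1)[OF that(2)] that assms(3) comm by (metis nat_neq_iff)
  have a_child: "h a < h x" if "\<not> h a < h b" "{a, x} \<in> E" "x \<noteq> b" for x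
    using h(2)[of a b x] h(1)[OF that(2)] that assms(3) hab by (metis nat_neq_iff)
  have k_neq: "k a \<noteq> k y" if "{a, y} \<in> E \<or> {b, y} \<in> E" "y \<noteq> a" "y \<noteq> b" for y
    using that b_child[of y] a_child[of y] h(1)[of a y] h(1)[of b y] ko[of y] hab ab
    unfolding k_def by (auto split: if_splits)
  have parent: "y \<noteq> a \<and> y \<noteq> b \<and> {x, y} \<in> E \<and> h y < h x \<or>
      y = a \<and> ({x, a} \<in> E \<and> h a < h x \<or> {x, b} \<in> E \<and> h b < h x)"
    if xy: "{x, y} \<in> insert {a, b} (contracted a b E)" "k y < k x" and x: "x \<noteq> a" "x \<noteq> b" for x y
  proof (cases "y = a")
    case True
    then have "{x, a} \<in> E \<or> {x, b} \<in> E" using xy x nb comm by metis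
    moreover have "k a < h x" using xy(2) True ko[OF x] by simp
    ultimately show ?thesis
      using True b_child[of x] a_child[of x] x comm[of x] hab ab unfolding k_def by (auto split: if_splits)
  next
    case False
    then have "y \<noteq> b" "{x, y} \<in> E" using xy(1) x nb by blast+
    then show ?thesis using False xy(2) ko x by metis
  qed
  have parent_a: "if h a < h b then {a, y} \<in> E \<and> h y < h a else {b, y} \<in> E \<and> h y < h b"
    if y: "{a, y} \<in> insert {a, b} (contracted a b E)" "k y < k a" for y
  proof -
    have "y \<noteq> b" "y \<noteq> a" using y(2) kab by auto
    moreover from this have "{a, y} \<in> E \<or> {b, y} \<in> E" using y(1) nb by blast
    moreover have "h y < k a" using y(2) ko calculation by metis
    ultimately show ?thesis
      using b_child[of y] a_child[of y] hab ab unfolding k_def by (auto split: if_splits)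
  qed
  show ?thesis
  proof (rule forestI[of _ k])
    fix x y assume "{x, y} \<in> insert {a, b} (contracted a b E)"
    then show "k x \<noteq> k y" using nb[of x y] k_neq kab h(1)[of x y] ko comm by (metis less_irrefl)
  next
    fix x y z assume xyz: "{x, y} \<in> insert {a, b} (contracted a b E)"
      "{x, z} \<in> insert {a, b} (contracted a b E)" "k y < k x" "k z < k x"
    consider "x = a" | "x = b" | "x \<noteq> a" "x \<noteq> b" by blast
    then show "y = z"
    proof cases
      case 1
      then show ?thesis using parent_a[of y] parent_a[of z] xyz h(2)[of a y z] h(2)[of b y z]
        by (simp split: if_splits)
    next
      case 2
      then show ?thesis using xyz(1,2) nb[of b y] nb[of b z] ab by simp
    next
      case 3
      then show ?thesis using parent[OF xyz(1,3)] parent[OF xyz(2,4)] h(2) by metis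
    qed
  qed
qed


definition leaf_edges :: "'a set set \<Rightarrow> 'a set set" where
  "leaf_edges E = {e \<in> E. \<exists>x\<in>e. degree E x = 1}"

lemma leaf_edges_subset: "leaf_edges E \<subseteq> E"
  by (auto simp: leaf_edges_def)

lemma degree_pos: "finite E \<Longrightarrow> e \<in> E \<Longrightarrow> x \<in> e \<Longrightarrow> 0 < degree E x"
  unfolding degree_def by (auto simp: card_gt_0_iff)

lemma degree_remove:
  "finite E \<Longrightarrow> e \<in> E \<Longrightarrow> degree (E - {e}) x = degree E x - of_bool (x \<in> e)"
proof -
  assume "finite E" "e \<in> E"
  moreover have "{f \<in> E - {e}. x \<in> f} = {f \<in> E. x \<in> f} - {e}" by blast
  ultimately show ?thesis by (auto simp: degree_def card_Diff_singleton_if)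
qed

lemma degree_insert:
  "finite E \<Longrightarrow> e \<notin> E \<Longrightarrow> degree (insert e E) x = degree E x + of_bool (x \<in> e)"
proof -
  assume "finite E" "e \<notin> E"
  moreover have "{f \<in> insert e E. x \<in> f} = (if x \<in> e then insert e {f \<in> E. x \<in> f} else {f \<in> E. x \<in> f})" by auto
  ultimately show ?thesis by (auto simp: degree_def)
qed

lemma degree_1_unique:
  assumes "degree E x = 1" "e \<in> E" "x \<in> e" "f \<in> E" "x \<in> f"
  shows "e = f"
proof -
  obtain g where g: "{e \<in> E. x \<in> e} = {g}" using assms(1) by (auto simp: degree_def card_1_singleton_iff)
  have "e \<in> {e \<in> E. x \<in> e}" "f \<in> {e \<in> E. x \<in> e}" using assms(2-5) by simp_all
  then show ?thesis unfolding g by simp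
qed

lemma deep_vertex_iff:
  assumes "simple_graph V E"
  shows "deep_vertex V E x \<longleftrightarrow> x \<in> V \<and> 2 \<le> degree E x \<and> x \<notin> \<Union>(leaf_edges E)"
proof -
  have "(\<exists>y\<in>V. {x, y} \<in> E \<and> degree E y = 1) \<longleftrightarrow> x \<in> \<Union>(leaf_edges E)" if "2 \<le> degree E x"
  proof
    assume "x \<in> \<Union>(leaf_edges E)"
    then obtain f z where f: "f \<in> E" "x \<in> f" "z \<in> f" "degree E z = 1" by (auto simp: leaf_edges_def)
    then obtain y where "f = {x, y}" using simple_graph_edge_at[OF assms] by metis
    moreover have "z \<noteq> x" using f(4) that by auto
    ultimately have "f = {x, z}" using f(3) by auto
    then show "\<exists>y\<in>V. {x, y} \<in> E \<and> degree E y = 1"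
      using f simple_graph_edgeD[OF assms, of x z] by auto
  qed (auto simp: leaf_edges_def)
  then show ?thesis by (auto simp: deep_vertex_def)
qed

lemma internal_not_connected:
  assumes "simple_graph V E" "degree E a \<noteq> 1" "degree E b \<noteq> 1" "a \<noteq> b"
  shows "(a, b) \<notin> (adj_rel (leaf_edges E))\<^sup>*"
proof
  assume "(a, b) \<in> (adj_rel (leaf_edges E))\<^sup>*"
  then have "b \<in> insert a {y. {a, y} \<in> E \<and> degree E y = 1}"
  proof (rule adj_rel_closed)
    fix u w assume u: "u \<in> insert a {y. {a, y} \<in> E \<and> degree E y = 1}" and uw: "{u, w} \<in> leaf_edges E"
    show "w \<in> insert a {y. {a, y} \<in> E \<and> degree E y = 1}"
    proof (cases "u = a")
      case True
      then show ?thesis using uw assms(2) by (auto simp: leaf_edges_def)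
    next
      case False
      then have "{a, u} = {u, w}"
        using u uw degree_1_unique[of E u "{a, u}" "{u, w}"] by (auto simp: leaf_edges_def)
      then show ?thesis using False by (auto simp: doubleton_eq_iff)
    qed
  qed simp
  then show False using assms by auto
qed

lemma leaf_edges_ends:
  assumes "simple_graph V E"
  shows "\<forall>e\<in>leaf_edges E. \<exists>a\<in>V. \<exists>b\<in>V. e = {a, b}"
  using simple_graph_edgeE[OF assms] leaf_edges_subset by (metis subsetD)

lemma finite_leaf_edges: "simple_graph V E \<Longrightarrow> finite (leaf_edges E)"
  by (meson finite_subset leaf_edges_subset simple_graph_finite_edges)

lemma comp_sizes_star_forest:
  assumes "finite C" "finite Y" "C \<inter> Y = {}" "r ` Y \<subseteq> C"
  shows "comp_sizes (C \<union> Y) ((\<lambda>y. {y, r y}) ` Y) =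
    image_mset (\<lambda>c. Suc (card {y \<in> Y. r y = c})) (mset_set C)"
proof -
  define \<rho> where "\<rho> x = (if x \<in> C then x else r x)" for x
  let ?L = "(\<lambda>y. {y, r y}) ` Y"
  have \<rho>C: "\<rho> c = c" if "c \<in> C" for c using that by (simp add: \<rho>_def)
  have \<rho>Y: "\<rho> y = r y" "\<rho> (r y) = r y" if "y \<in> Y" for y using that assms by (auto simp: \<rho>_def)
  have to: "(x, \<rho> x) \<in> (adj_rel ?L)\<^sup>*" if "x \<in> C \<union> Y" for x
  proof (cases "x \<in> C")
    case False
    then have "{x, \<rho> x} \<in> ?L" using that by (auto simp: \<rho>_def)
    then show ?thesis by (intro r_into_rtrancl) (simp add: adj_rel_def)
  qed (simp add: \<rho>_def)
  have const: "\<rho> y = \<rho> x" if "(x, y) \<in> (adj_rel ?L)\<^sup>*" for x y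
  proof -
    have "\<rho> w = \<rho> u" if uw: "{u, w} \<in> ?L" for u w
    proof -
      obtain y where y: "y \<in> Y" "{u, w} = {y, r y}" using uw by (rule imageE) blast
      then have "u = y \<and> w = r y \<or> u = r y \<and> w = y" by (simp add: doubleton_eq_iff)
      then show ?thesis using \<rho>Y[OF y(1)] by metis
    qed
    then have "y \<in> {y. \<rho> y = \<rho> x}" by (intro adj_rel_closed[OF that]) simp_all
    then show ?thesis by simp
  qed
  have "comp_sizes (C \<union> Y) ?L = kernel_sizes (C \<union> Y) \<rho>"
  proof (rule kernel_sizes_cong)
    fix x y assume xy: "x \<in> C \<union> Y" "y \<in> C \<union> Y"
    have "(x, y) \<in> (adj_rel ?L)\<^sup>*" if "\<rho> x = \<rho> y"
      using to[OF xy(1)] adj_rel_rtrancl_sym[OF to[OF xy(2)]] that by (metis rtrancl_trans)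
    then show "component (C \<union> Y) ?L x = component (C \<union> Y) ?L y \<longleftrightarrow> \<rho> x = \<rho> y"
      using const unfolding component_eq_iff[OF xy] by metis
  qed
  also have "\<dots> = image_mset (\<lambda>z. card {x \<in> C \<union> Y. \<rho> x = z}) (mset_set C)"
  proof -
    have "\<rho> ` C = C" using \<rho>C by simp
    moreover have "\<rho> ` Y \<subseteq> C" using \<rho>Y(1) assms(4) by auto
    ultimately have "\<rho> ` (C \<union> Y) = C" by (simp add: image_Un Un_absorb2)
    then show ?thesis by (simp add: kernel_sizes_def)
  qed
  also have "\<dots> = image_mset (\<lambda>c. Suc (card {y \<in> Y. r y = c})) (mset_set C)"
  proof (rule image_mset_cong)
    fix c assume "c \<in># mset_set C"
    then have c: "c \<in> C" using assms(1) by simp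
    have "{x \<in> C \<union> Y. \<rho> x = c} = insert c {y \<in> Y. r y = c}"
      using c \<rho>C \<rho>Y by auto
    then show "card {x \<in> C \<union> Y. \<rho> x = c} = Suc (card {y \<in> Y. r y = c})"
      using assms(2) c assms(3) by (subst \<open>{x \<in> C \<union> Y. \<rho> x = c} = _\<close>, subst card_insert_disjoint) auto
  qed
  finally show ?thesis .
qed

lemma leaf_edges_star_forest:
  assumes "simple_graph V E" "forest E"
  obtains C Y r where "V = C \<union> Y" "C \<inter> Y = {}" "finite C" "finite Y" "r ` Y \<subseteq> C"
    "leaf_edges E = (\<lambda>y. {y, r y}) ` Y" "\<forall>y\<in>Y. degree E y = 1"
proof -
  obtain h :: "'a \<Rightarrow> nat" where h: "\<And>x y. {x, y} \<in> E \<Longrightarrow> h x \<noteq> h y"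
    using forestE[OF assms(2)] by metis
  define Y where "Y = {y \<in> V. degree E y = 1 \<and> (\<exists>x. {y, x} \<in> E \<and> (degree E x \<noteq> 1 \<or> h x < h y))}"
  define r where "r y = (SOME x. {y, x} \<in> E)" for y
  have uniq: "x = z" if "degree E y = 1" "{y, x} \<in> E" "{y, z} \<in> E" for x y z
    using degree_1_unique[OF that(1,2) _ that(3)] by (auto simp: doubleton_eq_iff)
  have r: "r y = x" if "degree E y = 1" "{y, x} \<in> E" for x y
    unfolding r_def using that uniq by (intro some_equality) auto
  have rC: "r ` Y \<subseteq> V - Y"
  proof
    fix x assume "x \<in> r ` Y"
    then obtain y where y: "y \<in> V" "degree E y = 1" "{y, x} \<in> E" "degree E x \<noteq> 1 \<or> h x < h y"
      unfolding Y_def using r by auto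
    have xy: "{x, y} \<in> E" using y(3) by (simp add: insert_commute)
    have "x \<in> V" using simple_graph_edgeD[OF assms(1) xy] by simp
    moreover have "x \<notin> Y"
    proof
      assume "x \<in> Y"
      then obtain z where z: "degree E x = 1" "{x, z} \<in> E" "degree E z \<noteq> 1 \<or> h z < h x" by (auto simp: Y_def)
      then have "z = y" using uniq xy by blast
      then show False using z y by auto
    qed
    ultimately show "x \<in> V - Y" by simp
  qed
  have L: "leaf_edges E = (\<lambda>y. {y, r y}) ` Y"
  proof (intro subset_antisym subsetI)
    fix f assume "f \<in> leaf_edges E"
    then obtain u where u: "f \<in> E" "u \<in> f" "degree E u = 1" by (auto simp: leaf_edges_def)
    then obtain w where w: "f = {u, w}" using simple_graph_edge_at[OF assms(1)] by metis
    have V: "u \<in> V" "w \<in> V" using simple_graph_edgeD[OF assms(1), of u w] u(1) w by auto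
    have wu: "{w, u} \<in> E" using u(1) w by (simp add: insert_commute)
    show "f \<in> (\<lambda>y. {y, r y}) ` Y"
    proof (cases "degree E w \<noteq> 1 \<or> h w < h u")
      case True
      then have "u \<in> Y" using u w V by (auto simp: Y_def)
      moreover have "r u = w" using r u w by simp
      ultimately show ?thesis by (intro image_eqI[of _ _ u]) (simp_all add: w)
    next
      case False
      then have "degree E w = 1" "h u < h w" using h[OF wu] by auto
      then have "w \<in> Y" using wu V by (auto simp: Y_def)
      moreover have "r w = u" using r wu \<open>degree E w = 1\<close> by simp
      ultimately show ?thesis by (intro image_eqI[of _ _ w]) (simp_all add: w insert_commute)
    qed
  next
    fix f assume "f \<in> (\<lambda>y. {y, r y}) ` Y"
    then obtain y where "y \<in> Y" "f = {y, r y}" by blast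
    then show "f \<in> leaf_edges E" using r by (auto simp: Y_def leaf_edges_def)
  qed
  have "finite V" using assms(1) by (simp add: simple_graph_def)
  then show thesis
    by (intro that[of "V - Y" Y r] rC L) (auto simp: Y_def)
qed

lemma contract_edge_inj:
  assumes "simple_graph V E" "forest E" "{a, b} \<in> E"
  shows "inj_on (contract_edge a b) (E - {{a, b}})"
proof -
  have ab: "a \<noteq> b" using simple_graph_edgeD[OF assms(1,3)] by simp
  have *: False if f: "f \<in> E - {{a, b}}" "b \<in> f" and g: "g \<in> E - {{a, b}}" "b \<notin> g"
    and eq: "contract_edge a b f = contract_edge a b g" for f g
  proof -
    obtain z where z: "f = {b, z}" "b \<noteq> z" using simple_graph_edge_at[OF assms(1) _ f(2)] f(1) by blast
    then have "g = {a, z}" using eq f(2) g(2) by (auto simp: contract_edge_def)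
    then show False using forest_no_triangle[OF assms(2,3), of z] f(1) g(1) z by auto
  qed
  have **: "f = g" if fg: "b \<in> f" "b \<in> g" "f \<in> E - {{a, b}}" "g \<in> E - {{a, b}}"
    "contract_edge a b f = contract_edge a b g" for f g
  proof -
    obtain y where "f = {b, y}" "b \<noteq> y"
      using simple_graph_edge_at[OF assms(1) _ fg(1)] fg(3) by blast
    moreover obtain z where "g = {b, z}" "b \<noteq> z"
      using simple_graph_edge_at[OF assms(1) _ fg(2)] fg(4) by blast
    moreover from calculation have "y \<noteq> a" "z \<noteq> a" using fg by (auto simp: insert_commute)
    ultimately show ?thesis using fg(5) by (auto simp: contract_edge_def doubleton_eq_iff)
  qed
  show ?thesis
  proof (rule inj_onI)
    fix f g assume fg: "f \<in> E - {{a, b}}" "g \<in> E - {{a, b}}" "contract_edge a b f = contract_edge a b g"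
    consider "b \<in> f" "b \<in> g" | "b \<in> f" "b \<notin> g" | "b \<notin> f" "b \<in> g" | "b \<notin> f" "b \<notin> g" by blast
    then show "f = g"
    proof cases
      case 1 with ** fg show ?thesis by blast
    next
      case 2 with * fg show ?thesis by blast
    next
      case 3 with *[of g f] fg show ?thesis by simp
    next
      case 4 with fg(3) show ?thesis by (simp add: contract_edge_def)
    qed
  qed
qed

lemma degree_contracted:
  assumes "simple_graph V E" "forest E" "{a, b} \<in> E"
  shows "x \<noteq> a \<Longrightarrow> x \<noteq> b \<Longrightarrow> degree (contracted a b E) x = degree E x"
    and "degree (contracted a b E) b = 0"
    and "degree (contracted a b E) a = degree E a - 1 + (degree E b - 1)"
proof -
  have ab: "a \<noteq> b" using simple_graph_edgeD[OF assms(1,3)] by simp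
  have fin: "finite E" using assms(1) by (rule simple_graph_finite_edges)
  note inj = contract_edge_inj[OF assms]
  have mem: "x \<in> contract_edge a b f \<longleftrightarrow> x \<in> f" if "x \<noteq> a" "x \<noteq> b" for x f
    using that by (auto simp: contract_edge_def)
  show "degree (contracted a b E) x = degree E x" if x: "x \<noteq> a" "x \<noteq> b"
  proof -
    have "{f \<in> contracted a b E. x \<in> f} = contract_edge a b ` {f \<in> E - {{a, b}}. x \<in> f}"
      using mem[OF x] by (auto simp: contracted_def)
    also have "card \<dots> = card {f \<in> E - {{a, b}}. x \<in> f}"
      by (rule card_image) (rule inj_on_subset[OF inj], auto)
    also have "{f \<in> E - {{a, b}}. x \<in> f} = {f \<in> E. x \<in> f}" using x by auto
    finally show ?thesis by (simp add: degree_def)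
  qed
  have "b \<notin> contract_edge a b f" for f using ab by (auto simp: contract_edge_def)
  then have "{f \<in> contracted a b E. b \<in> f} = {}" by (auto simp: contracted_def)
  then show "degree (contracted a b E) b = 0" unfolding degree_def by (simp only: card.empty)
  have "{f \<in> contracted a b E. a \<in> f} = contract_edge a b ` ({f \<in> E - {{a, b}}. a \<in> f} \<union> {f \<in> E - {{a, b}}. b \<in> f})"
    by (auto simp: contracted_def contract_edge_def split: if_splits)
  also have "card \<dots> = card ({f \<in> E - {{a, b}}. a \<in> f} \<union> {f \<in> E - {{a, b}}. b \<in> f})"
    by (rule card_image) (rule inj_on_subset[OF inj], auto)
  also have "\<dots> = degree (E - {{a, b}}) a + degree (E - {{a, b}}) b"
    unfolding degree_def
  proof (rule card_Un_disjoint)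
    show "{f \<in> E - {{a, b}}. a \<in> f} \<inter> {f \<in> E - {{a, b}}. b \<in> f} = {}"
    proof (intro equals0I)
      fix f assume f: "f \<in> {f \<in> E - {{a, b}}. a \<in> f} \<inter> {f \<in> E - {{a, b}}. b \<in> f}"
      then obtain z where "f = {a, z}" using simple_graph_edge_at[OF assms(1), of f a] by blast
      then show False using f ab by auto
    qed
  qed (use fin in auto)
  finally show "degree (contracted a b E) a = degree E a - 1 + (degree E b - 1)"
    using degree_remove[OF fin assms(3)] by (simp add: degree_def)
qed


lemma adj_rel_rtrancl_subset:
  assumes "\<And>x y. {x, y} \<in> A \<Longrightarrow> (x, y) \<in> (adj_rel B)\<^sup>*"
  shows "(adj_rel A)\<^sup>* \<subseteq> (adj_rel B)\<^sup>*"
  using assms by (intro rtrancl_subset_rtrancl) (auto simp: adj_rel_def)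

locale internal_edge =
  fixes V :: "'a set" and E :: "'a set set" and a b :: 'a
  assumes simple: "simple_graph V E" and forest: "forest E" and edge: "{a, b} \<in> E"
    and deg_a: "2 \<le> degree E a" and deg_b: "2 \<le> degree E b"
begin

lemma ab: "a \<noteq> b" "a \<in> V" "b \<in> V"
  using simple_graph_edgeD[OF simple edge] by auto

lemma fin: "finite E"
  using simple by (rule simple_graph_finite_edges)

lemma finV: "finite V"
  using simple by (simp add: simple_graph_def)

abbreviation "E1 \<equiv> E - {{a, b}}"
abbreviation "E2 \<equiv> contracted a b E"
abbreviation "E3 \<equiv> insert {a, b} E2"

lemma edge_internal: "{a, b} \<notin> leaf_edges E"
  using deg_a deg_b by (auto simp: leaf_edges_def)

lemma simple1: "simple_graph V E1" and simple2: "simple_graph V E2" and simple3: "simple_graph V E3"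
proof -
  show "simple_graph V E1" by (rule simple_graph_subset[OF simple]) auto
  show "simple_graph V E2" using simple_graph_contracted[OF simple] ab by simp
  then show "simple_graph V E3" using ab by (auto simp: simple_graph_def)
qed

lemma degree1: "degree E1 x = degree E x - of_bool (x \<in> {a, b})"
  by (rule degree_remove[OF fin edge])

lemma degree2: "x \<noteq> a \<Longrightarrow> x \<noteq> b \<Longrightarrow> degree E2 x = degree E x" "degree E2 b = 0"
  "degree E2 a = degree E a - 1 + (degree E b - 1)"
  using degree_contracted[OF simple forest edge] by auto

lemma edge_notin: "{a, b} \<notin> E2"
  using mem_contracted_iff[OF simple ab(1), of a b] by simp

lemma degree3: "degree E3 x = degree E2 x + of_bool (x \<in> {a, b})"
  using degree_insert[OF simple_graph_finite_edges[OF simple2] edge_notin] .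

lemma leaf_edges1: "leaf_edges E \<subseteq> leaf_edges E1"
proof
  fix f assume f: "f \<in> leaf_edges E"
  then obtain x where x: "x \<in> f" "degree E x = 1" "f \<in> E" by (auto simp: leaf_edges_def)
  then have "x \<noteq> a" "x \<noteq> b" using deg_a deg_b by auto
  moreover have "f \<noteq> {a, b}" using f edge_internal by blast
  ultimately show "f \<in> leaf_edges E1" using x by (auto simp: leaf_edges_def degree1)
qed

lemma leaf_edges2: "leaf_edges E2 = contract_edge a b ` leaf_edges E"
proof (intro subset_antisym subsetI)
  fix f assume "f \<in> leaf_edges E2"
  then obtain g x where g: "g \<in> E" "f = contract_edge a b g" "x \<in> f" "degree E2 x = 1"
    by (auto simp: leaf_edges_def contracted_def)
  have "x \<noteq> a" "x \<noteq> b" using g(4) degree2 deg_a deg_b by auto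
  then have "x \<in> g" "degree E x = 1"
    using g degree2(1) by (auto simp: contract_edge_def split: if_splits)
  then show "f \<in> contract_edge a b ` leaf_edges E" using g by (auto simp: leaf_edges_def)
next
  fix f assume "f \<in> contract_edge a b ` leaf_edges E"
  then obtain g where g: "f = contract_edge a b g" "g \<in> leaf_edges E" by blast
  then obtain x where x: "g \<in> E" "x \<in> g" "degree E x = 1" by (auto simp: leaf_edges_def)
  then have "x \<noteq> a" "x \<noteq> b" using deg_a deg_b by auto
  moreover have "g \<noteq> {a, b}" using g edge_internal by blast
  ultimately have "f \<in> E2" "x \<in> f" "degree E2 x = 1"
    using x g degree2(1) by (auto simp: contracted_def contract_edge_def)
  then show "f \<in> leaf_edges E2" by (auto simp: leaf_edges_def)
qed

lemma leaf_edges3: "leaf_edges E3 = insert {a, b} (leaf_edges E2)"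
proof -
  have "degree E3 b = 1" using degree3[of b] degree2(2) by simp
  moreover have "degree E3 x = 1 \<longleftrightarrow> degree E2 x = 1" if "x \<in> f" "f \<in> E2" for x f
  proof -
    have "{a, b} \<noteq> f" "x \<noteq> b" using that edge_notin degree2(2) degree_pos[OF simple_graph_finite_edges[OF simple2] that(2,1)] by auto
    then show ?thesis using degree3[of x] degree2(3) deg_a deg_b by auto
  qed
  ultimately show ?thesis by (auto simp: leaf_edges_def)
qed

lemma card_internal_less:
  shows "card (E1 - leaf_edges E1) < card (E - leaf_edges E)"
    and "card (E2 - leaf_edges E2) < card (E - leaf_edges E)"
    and "card (E3 - leaf_edges E3) < card (E - leaf_edges E)"
proof -
  let ?I = "E - leaf_edges E - {{a, b}}"
  have I: "card ?I < card (E - leaf_edges E)"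
    using fin edge edge_internal by (intro card_Diff1_less) auto
  have "E1 - leaf_edges E1 \<subseteq> ?I" using leaf_edges1 by auto
  then show "card (E1 - leaf_edges E1) < card (E - leaf_edges E)"
    using I fin by (meson card_mono finite_Diff le_less_trans)
  have sub: "E2 - leaf_edges E2 \<subseteq> contract_edge a b ` ?I"
    unfolding leaf_edges2 by (auto simp: contracted_def)
  have c: "card (contract_edge a b ` ?I) \<le> card ?I" using fin by (intro card_image_le) auto
  show "card (E2 - leaf_edges E2) < card (E - leaf_edges E)"
    using card_mono[OF _ sub] fin c I by auto
  have "E3 - leaf_edges E3 \<subseteq> contract_edge a b ` ?I" using sub unfolding leaf_edges3 by auto
  from card_mono[OF _ this] show "card (E3 - leaf_edges E3) < card (E - leaf_edges E)"
    using fin c I by auto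
qed

lemma comp_sizes3_less: "comp_sizes V (leaf_edges E) < comp_sizes V (leaf_edges E3)"
proof -
  let ?K = "insert {a, b} (leaf_edges E)"
  have eK: "(a, b) \<in> (adj_rel ?K)\<^sup>*" "(b, a) \<in> (adj_rel ?K)\<^sup>*"
    and e3: "(a, b) \<in> (adj_rel (leaf_edges E3))\<^sup>*" "(b, a) \<in> (adj_rel (leaf_edges E3))\<^sup>*"
    by (rule r_into_rtrancl, simp add: adj_rel_def leaf_edges3 insert_commute)+
  have at_b: "\<exists>z. g = {b, z} \<and> contract_edge a b g = {a, z}" if gb: "g \<in> leaf_edges E" "b \<in> g" for g
  proof -
    obtain z where "g = {b, z}" "b \<noteq> z"
      using simple_graph_edge_at[OF simple _ gb(2)] gb(1) leaf_edges_subset by blast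
    then show ?thesis by (auto simp: contract_edge_def)
  qed
  have "(x, y) \<in> (adj_rel ?K)\<^sup>*" if "{x, y} \<in> leaf_edges E3" for x y
  proof (cases "{x, y} = {a, b}")
    case True
    then show ?thesis using eK by (auto simp: doubleton_eq_iff)
  next
    case False
    then obtain g where g: "g \<in> leaf_edges E" "{x, y} = contract_edge a b g"
      using \<open>{x, y} \<in> leaf_edges E3\<close> unfolding leaf_edges3 leaf_edges2 by blast
    show ?thesis
    proof (cases "b \<in> g")
      case True
      then obtain z where z: "g = {b, z}" "{x, y} = {a, z}" using at_b g by metis
      have "(b, z) \<in> (adj_rel ?K)\<^sup>*" "(z, b) \<in> (adj_rel ?K)\<^sup>*"
        using g z(1) by (auto simp: adj_rel_def insert_commute intro!: r_into_rtrancl)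
      then show ?thesis using z(2) eK by (auto simp: doubleton_eq_iff intro: rtrancl_trans)
    next
      case False
      then have "{x, y} \<in> ?K" using g by (simp add: contract_edge_def)
      then show ?thesis by (intro r_into_rtrancl) (simp add: adj_rel_def)
    qed
  qed
  moreover have "(x, y) \<in> (adj_rel (leaf_edges E3))\<^sup>*" if "{x, y} \<in> ?K" for x y
  proof (cases "{x, y} = {a, b}")
    case True
    then show ?thesis using e3 by (auto simp: doubleton_eq_iff)
  next
    case False
    then have g: "{x, y} \<in> leaf_edges E" using that by blast
    then have c: "contract_edge a b {x, y} \<in> leaf_edges E3" unfolding leaf_edges3 leaf_edges2 by blast
    show ?thesis
    proof (cases "b \<in> {x, y}")
      case True
      then obtain z where z: "{x, y} = {b, z}" "contract_edge a b {x, y} = {a, z}" using at_b g by metis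
      have "(a, z) \<in> (adj_rel (leaf_edges E3))\<^sup>*" "(z, a) \<in> (adj_rel (leaf_edges E3))\<^sup>*"
        using c z(2) by (auto simp: adj_rel_def insert_commute intro!: r_into_rtrancl)
      then show ?thesis using z(1) e3 by (auto simp: doubleton_eq_iff intro: rtrancl_trans)
    next
      case False
      then have "{x, y} \<in> leaf_edges E3" using c by (simp add: contract_edge_def)
      then show ?thesis by (intro r_into_rtrancl) (simp add: adj_rel_def)
    qed
  qed
  ultimately have "(adj_rel (leaf_edges E3))\<^sup>* = (adj_rel ?K)\<^sup>*"
    by (intro subset_antisym adj_rel_rtrancl_subset)
  then have "comp_sizes V (leaf_edges E3) = comp_sizes V ?K"
    by (intro kernel_sizes_cong) (simp add: component_eq_iff)
  moreover have "comp_sizes V (leaf_edges E) < comp_sizes V ?K"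
    using internal_not_connected[OF simple] deg_a deg_b ab finV by (intro comp_sizes_insert_less) auto
  ultimately show ?thesis by simp
qed

lemma comp_sizes2_less:
  assumes "\<not> deep_vertex V E a" "\<not> deep_vertex V E b"
  shows "comp_sizes V (leaf_edges E) < comp_sizes V (leaf_edges E2)"
proof -
  obtain C Y r where r: "V = C \<union> Y" "C \<inter> Y = {}" "finite C" "finite Y" "r ` Y \<subseteq> C"
    "leaf_edges E = (\<lambda>y. {y, r y}) ` Y" "\<forall>y\<in>Y. degree E y = 1"
    using leaf_edges_star_forest[OF simple forest] by metis
  have "a \<notin> Y" "b \<notin> Y" using r(7) deg_a deg_b by auto
  then have abC: "a \<in> C" "b \<in> C" using ab(2,3) r(1) by auto
  define r2 where "r2 y = (if r y = b then a else r y)" for y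
  have "contract_edge a b {y, r y} = {y, r2 y}" if "y \<in> Y" for y
    using \<open>b \<notin> Y\<close> that by (auto simp: contract_edge_def r2_def)
  then have L2: "leaf_edges E2 = (\<lambda>y. {y, r2 y}) ` Y"
    unfolding leaf_edges2 r(6) by (simp add: image_image)
  define C' where "C' = C - {a, b}"
  have C: "C = insert a (insert b C')" "a \<notin> insert b C'" "b \<notin> C'" "finite C'"
    using abC ab(1) r(3) by (auto simp: C'_def)
  let ?n = "\<lambda>r c. card {y \<in> Y. r y = c}"
  have "{y \<in> Y. r2 y = a} = {y \<in> Y. r y = a} \<union> {y \<in> Y. r y = b}" by (auto simp: r2_def)
  then have na: "?n r2 a = ?n r a + ?n r b"
    using r(4) ab(1) by (simp add: card_Un_disjoint disjoint_iff)
  have "{y \<in> Y. r2 y = b} = {}" using ab(1) by (auto simp: r2_def)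
  then have nb: "?n r2 b = 0" by (simp only: card.empty)
  have X: "image_mset (\<lambda>c. Suc (?n r2 c)) (mset_set C') = image_mset (\<lambda>c. Suc (?n r c)) (mset_set C')"
  proof (rule image_mset_cong)
    fix c assume "c \<in># mset_set C'"
    then have "c \<noteq> a" "c \<noteq> b" using C(4) by (auto simp: C'_def)
    then have "{y \<in> Y. r2 y = c} = {y \<in> Y. r y = c}" by (auto simp: r2_def)
    then show "Suc (?n r2 c) = Suc (?n r c)" by (simp only:)
  qed
  have pos: "0 < ?n r c" if "c \<in> C" "\<not> deep_vertex V E c" "2 \<le> degree E c" for c
  proof -
    have "c \<in> V" using that(1) r(1) by blast
    then have "c \<in> \<Union>(leaf_edges E)" using that(2,3) deep_vertex_iff[OF simple, of c] by blast
    then obtain y where y: "y \<in> Y" "c \<in> {y, r y}" unfolding r(6) by blast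
    then have "r y = c" using that(1) r(2) by auto
    then have "y \<in> {y \<in> Y. r y = c}" using y by simp
    then show ?thesis using r(4) by (auto simp: card_gt_0_iff)
  qed
  have less: "{#Suc (?n r a), Suc (?n r b)#} < {#Suc (?n r2 a), Suc (?n r2 b)#}"
    unfolding na nb using pos[OF abC(1) assms(1) deg_a] pos[OF abC(2) assms(2) deg_b]
    by (intro ex_gt_imp_less_multiset exI[of _ "Suc (?n r a + ?n r b)"]) auto
  have s1: "comp_sizes V (leaf_edges E) = {#Suc (?n r a), Suc (?n r b)#} + image_mset (\<lambda>c. Suc (?n r c)) (mset_set C')"
  proof -
    from comp_sizes_star_forest[OF r(3,4,2,5)]
    have "comp_sizes V (leaf_edges E) = image_mset (\<lambda>c. Suc (?n r c)) (mset_set C)"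
      unfolding r(1,6) .
    then show ?thesis unfolding C(1) using C(2-4) by simp
  qed
  have s2: "comp_sizes V (leaf_edges E2) = {#Suc (?n r2 a), Suc (?n r2 b)#} + image_mset (\<lambda>c. Suc (?n r c)) (mset_set C')"
  proof -
    have "r2 ` Y \<subseteq> C" using r(5) abC by (auto simp: r2_def)
    from comp_sizes_star_forest[OF r(3,4,2) this]
    have "comp_sizes V (leaf_edges E2) = image_mset (\<lambda>c. Suc (?n r2 c)) (mset_set C)"
      unfolding r(1) L2 .
    then show ?thesis unfolding C(1) X[symmetric] using C(2-4) by simp
  qed
  show ?thesis unfolding s1 s2 using less by (rule add_strict_right_mono)
qed

lemma star_lead1:
  assumes "star_lead n f (comp_sizes V (leaf_edges E1)) (\<Prod>x | deep_vertex V E1 x. 1 - of_nat (degree E1 x))"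
  shows "star_lead n f (comp_sizes V (leaf_edges E)) (\<Prod>x | deep_vertex V E x. 1 - of_nat (degree E1 x))"
proof (cases "\<exists>x\<in>{a, b}. deep_vertex V E x \<and> degree E x = 2")
  case True
  then obtain x where x: "x \<in> {a, b}" "deep_vertex V E x" "degree E x = 2" by blast
  have d1: "degree E1 x = 1" using x by (simp add: degree1)
  then obtain f where f: "f \<in> E1" "x \<in> f" unfolding degree_def by (auto simp: card_1_singleton_iff)
  then obtain z where z: "f = {x, z}" "x \<noteq> z" using simple_graph_edge_at[OF simple1] by metis
  have "{x, z} \<in> E" "z \<in> V" using f z simple_graph_edgeD[OF simple1, of x z] by auto
  then have "degree E z \<noteq> 1" using x(2) by (auto simp: deep_vertex_def)
  then have "(x, z) \<notin> (adj_rel (leaf_edges E))\<^sup>*"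
    using internal_not_connected[OF simple, of x z] x(3) z(2) by simp
  moreover have "{x, z} \<in> leaf_edges E1" using f z d1 by (auto simp: leaf_edges_def)
  ultimately have "comp_sizes V (leaf_edges E) < comp_sizes V (leaf_edges E1)"
    using \<open>z \<in> V\<close> x(1) ab
    by (intro comp_sizes_less[OF finV finite_leaf_edges[OF simple1] leaf_edges1 leaf_edges_ends[OF simple1]]) auto
  moreover have "(\<Prod>x | deep_vertex V E x. 1 - rat_of_nat (degree E1 x)) = 0"
  proof (rule prod_zero)
    show "finite {x. deep_vertex V E x}" using finV by (auto simp: deep_vertex_def)
    show "\<exists>x\<in>{x. deep_vertex V E x}. 1 - rat_of_nat (degree E1 x) = 0"
      using x(2) d1 by (intro bexI[of _ x]) auto
  qed
  ultimately show ?thesis using star_lead_less[OF assms] by simp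
next
  case False
  have "leaf_edges E1 \<subseteq> leaf_edges E"
  proof
    fix f assume "f \<in> leaf_edges E1"
    then obtain x where x: "x \<in> f" "f \<in> E1" "degree E1 x = 1" by (auto simp: leaf_edges_def)
    show "f \<in> leaf_edges E"
    proof (cases "x \<in> {a, b}")
      case True
      then have "degree E x = 2" "x \<in> V" using x(3) ab deg_a deg_b by (auto simp: degree1)
      then have "x \<in> \<Union>(leaf_edges E)" using False True by (auto simp: deep_vertex_iff[OF simple])
      then obtain g where g: "g \<in> leaf_edges E" "x \<in> g" by blast
      then have "g \<in> E1" using edge_internal leaf_edges_subset by auto
      then have "f = g" using degree_1_unique[OF x(3) x(2,1)] g by blast
      then show ?thesis using g by simp
    next
      case False
      then show ?thesis using x by (auto simp: leaf_edges_def degree1)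
    qed
  qed
  then have L: "leaf_edges E1 = leaf_edges E" using leaf_edges1 by blast
  have "deep_vertex V E1 x \<longleftrightarrow> deep_vertex V E x" for x
  proof (cases "x \<in> {a, b}")
    case True
    then show ?thesis
      using False deg_a deg_b unfolding deep_vertex_iff[OF simple1] deep_vertex_iff[OF simple] L degree1 by auto
  next
    case False
    then show ?thesis unfolding deep_vertex_iff[OF simple1] deep_vertex_iff[OF simple] L degree1 by auto
  qed
  then show ?thesis using assms L by simp
qed

lemma star_lead_step:
  assumes deep: "deep_vertex V E a \<Longrightarrow> deep_vertex V E b"
    and IH: "\<And>F. F \<in> {E1, E2, E3} \<Longrightarrow> star_lead n (chrom_sym V F) (comp_sizes V (leaf_edges F))
      (\<Prod>x | deep_vertex V F x. 1 - of_nat (degree F x))"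
  shows "star_lead n (chrom_sym V E) (comp_sizes V (leaf_edges E))
      (\<Prod>x | deep_vertex V E x. 1 - of_nat (degree E x))"
proof -
  define D where "D = {x. deep_vertex V E x}"
  let ?\<Lambda> = "comp_sizes V (leaf_edges E)"
  have finD: "finite D" using finV by (auto simp: D_def deep_vertex_def)
  have X: "chrom_sym V E = (\<lambda>m. 1 * (1 * chrom_sym V E1 m + (-1) * chrom_sym V E2 m) + 1 * chrom_sym V E3 m)"
    using chrom_sym_dnc[OF simple edge] by (simp add: fun_eq_iff)
  have 1: "star_lead n (chrom_sym V E1) ?\<Lambda> (\<Prod>x\<in>D. 1 - of_nat (degree E1 x))"
    using star_lead1[OF IH] by (simp add: D_def)
  have 3: "star_lead n (chrom_sym V E3) ?\<Lambda> 0"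
    by (rule star_lead_less[OF IH comp_sizes3_less]) simp
  have "\<exists>w. star_lead n (chrom_sym V E2) ?\<Lambda> w \<and>
      (\<Prod>x\<in>D. 1 - of_nat (degree E1 x)) - w = (\<Prod>x\<in>D. 1 - rat_of_nat (degree E x))"
  proof (cases "b \<in> D")
    case True
    then have b: "b \<notin> \<Union>(leaf_edges E)" by (simp add: D_def deep_vertex_iff[OF simple])
    have "contract_edge a b f = f" if "f \<in> leaf_edges E" for f
      using b that by (auto simp: contract_edge_def)
    then have L: "leaf_edges E2 = leaf_edges E" unfolding leaf_edges2 by simp
    have "deep_vertex V E2 x \<longleftrightarrow> x \<in> D - {b}" for x
      unfolding deep_vertex_iff[OF simple2] L D_def using degree2 deg_a deg_b
      by (cases "x = a"; cases "x = b") (auto simp: deep_vertex_iff[OF simple])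
    then have "{x. deep_vertex V E2 x} = D - {b}" by blast
    then have 2: "star_lead n (chrom_sym V E2) ?\<Lambda> (\<Prod>x\<in>D - {b}. 1 - of_nat (degree E2 x))"
      using IH[of E2] L by simp
    define Q where "Q F = (\<Prod>x\<in>D - {a, b}. 1 - rat_of_nat (degree F x))" for F
    have Q: "Q E1 = Q E" "Q E2 = Q E"
      unfolding Q_def by (auto intro!: prod.cong simp: degree1 degree2(1))
    have rem: "D - {b} - {a} = D - {a, b}" by blast
    have Db: "(\<Prod>x\<in>D. 1 - rat_of_nat (degree F x)) = (1 - of_nat (degree F b)) * (\<Prod>x\<in>D - {b}. 1 - of_nat (degree F x))" for F
      using prod.remove[OF finD True] .
    have "(\<Prod>x\<in>D. 1 - rat_of_nat (degree E1 x)) - (\<Prod>x\<in>D - {b}. 1 - of_nat (degree E2 x)) =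
      (\<Prod>x\<in>D. 1 - of_nat (degree E x))"
    proof (cases "a \<in> D")
      case True
      then have aD: "a \<in> D - {b}" using ab(1) by simp
      have Da: "(\<Prod>x\<in>D - {b}. 1 - rat_of_nat (degree F x)) = (1 - of_nat (degree F a)) * Q F" for F
        using prod.remove[OF _ aD, of "\<lambda>x. 1 - rat_of_nat (degree F x)"] finD by (simp add: Q_def rem)
      have "(\<Prod>x\<in>D. 1 - rat_of_nat (degree E1 x)) - (\<Prod>x\<in>D - {b}. 1 - of_nat (degree E2 x)) =
          ((1 - of_nat (degree E1 b)) * (1 - of_nat (degree E1 a)) - (1 - of_nat (degree E2 a))) * Q E"
        unfolding Db unfolding Da Q by (simp add: algebra_simps)
      also have "(1 - rat_of_nat (degree E1 b)) * (1 - of_nat (degree E1 a)) - (1 - of_nat (degree E2 a)) =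
          (1 - of_nat (degree E b)) * (1 - of_nat (degree E a))"
        using deg_a deg_b by (simp add: degree1 degree2 of_nat_diff algebra_simps)
      finally show ?thesis unfolding Db unfolding Da by simp
    next
      case False
      then have Da: "(\<Prod>x\<in>D - {b}. 1 - rat_of_nat (degree F x)) = Q F" for F
        unfolding Q_def by (intro prod.cong) auto
      have "(\<Prod>x\<in>D. 1 - rat_of_nat (degree E1 x)) - (\<Prod>x\<in>D - {b}. 1 - of_nat (degree E2 x)) =
          (1 - of_nat (degree E1 b) - 1) * Q E"
        unfolding Db unfolding Da Q by (simp add: algebra_simps)
      also have "1 - rat_of_nat (degree E1 b) - 1 = 1 - of_nat (degree E b)"
        using deg_b by (simp add: degree1 of_nat_diff)
      finally show ?thesis unfolding Db unfolding Da by simp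
    qed
    then show ?thesis using 2 by blast
  next
    case False
    then have "a \<notin> D" using deep by (auto simp: D_def)
    have "star_lead n (chrom_sym V E2) ?\<Lambda> 0"
      by (rule star_lead_less[OF IH comp_sizes2_less]) (use False \<open>a \<notin> D\<close> in \<open>simp_all add: D_def\<close>)
    moreover have "(\<Prod>x\<in>D. 1 - of_nat (degree E1 x)) = (\<Prod>x\<in>D. 1 - rat_of_nat (degree E x))"
      using False \<open>a \<notin> D\<close> by (intro prod.cong) (auto simp: degree1)
    ultimately show ?thesis by auto
  qed
  then obtain w where w: "star_lead n (chrom_sym V E2) ?\<Lambda> w"
    "(\<Prod>x\<in>D. 1 - of_nat (degree E1 x)) - w = (\<Prod>x\<in>D. 1 - rat_of_nat (degree E x))" by blast
  from star_lead_linear[OF star_lead_linear[OF 1 w(1), of 1 "-1"] 3, of 1 1]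
  show ?thesis using w(2) unfolding X[symmetric] by (simp add: D_def)
qed

end

theorem star_lead_forest:
  assumes "simple_graph V E" "forest E"
  shows "star_lead (card V) (chrom_sym V E) (comp_sizes V (leaf_edges E))
    (\<Prod>x | deep_vertex V E x. 1 - of_nat (degree E x))"
  using assms
proof (induction "card (E - leaf_edges E)" arbitrary: E rule: less_induct)
  case less
  have finE: "finite E" using less.prems(1) by (rule simple_graph_finite_edges)
  show ?case
  proof (cases "E = leaf_edges E")
    case True
    have V: "finite V" using less.prems(1) by (simp add: simple_graph_def)
    obtain C Y r where r: "V = C \<union> Y" "C \<inter> Y = {}" "finite C" "finite Y" "r ` Y \<subseteq> C"
      "leaf_edges E = (\<lambda>y. {y, r y}) ` Y"
      using leaf_edges_star_forest[OF less.prems] by metis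
    obtain l where l: "l \<in> partitions (card V)" "mset l = comp_sizes V (leaf_edges E)"
      using partition_of_kernel_sizes[OF V] by metis
    have chrom: "chrom_sym V E = star_part l"
      using chrom_sym_star_forest[OF r(3,4,2,5), of l] l(2) comp_sizes_star_forest[OF r(3,4,2,5)] True
      unfolding r(1,6) by simp
    have "\<not> deep_vertex V E x" for x
    proof
      assume "deep_vertex V E x"
      then have "2 \<le> degree E x" "x \<notin> \<Union>E"
        using deep_vertex_iff[OF less.prems(1)] True by auto
      moreover from this have "{e \<in> E. x \<in> e} = {}" by blast
      ultimately show False by (simp add: degree_def)
    qed
    then have prod: "(\<Prod>x | deep_vertex V E x. 1 - rat_of_nat (degree E x)) = 1"
      by (intro prod.neutral) auto
    show ?thesis unfolding prod chrom l(2)[symmetric] by (rule star_lead_star_part[OF l(1)])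
  next
    case False
    then obtain e where e: "e \<in> E" "e \<notin> leaf_edges E" using leaf_edges_subset by blast
    then obtain x y where xy: "e = {x, y}" using simple_graph_edgeE[OF less.prems(1)] by metis
    have deg: "2 \<le> degree E z" if "z \<in> e" for z
      using degree_pos[OF finE e(1) that] e that by (auto simp: leaf_edges_def)
    have "\<exists>a b. e = {a, b} \<and> (deep_vertex V E a \<longrightarrow> deep_vertex V E b)"
      using xy by (metis insert_commute)
    then obtain a b where names: "e = {a, b}" "deep_vertex V E a \<Longrightarrow> deep_vertex V E b" by blast
    interpret internal_edge V E a b
      using less.prems e deg names(1) by unfold_locales auto
    have f3: "forest E3" by (rule forest_contracted[OF simple forest edge])
    show ?thesis
    proof (rule star_lead_step)
      fix F assume "F \<in> {E1, E2, E3}"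
      then have "card (F - leaf_edges F) < card (E - leaf_edges E) \<and> simple_graph V F \<and> forest F"
        using card_internal_less simple1 simple2 simple3 f3 forest_subset[OF f3, of E2]
          forest_subset[OF forest, of E1] by auto
      then show "star_lead (card V) (chrom_sym V F) (comp_sizes V (leaf_edges F))
          (\<Prod>x | deep_vertex V F x. 1 - of_nat (degree F x))"
        using less.hyps by blast
    qed (rule names(2))
  qed
qed

section \<open>Cycles\<close>

lemma cycle_if_no_leaf:
  assumes "simple_graph V E" "E \<noteq> {}" "\<And>x. degree E x \<noteq> 1"
  shows "\<exists>ws. is_cycle V E ws"
proof -
  have fin: "finite V" "finite E" using assms(1) simple_graph_finite_edges by (auto simp: simple_graph_def)
  define Q where "Q = {xs. distinct xs \<and> set xs \<subseteq> V \<and> 2 \<le> length xs \<and>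
    (\<forall>i. Suc i < length xs \<longrightarrow> {xs ! i, xs ! Suc i} \<in> E)}"
  obtain e where "e \<in> E" using assms(2) by blast
  then obtain x y where xy: "{x, y} \<in> E" using simple_graph_edgeE[OF assms(1)] by metis
  have "[x, y] \<in> Q" using xy simple_graph_edgeD[OF assms(1) xy] by (auto simp: Q_def nth_Cons' less_Suc_eq)
  moreover have "Q \<subseteq> {xs. set xs \<subseteq> V \<and> length xs \<le> card V}"
    using fin(1) by (auto simp: Q_def) (metis card_mono distinct_card)
  then have "finite Q" using finite_lists_length_le[OF fin(1)] by (rule finite_subset)
  ultimately have "Max (length ` Q) \<in> length ` Q" by (intro Max_in) auto
  then obtain xs where xs: "xs \<in> Q" "length xs = Max (length ` Q)" by auto
  have max: "length ys \<le> length xs" if "ys \<in> Q" for ys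
    using that \<open>finite Q\<close> xs(2) by simp
  have x: "distinct xs" "set xs \<subseteq> V" "2 \<le> length xs" "\<And>i. Suc i < length xs \<Longrightarrow> {xs ! i, xs ! Suc i} \<in> E"
    using xs(1) by (auto simp: Q_def)
  define f where "f = {xs ! 0, xs ! 1}"
  have f: "f \<in> E" using x(4)[of 0] x(3) by (simp add: f_def)
  have "\<exists>g\<in>E. xs ! 0 \<in> g \<and> g \<noteq> f"
  proof (rule ccontr)
    assume "\<not> (\<exists>g\<in>E. xs ! 0 \<in> g \<and> g \<noteq> f)"
    moreover have "xs ! 0 \<in> f" by (simp add: f_def)
    ultimately have "{g \<in> E. xs ! 0 \<in> g} = {f}" using f by blast
    then have "degree E (xs ! 0) = 1" by (simp add: degree_def)
    then show False using assms(3) by blast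
  qed
  then obtain g where g: "g \<in> E" "xs ! 0 \<in> g" "g \<noteq> f" by blast
  then obtain z where z: "g = {xs ! 0, z}" "xs ! 0 \<noteq> z" using simple_graph_edge_at[OF assms(1)] by metis
  have "z \<in> V" using simple_graph_edgeD[OF assms(1), of "xs ! 0" z] g z by simp
  have "z \<in> set xs"
  proof (rule ccontr)
    assume "z \<notin> set xs"
    have "{(z # xs) ! i, (z # xs) ! Suc i} \<in> E" if "Suc i < length (z # xs)" for i
      using that x(4) g(1) z by (cases i) (auto simp: insert_commute)
    then have "z # xs \<in> Q" using x \<open>z \<in> V\<close> \<open>z \<notin> set xs\<close> by (simp add: Q_def)
    from max[OF this] show False by simp
  qed
  then obtain j where j: "j < length xs" "z = xs ! j" by (metis in_set_conv_nth)
  have "j \<noteq> 0" using j(2) z(2) by metis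
  moreover have "j \<noteq> 1" using j(2) g(3) z(1) by (auto simp: f_def)
  ultimately have j2: "2 \<le> j" by simp
  let ?ws = "take (Suc j) xs"
  have len: "length ?ws = Suc j" using j by simp
  have "cycle_edge ?ws i \<in> E" if "i < Suc j" for i
  proof (cases "i = j")
    case True
    then have "cycle_edge ?ws i = g" using j z by (simp add: cycle_edge_def insert_commute)
    then show ?thesis using g by simp
  next
    case False
    then have "cycle_edge ?ws i = {xs ! i, xs ! Suc i}" using that j by (simp add: cycle_edge_def)
    then show ?thesis using x(4) that j False by simp
  qed
  then have "is_cycle V E ?ws"
    using x(1,2) j2 j set_take_subset[of "Suc j" xs] unfolding is_cycle_def cycle_edges_def len by auto
  then show ?thesis by blast
qed

lemma forest_if_no_cycle:
  assumes "simple_graph V E" "\<nexists>ws. is_cycle V E ws"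
  shows "forest E"
  using assms
proof (induction "card E" arbitrary: E rule: less_induct)
  case less
  have fin: "finite E" using less.prems(1) by (rule simple_graph_finite_edges)
  show ?case
  proof (cases "E = {}")
    case True
    then show ?thesis by (simp add: forest_def)
  next
    case False
    then obtain x where x: "degree E x = 1" using cycle_if_no_leaf[OF less.prems(1)] less.prems(2) by blast
    then obtain e where e: "{e \<in> E. x \<in> e} = {e}" by (auto simp: degree_def card_1_singleton_iff)
    then have eE: "e \<in> E" "x \<in> e" by auto
    obtain y where y: "e = {x, y}" "x \<noteq> y" using simple_graph_edge_at[OF less.prems(1) eE] by metis
    have nb: "w = y" if "{x, w} \<in> E" for w
    proof -
      have "{x, w} \<in> {e \<in> E. x \<in> e}" using that by simp
      then show ?thesis using e y by (auto simp: doubleton_eq_iff)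
    qed
    have "card (E - {e}) < card E" using fin eE by (intro card_Diff1_less)
    moreover have "simple_graph V (E - {e})" using less.prems(1) by (rule simple_graph_subset) auto
    moreover have "\<nexists>ws. is_cycle V (E - {e}) ws" using less.prems(2) by (auto simp: is_cycle_def)
    ultimately have "forest (E - {e})" by (rule less.hyps)
    then obtain h :: "'a \<Rightarrow> nat" where h: "\<And>x y. {x, y} \<in> E - {e} \<Longrightarrow> h x \<noteq> h y"
      "\<And>x y z. {x, y} \<in> E - {e} \<Longrightarrow> {x, z} \<in> E - {e} \<Longrightarrow> h y < h x \<Longrightarrow> h z < h x \<Longrightarrow> y = z"
      using forestE by metis
    let ?h = "h(x := Suc (h y))"
    have old: "{u, w} \<in> E - {e}" if "{u, w} \<in> E" "u \<noteq> x" "w \<noteq> x" for u w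
      using that eE by auto
    show ?thesis
    proof (rule forestI[of _ ?h])
      fix u w assume uw: "{u, w} \<in> E"
      then have "{w, u} \<in> E" by (simp add: insert_commute)
      then show "?h u \<noteq> ?h w"
        using uw nb[of u] nb[of w] old[OF uw] h(1)[of u w] y(2) by auto
    next
      fix u w z assume *: "{u, w} \<in> E" "{u, z} \<in> E" "?h w < ?h u" "?h z < ?h u"
      show "w = z"
      proof (cases "u = x")
        case True
        then show ?thesis using * nb by metis
      next
        case False
        have "t \<noteq> x" if "{u, t} \<in> E" "?h t < ?h u" for t
        proof
          assume "t = x"
          then have "u = y" using nb[of u] that(1) by (simp add: insert_commute)
          then show False using that(2) \<open>t = x\<close> y(2) by simp
        qed
        then have "w \<noteq> x" "z \<noteq> x" using * by blast+
        then show ?thesis using h(2)[OF old[OF *(1) False] old[OF *(2) False]] *(3,4) False by simp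
      qed
    qed
  qed
qed

lemma cycle_edge_last: "vs \<noteq> [] \<Longrightarrow> cycle_edge vs (length vs - 1) = {vs ! (length vs - 1), vs ! 0}"
proof -
  assume "vs \<noteq> []"
  then have "Suc (length vs - 1) = length vs" by simp
  then show ?thesis by (simp only: cycle_edge_def mod_self)
qed

lemma cycle_edge_less: "Suc k < length vs \<Longrightarrow> cycle_edge vs k = {vs ! k, vs ! Suc k}"
  by (simp add: cycle_edge_def)

lemma sum_Pow_alternating_zero:
  fixes g :: "'b set \<Rightarrow> rat"
  assumes "finite N" "k \<in> N" "\<And>I. I \<subseteq> N - {k} \<Longrightarrow> g (insert k I) = g I"
  shows "(\<Sum>I\<in>Pow N. (- 1) ^ card I * g I) = 0"
proof -
  let ?N = "N - {k}"
  have N: "N = insert k ?N" using assms(2) by blast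
  have inj: "inj_on (insert k) (Pow ?N)" by (auto simp: inj_on_def)
  have "(\<Sum>I\<in>Pow N. (- 1) ^ card I * g I) =
      (\<Sum>I\<in>Pow ?N. (- 1) ^ card I * g I) + (\<Sum>I\<in>insert k ` Pow ?N. (- 1) ^ card I * g I)"
    by (subst N, subst Pow_insert, subst sum.union_disjoint) (use assms(1) in auto)
  also have "(\<Sum>I\<in>insert k ` Pow ?N. (- 1) ^ card I * g I) = (\<Sum>I\<in>Pow ?N. - ((- 1) ^ card I * g I))"
    unfolding sum.reindex[OF inj] comp_def
  proof (rule sum.cong)
    fix I assume "I \<in> Pow ?N"
    then have I: "I \<subseteq> ?N" by simp
    then have "card (insert k I) = Suc (card I)"
      using assms(1) by (intro card_insert_disjoint) (auto intro: finite_subset)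
    then show "(- 1) ^ card (insert k I) * g (insert k I) = - ((- 1) ^ card I * g I)"
      using assms(3)[OF I] by simp
  qed simp
  finally show ?thesis by (simp add: sum_negf)
qed

text \<open>A colouring that is monochromatic on all but one edge of a cycle is monochromatic on the last
  one; otherwise the deletion of a properly coloured edge changes nothing but the sign.\<close>

lemma chrom_sym_cycle_deletion:
  assumes "simple_graph V E" "is_cycle V E vs" "c = length vs"
  shows "(\<Sum>I\<in>Pow {..<c - 1}. (- 1) ^ card I * chrom_sym V (E - cycle_edge vs ` I) m) = 0"
proof -
  define K where "K = {\<kappa> \<in> V \<rightarrow>\<^sub>E UNIV. image_mset \<kappa> (mset_set V) = m}"
  define P where "P \<kappa> I \<longleftrightarrow> (\<forall>e\<in>E - cycle_edge vs ` I. card (\<kappa> ` e) = 2)" for \<kappa> :: "'a \<Rightarrow> nat" and I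
  have V: "finite V" using assms(1) by (simp add: simple_graph_def)
  have c: "3 \<le> c" using assms(2,3) by (simp add: is_cycle_def)
  have finK: "finite K"
    using finite_wcolorings[OF V, of "\<lambda>_. 1" "{}" m] by (simp add: K_def sum_singleton_mset proper_colorings_def)
  have X: "chrom_sym V (E - cycle_edge vs ` I) m = (\<Sum>\<kappa>\<in>K. of_bool (P \<kappa> I))" for I
  proof -
    have "simple_graph V (E - cycle_edge vs ` I)" using assms(1) by (rule simple_graph_subset) auto
    then have "{\<kappa> \<in> proper_colorings V (E - cycle_edge vs ` I). image_mset \<kappa> (mset_set V) = m} = K \<inter> {\<kappa>. P \<kappa> I}"
      by (auto simp: proper_colorings_iff K_def P_def)
    then show ?thesis using finK by (simp add: chrom_sym_def sum.If_cases of_bool_def)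
  qed
  have inner: "(\<Sum>I\<in>Pow {..<c - 1}. (- 1) ^ card I * of_bool (P \<kappa> I)) = (0 :: rat)" for \<kappa>
  proof (cases "\<exists>k<c - 1. card (\<kappa> ` cycle_edge vs k) = 2")
    case True
    then obtain k where k: "k < c - 1" "card (\<kappa> ` cycle_edge vs k) = 2" by blast
    show ?thesis
      by (rule sum_Pow_alternating_zero[where k = k]) (use k in \<open>auto simp: P_def\<close>)
  next
    case False
    have same: "\<kappa> (vs ! Suc k) = \<kappa> (vs ! k)" if "k < c - 1" for k
    proof (rule ccontr)
      assume "\<kappa> (vs ! Suc k) \<noteq> \<kappa> (vs ! k)"
      moreover have "cycle_edge vs k = {vs ! k, vs ! Suc k}"
        using that assms(3) by (simp add: cycle_edge_def)
      ultimately have "card (\<kappa> ` cycle_edge vs k) = 2" by auto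
      then show False using False that by blast
    qed
    have const: "\<kappa> (vs ! k) = \<kappa> (vs ! 0)" if "k \<le> c - 1" for k
      using that by (induction k) (simp_all add: same)
    have last: "cycle_edge vs (c - 1) = {vs ! (c - 1), vs ! 0}"
    proof -
      have "vs \<noteq> []" using c assms(3) by auto
      then show ?thesis unfolding assms(3) by (rule cycle_edge_last)
    qed
    have "\<kappa> ` cycle_edge vs (c - 1) = {\<kappa> (vs ! 0)}"
      unfolding last image_insert image_empty const[OF order.refl] by simp
    then have mono: "card (\<kappa> ` cycle_edge vs (c - 1)) \<noteq> 2" by simp
    have "cycle_edge vs (c - 1) \<in> E"
      using assms(2,3) c by (auto simp: is_cycle_def cycle_edges_def)
    moreover have "cycle_edge vs (c - 1) \<notin> cycle_edge vs ` I" if I: "I \<subseteq> {..<c - 1}" for I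
    proof
      assume "cycle_edge vs (c - 1) \<in> cycle_edge vs ` I"
      then obtain k where k: "k < c - 1" "cycle_edge vs (c - 1) = cycle_edge vs k" using I by blast
      have "cycle_edge vs k = {vs ! k, vs ! Suc k}" using k(1) assms(3) by (simp add: cycle_edge_def)
      then have "{vs ! (c - 1), vs ! 0} = {vs ! k, vs ! Suc k}" using k(2) last by simp
      moreover have "vs ! i = vs ! j \<longleftrightarrow> i = j" if "i < c" "j < c" for i j
        using assms(2,3) that by (simp add: is_cycle_def nth_eq_iff_index_eq)
      ultimately have "c - 1 = k \<or> c - 1 = Suc k \<and> k = 0"
        using k(1) c by (auto simp: doubleton_eq_iff)
      then show False using k(1) c by auto
    qed
    ultimately have "\<not> P \<kappa> I" if "I \<in> Pow {..<c - 1}" for I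
      using that mono unfolding P_def by blast
    then show ?thesis by (intro sum.neutral) auto
  qed
  have "(\<Sum>I\<in>Pow {..<c - 1}. (- 1) ^ card I * chrom_sym V (E - cycle_edge vs ` I) m) =
    (\<Sum>\<kappa>\<in>K. \<Sum>I\<in>Pow {..<c - 1}. (- 1) ^ card I * of_bool (P \<kappa> I))"
    unfolding X sum_distrib_left by (rule sum.swap)
  then show ?thesis by (simp only: inner sum.neutral_const)
qed

section \<open>Unicyclic graphs with one non-trivial tree\<close>

locale unicyclic_one_tree =
  fixes V :: "'a set" and E :: "'a set set" and vs :: "'a list" and v :: 'a and c :: nat
  assumes simple: "simple_graph V E" and unicyclic: "unicyclic V E"
    and cycle: "is_cycle V E vs" and c_def: "c = length vs"
    and tree: "{x \<in> set vs. card (component V (E - cycle_edges vs) x) > 1} = {v}"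
    and v_nth: "vs ! 0 = v"
begin

abbreviation "ce \<equiv> cycle_edge vs"

definition del :: "nat set \<Rightarrow> 'a set set" where
  "del I = E - ce ` I"

lemma c3: "3 \<le> c" and dist: "distinct vs" and vsV: "set vs \<subseteq> V" and ceE: "i < c \<Longrightarrow> ce i \<in> E"
  using cycle by (auto simp: is_cycle_def cycle_edges_def c_def)

lemma fin: "finite V" "finite E"
  using simple simple_graph_finite_edges by (auto simp: simple_graph_def)

lemma nth_vs: "i < c \<Longrightarrow> vs ! i \<in> set vs"
  by (simp add: c_def)

lemma in_vsE:
  assumes "x \<in> set vs"
  obtains "x = v" | i where "1 \<le> i" "i < c" "x = vs ! i"
proof -
  obtain i where i: "i < c" "x = vs ! i" using assms by (auto simp: in_set_conv_nth c_def)
  show thesis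
  proof (cases "i = 0")
    case True
    then show thesis using that(1) i v_nth by simp
  next
    case False
    then show thesis using that(2)[of i] i by simp
  qed
qed

lemma nth_eq: "i < c \<Longrightarrow> j < c \<Longrightarrow> vs ! i = vs ! j \<longleftrightarrow> i = j"
  using dist by (simp add: nth_eq_iff_index_eq c_def)

lemma ce_less: "Suc i < c \<Longrightarrow> ce i = {vs ! i, vs ! Suc i}"
  using cycle_edge_less[of i vs] by (simp add: c_def)

lemma ce_last: "ce (c - 1) = {vs ! (c - 1), v}"
proof -
  have "vs \<noteq> []" using c3 by (auto simp: c_def)
  from cycle_edge_last[OF this] show ?thesis unfolding c_def v_nth .
qed

lemma v_in: "v \<in> set vs" "v \<in> V"
  using tree vsV by auto

lemma nth_ne_v: "1 \<le> i \<Longrightarrow> i < c \<Longrightarrow> vs ! i \<noteq> v"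
  using nth_eq[of i 0] v_nth by auto

lemma v_notin_nths: "1 \<le> k \<Longrightarrow> v \<notin> (!) vs ` {k..<c}"
proof
  assume k: "1 \<le> k" and "v \<in> (!) vs ` {k..<c}"
  then obtain i where i: "i \<in> {k..<c}" "v = vs ! i" by blast
  then show False using nth_ne_v[of i] k by simp
qed

lemma mem_ce_iff:
  assumes "k < c"
  shows "x \<in> ce k \<longleftrightarrow> x = vs ! k \<or> x = (if Suc k = c then v else vs ! Suc k)"
proof (cases "Suc k = c")
  case True
  then have "k = c - 1" by simp
  then show ?thesis using ce_last True by simp
next
  case False
  then show ?thesis using ce_less[of k] assms by simp
qed

lemma ce_subset: "k < c \<Longrightarrow> ce k \<subseteq> set vs"
  using mem_ce_iff nth_vs v_in by (auto split: if_splits)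

lemma nth_in_ce_iff:
  assumes "k < c" "1 \<le> i" "i < c"
  shows "vs ! i \<in> ce k \<longleftrightarrow> k = i \<or> Suc k = i"
  using assms nth_ne_v[OF assms(2,3)] nth_eq[of i k] nth_eq[of i "Suc k"]
  by (auto simp: mem_ce_iff)

lemma v_in_ce_iff:
  assumes "k < c"
  shows "v \<in> ce k \<longleftrightarrow> k = 0 \<or> Suc k = c"
  using assms nth_ne_v[of k] nth_ne_v[of "Suc k"] v_nth
  by (cases "k = 0") (auto simp: mem_ce_iff)

lemma ce_inj: "inj_on ce {..<c}"
proof -
  have *: "k = l" if kl: "ce k = ce l" "k < c" "l < c" "k \<le> l" for k l
  proof (rule ccontr)
    assume "k \<noteq> l"
    then have l: "1 \<le> l" "k < l" using kl by auto
    have "vs ! l \<in> ce k" using kl mem_ce_iff[of l "vs ! l"] by simp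
    then have "l = Suc k" using nth_in_ce_iff[of k l] kl l by simp
    then show False
    proof (cases "Suc l = c")
      case True
      then have "v \<in> ce k" using v_in_ce_iff[of l] kl by simp
      then show False using v_in_ce_iff[of k] kl True \<open>l = Suc k\<close> c3 by auto
    next
      case False
      then have "vs ! Suc l \<in> ce k" using kl mem_ce_iff[of l] by simp
      then show False using nth_in_ce_iff[of k "Suc l"] kl False \<open>l = Suc k\<close> by simp
    qed
  qed
  show ?thesis
  proof (rule inj_onI)
    fix k l assume "k \<in> {..<c}" "l \<in> {..<c}" "ce k = ce l"
    then show "k = l" using *[of k l] *[of l k] by (cases "k \<le> l") auto
  qed
qed

lemma ce_in_del_iff: "I \<subseteq> {..<c} \<Longrightarrow> k < c \<Longrightarrow> ce k \<in> del I \<longleftrightarrow> k \<notin> I"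
  using ceE inj_on_image_mem_iff[OF ce_inj, of k I] by (simp add: del_def)

lemma edge_at_nth:
  assumes "1 \<le> i" "i < c" "e \<in> E" "vs ! i \<in> e"
  shows "e = ce (i - 1) \<or> e = ce i"
proof -
  have "e \<in> cycle_edges vs"
  proof (rule ccontr)
    assume "e \<notin> cycle_edges vs"
    obtain y where y: "e = {vs ! i, y}" "vs ! i \<noteq> y" using simple_graph_edge_at[OF simple assms(3,4)] by metis
    have V: "vs ! i \<in> V" "y \<in> V" using simple_graph_edgeD[OF simple, of "vs ! i" y] assms(3) y by auto
    have "(vs ! i, y) \<in> (adj_rel (E - cycle_edges vs))\<^sup>*"
      using assms(3) \<open>e \<notin> cycle_edges vs\<close> y by (auto simp: adj_rel_def intro!: r_into_rtrancl)
    then have "{vs ! i, y} \<subseteq> component V (E - cycle_edges vs) (vs ! i)"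
      using V by (simp add: component_def)
    moreover have "finite (component V (E - cycle_edges vs) (vs ! i))"
      using fin by (simp add: component_def)
    ultimately have "card {vs ! i, y} \<le> card (component V (E - cycle_edges vs) (vs ! i))" by (intro card_mono)
    then have "vs ! i \<in> {x \<in> set vs. card (component V (E - cycle_edges vs) x) > 1}"
      using y(2) nth_vs[OF assms(2)] by simp
    then show False unfolding tree using nth_ne_v[OF assms(1,2)] by simp
  qed
  then obtain k where k: "k < c" "e = ce k" by (auto simp: cycle_edges_def c_def)
  then have "k = i \<or> Suc k = i" using nth_in_ce_iff assms by blast
  then show ?thesis using k(2) by auto
qed

lemma edges_at_nth:
  assumes "1 \<le> i" "i < c" "I \<subseteq> {..<c}"
  shows "{e \<in> del I. vs ! i \<in> e} = ce ` ({i - 1, i} - I)"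
proof (intro subset_antisym subsetI)
  fix e assume e: "e \<in> {e \<in> del I. vs ! i \<in> e}"
  then have "e = ce (i - 1) \<or> e = ce i" using edge_at_nth[OF assms(1,2)] by (simp add: del_def)
  then obtain k where k: "k \<in> {i - 1, i}" "e = ce k" by blast
  then have "k < c" using assms by auto
  then have "k \<notin> I" using ce_in_del_iff[OF assms(3)] k e by simp
  then show "e \<in> ce ` ({i - 1, i} - I)" using k by blast
next
  fix e assume "e \<in> ce ` ({i - 1, i} - I)"
  then obtain k where k: "k = i - 1 \<or> k = i" "k \<notin> I" "e = ce k" by blast
  then have "k < c" "k = i \<or> Suc k = i" using assms by auto
  then show "e \<in> {e \<in> del I. vs ! i \<in> e}"
    using ce_in_del_iff[OF assms(3)] nth_in_ce_iff[OF _ assms(1,2)] k by simp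
qed

lemma degree_nth:
  assumes "1 \<le> i" "i < c" "I \<subseteq> {..<c}"
  shows "degree (del I) (vs ! i) = card ({i - 1, i} - I)"
  unfolding degree_def edges_at_nth[OF assms] using assms
  by (intro card_image inj_on_subset[OF ce_inj]) auto

lemma degree_off_cycle:
  assumes "x \<notin> set vs" "I \<subseteq> {..<c}"
  shows "degree (del I) x = degree E x"
proof -
  have "x \<notin> ce k" if "k \<in> I" for k using that assms ce_subset by blast
  then have "{e \<in> del I. x \<in> e} = {e \<in> E. x \<in> e}" by (auto simp: del_def)
  then show ?thesis by (simp add: degree_def)
qed

lemma degree_v: 
  assumes "I \<subseteq> {..<c - 1}"
  shows "degree (del I) v = degree E v - of_bool (0 \<in> I)"
proof -
  have *: "v \<in> ce k \<longleftrightarrow> k = 0" if "k \<in> I" for k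
  proof -
    have "k < c - 1" using that assms by blast
    then show ?thesis using v_in_ce_iff[of k] by auto
  qed
  have "ce 0 \<in> {e \<in> E. v \<in> e}" using ceE[of 0] v_in_ce_iff[of 0] c3 by simp
  moreover have "{e \<in> del I. v \<in> e} = (if 0 \<in> I then {e \<in> E. v \<in> e} - {ce 0} else {e \<in> E. v \<in> e})"
    using * by (auto simp: del_def)
  ultimately show ?thesis using fin(2) by (simp add: degree_def)
qed

lemma degree_v_ge: "3 \<le> degree E v"
proof -
  have card: "card (component V (E - cycle_edges vs) v) > 1" using tree by auto
  have "\<not> component V (E - cycle_edges vs) v \<subseteq> {v}"
  proof
    assume "component V (E - cycle_edges vs) v \<subseteq> {v}"
    from card_mono[OF _ this] card show False by simp
  qed
  then obtain y where "(v, y) \<in> (adj_rel (E - cycle_edges vs))\<^sup>*" "y \<noteq> v" by (auto simp: component_def)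
  then obtain z where "(v, z) \<in> adj_rel (E - cycle_edges vs)"
    by (auto elim: converse_rtranclE)
  then have "{v, z} \<in> E - cycle_edges vs" by (simp add: adj_rel_def)
  moreover have "ce 0 \<in> cycle_edges vs" "ce (c - 1) \<in> cycle_edges vs"
    using c3 by (auto simp: cycle_edges_def c_def)
  moreover have "ce 0 \<noteq> ce (c - 1)" using inj_onD[OF ce_inj, of 0 "c - 1"] c3 by auto
  ultimately have "distinct [ce 0, ce (c - 1), {v, z}]" "{v, z} \<in> E" by (metis DiffD1 DiffD2 distinct.simps(2) distinct_length_2_or_more distinct_singleton)+
  from distinct_card[OF this(1)] have "card {ce 0, ce (c - 1), {v, z}} = 3" by simp
  moreover have "{ce 0, ce (c - 1), {v, z}} \<subseteq> {e \<in> E. v \<in> e}"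
    using ceE[of 0] ceE[of "c - 1"] v_in_ce_iff[of 0] v_in_ce_iff[of "c - 1"] c3 \<open>{v, z} \<in> E\<close> by auto
  then have "card {ce 0, ce (c - 1), {v, z}} \<le> degree E v"
    unfolding degree_def using fin by (intro card_mono) auto
  ultimately show ?thesis by simp
qed

lemma degree_cycle_ge: "x \<in> set vs \<Longrightarrow> 2 \<le> degree E x"
proof (elim in_vsE)
  fix i assume "1 \<le> i" "i < c" "x = vs ! i"
  then show "2 \<le> degree E x" using degree_nth[of i "{}"] by (simp add: del_def)
qed (use degree_v_ge in simp)

lemma leaf_edges_sub_del:
  assumes "I \<subseteq> {..<c}"
  shows "leaf_edges E \<subseteq> leaf_edges (del I)"
proof
  fix f assume "f \<in> leaf_edges E"
  then obtain x where x: "f \<in> E" "x \<in> f" "degree E x = 1" by (auto simp: leaf_edges_def)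
  then have "x \<notin> set vs" using degree_cycle_ge by fastforce
  moreover from this have "f \<notin> ce ` I" using x(2) ce_subset assms by blast
  moreover have "degree (del I) x = 1" using x(3) degree_off_cycle[OF \<open>x \<notin> set vs\<close> assms] by simp
  ultimately show "f \<in> leaf_edges (del I)" using x by (auto simp: leaf_edges_def del_def)
qed

lemma isolated:
  assumes "1 \<le> i" "i < c"
  shows "vs ! i \<notin> \<Union>(leaf_edges E)"
proof
  assume "vs ! i \<in> \<Union>(leaf_edges E)"
  then obtain e x where e: "e \<in> E" "vs ! i \<in> e" "x \<in> e" "degree E x = 1" by (auto simp: leaf_edges_def)
  then have "e = ce (i - 1) \<or> e = ce i" using edge_at_nth assms by blast
  moreover have "i - 1 < c" using assms by simp
  ultimately have "x \<in> set vs" using ce_subset[of i] ce_subset[of "i - 1"] e(3) assms by auto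
  then show False using degree_cycle_ge e(4) by fastforce
qed

lemma simple_del: "simple_graph V (del I)"
  using simple by (rule simple_graph_subset) (simp add: del_def)

lemma forest_del:
  assumes "k \<in> I" "k < c"
  shows "forest (del I)"
proof (rule forest_if_no_cycle[OF simple_del])
  show "\<nexists>ws. is_cycle V (del I) ws"
  proof
    assume "\<exists>ws. is_cycle V (del I) ws"
    then obtain ws where ws: "is_cycle V (del I) ws" ..
    then have "is_cycle V E ws" by (auto simp: is_cycle_def del_def)
    then have "cycle_edges ws = cycle_edges vs" using unicyclic cycle unfolding unicyclic_def by blast
    moreover have "ce k \<in> cycle_edges vs" using assms(2) by (simp add: cycle_edges_def c_def)
    ultimately show False using ws assms(1) by (auto simp: is_cycle_def del_def)
  qed
qed

abbreviation "L0 \<equiv> leaf_edges E"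

definition lead_sizes :: "nat multiset" where
  "lead_sizes = comp_sizes V (insert (ce 1) L0)"

lemma comp_sizes_ce:
  assumes "1 \<le> j" "Suc j < c"
  shows "comp_sizes V (insert (ce j) L0) + {#1, 1#} = comp_sizes V L0 + {#2#}"
proof -
  have V: "vs ! j \<in> V" "vs ! Suc j \<in> V" using nth_vs vsV assms by auto
  have iso: "vs ! j \<notin> \<Union>L0" "vs ! Suc j \<notin> \<Union>L0" using isolated assms by auto
  have "vs ! j \<noteq> vs ! Suc j" using nth_eq assms by simp
  then have "(vs ! j, vs ! Suc j) \<notin> (adj_rel L0)\<^sup>*" using rtrancl_isolated[OF _ iso(1)] by metis
  from comp_sizes_insert[OF fin(1) V this] show ?thesis
    using component_isolated[OF V(1) iso(1)] component_isolated[OF V(2) iso(2)] ce_less[OF assms(2)]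
    by (simp add: numeral_2_eq_2)
qed

lemma comp_sizes_ce_eq:
  assumes "1 \<le> j" "Suc j < c"
  shows "comp_sizes V (insert (ce j) L0) = lead_sizes"
  using comp_sizes_ce[OF assms] comp_sizes_ce[of 1] c3 unfolding lead_sizes_def
  by (metis (no_types, lifting) One_nat_def Suc_le_eq add_right_cancel le_refl numeral_3_eq_3)

lemma comp_sizes_ce_last:
  "comp_sizes V (insert (ce (c - 1)) L0) + {#1, card (component V L0 v)#} =
    comp_sizes V L0 + {#Suc (card (component V L0 v))#}"
proof -
  have w: "vs ! (c - 1) \<in> V" using nth_vs vsV c3 by auto
  have iso: "vs ! (c - 1) \<notin> \<Union>L0" using isolated c3 by simp
  have "vs ! (c - 1) \<noteq> v" using nth_ne_v c3 by simp
  then have "(vs ! (c - 1), v) \<notin> (adj_rel L0)\<^sup>*" using rtrancl_isolated[OF _ iso] by metis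
  from comp_sizes_insert[OF fin(1) w v_in(2) this] show ?thesis
    using component_isolated[OF w iso] ce_last by simp
qed

lemma deep_v_iff: "deep_vertex V E v \<longleftrightarrow> v \<notin> \<Union>L0"
  using deep_vertex_iff[OF simple, of v] degree_v_ge v_in by auto

lemma comp_sizes_ce_last_deep:
  assumes "deep_vertex V E v"
  shows "comp_sizes V (insert (ce (c - 1)) L0) = lead_sizes"
proof -
  have "card (component V L0 v) = 1"
    using component_isolated[OF v_in(2)] assms deep_v_iff by simp
  then have "comp_sizes V (insert (ce (c - 1)) L0) + {#1, 1#} = lead_sizes + {#1, 1#}"
    using comp_sizes_ce_last comp_sizes_ce[of 1] c3 by (simp add: lead_sizes_def numeral_2_eq_2)
  then show ?thesis by (metis add_right_cancel)
qed

lemma comp_sizes_ce_last_less: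
  assumes "\<not> deep_vertex V E v"
  shows "lead_sizes < comp_sizes V (insert (ce (c - 1)) L0)"
proof -
  let ?s = "card (component V L0 v)" and ?X = "comp_sizes V (insert (ce (c - 1)) L0)"
  obtain e where e: "e \<in> L0" "v \<in> e" using assms deep_v_iff by blast
  then obtain y where y: "e = {v, y}" "v \<noteq> y" using simple_graph_edge_at[OF simple] leaf_edges_subset by blast
  have "y \<in> V" using simple_graph_edgeD[OF simple, of v y] e y leaf_edges_subset by auto
  moreover have "(v, y) \<in> (adj_rel L0)\<^sup>*" using e y by (auto simp: adj_rel_def)
  ultimately have "{v, y} \<subseteq> component V L0 v" using v_in by (auto simp: component_def)
  moreover have "finite (component V L0 v)" using fin by (simp add: component_def)
  ultimately have "card {v, y} \<le> ?s" by (intro card_mono)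
  then have s: "2 \<le> ?s" using y(2) by simp
  have "{#2, ?s#} < {#1, Suc ?s#}"
    using s by (intro ex_gt_imp_less_multiset exI[of _ "Suc ?s"]) auto
  then have "comp_sizes V L0 + {#2, ?s#} < comp_sizes V L0 + {#1, Suc ?s#}"
    by (rule add_strict_left_mono)
  also have "comp_sizes V L0 + {#2, ?s#} = lead_sizes + {#1, 1, ?s#}"
    using comp_sizes_ce[of 1] c3 by (simp add: lead_sizes_def)
  also have "comp_sizes V L0 + {#1, Suc ?s#} = ?X + {#1, 1, ?s#}"
    using comp_sizes_ce_last by simp
  finally show ?thesis by (metis add_less_cancel_right)
qed

lemma lead_sizes_le:
  assumes "1 \<le> j" "j < c"
  shows "lead_sizes \<le> comp_sizes V (insert (ce j) L0)"
proof (cases "Suc j = c")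
  case True
  then have "j = c - 1" by simp
  then show ?thesis using comp_sizes_ce_last_deep comp_sizes_ce_last_less by (cases "deep_vertex V E v") auto
next
  case False
  then show ?thesis using comp_sizes_ce_eq assms by simp
qed

lemma leaf_edge_right:
  assumes "I \<subseteq> {..<c}" "j \<in> I" "Suc j \<notin> I" "Suc j < c"
  shows "ce (Suc j) \<in> leaf_edges (del I)"
proof -
  have "{Suc j - 1, Suc j} - I = {Suc j}" using assms by auto
  then have "degree (del I) (vs ! Suc j) = 1" using degree_nth[of "Suc j" I] assms by simp
  moreover have "vs ! Suc j \<in> ce (Suc j)" using mem_ce_iff assms by simp
  ultimately show ?thesis using ce_in_del_iff[OF assms(1,4)] assms(3) by (auto simp: leaf_edges_def)
qed

lemma leaf_edge_left:
  assumes "I \<subseteq> {..<c}" "i \<notin> I" "Suc i \<in> I" "Suc i < c"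
  shows "ce i \<in> leaf_edges (del I)"
proof -
  have "{Suc i - 1, Suc i} - I = {i}" using assms by auto
  then have "degree (del I) (vs ! Suc i) = 1" using degree_nth[of "Suc i" I] assms by simp
  moreover have "vs ! Suc i \<in> ce i" using mem_ce_iff assms by simp
  ultimately show ?thesis using ce_in_del_iff[OF assms(1), of i] assms by (auto simp: leaf_edges_def)
qed

lemma del_less:
  assumes I: "I \<subseteq> {..<c - 1}" "I \<noteq> {}" and no: "\<And>j. I \<noteq> {..j}"
  shows "lead_sizes < comp_sizes V (leaf_edges (del I))"
proof -
  have finI: "finite I" using I(1) by (rule finite_subset) simp
  define j where "j = Max I"
  have j: "j \<in> I" "\<And>k. k \<in> I \<Longrightarrow> k \<le> j" using finI I(2) by (auto simp: j_def)
  have jc: "Suc j < c" "Suc j \<notin> I" using j I(1) by fastforce+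
  have Ic: "I \<subseteq> {..<c}" using I(1) by auto
  let ?M = "insert (ce (Suc j)) L0"
  have M: "?M \<subseteq> leaf_edges (del I)"
    using leaf_edge_right[OF Ic j(1) jc(2,1)] leaf_edges_sub_del[OF Ic] by simp
  have "{..j} - I \<noteq> {}" using no[of j] j(2) by auto
  define i where "i = Max ({..j} - I)"
  have i: "i \<in> {..j} - I" unfolding i_def using \<open>{..j} - I \<noteq> {}\<close> by (intro Max_in) auto
  then have ij: "i < j" "i \<notin> I" using j(1) by (auto simp: order.order_iff_strict)
  have "Suc i \<in> I"
  proof (rule ccontr)
    assume "Suc i \<notin> I"
    then have "Suc i \<le> i" unfolding i_def using ij by (intro Max_ge) (auto simp flip: i_def)
    then show False by simp
  qed
  then have ci: "ce i \<in> leaf_edges (del I)" using leaf_edge_left[OF Ic ij(2)] ij jc by simp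
  have ei: "ce i = {vs ! i, vs ! Suc i}" using ce_less ij jc by simp
  have V: "vs ! i \<in> V" "vs ! Suc i \<in> V" using nth_vs[of i] nth_vs[of "Suc i"] vsV ij jc by auto
  have "vs ! Suc i \<notin> ce (Suc j)" using nth_in_ce_iff[of "Suc j" "Suc i"] ij jc by auto
  then have "vs ! Suc i \<notin> \<Union>?M" using isolated[of "Suc i"] ij jc by auto
  moreover have "vs ! i \<noteq> vs ! Suc i" using nth_eq[of i "Suc i"] ij jc by simp
  ultimately have "(vs ! i, vs ! Suc i) \<notin> (adj_rel ?M)\<^sup>*"
    using rtrancl_isolated[of "vs ! Suc i" "vs ! i" ?M] adj_rel_rtrancl_sym by metis
  then have "comp_sizes V ?M < comp_sizes V (leaf_edges (del I))"
    using ci V unfolding ei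
    by (intro comp_sizes_less[OF fin(1) finite_leaf_edges[OF simple_del] M leaf_edges_ends[OF simple_del]])
  with lead_sizes_le[of "Suc j"] jc show ?thesis by auto
qed

lemma leaf_edges_del_atMost:
  assumes "Suc j < c"
  shows "leaf_edges (del {..j}) = insert (ce (Suc j)) L0"
proof (intro subset_antisym)
  have I: "{..j} \<subseteq> {..<c}" using assms by auto
  show "insert (ce (Suc j)) L0 \<subseteq> leaf_edges (del {..j})"
    using leaf_edge_right[OF I, of j] leaf_edges_sub_del[OF I] assms by simp
  show "leaf_edges (del {..j}) \<subseteq> insert (ce (Suc j)) L0"
  proof
    fix f assume "f \<in> leaf_edges (del {..j})"
    then obtain x where x: "f \<in> del {..j}" "x \<in> f" "degree (del {..j}) x = 1" by (auto simp: leaf_edges_def)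
    have fE: "f \<in> E" using x(1) by (simp add: del_def)
    have I': "{..j} \<subseteq> {..<c - 1}" using assms by auto
    show "f \<in> insert (ce (Suc j)) L0"
    proof (cases "x \<in> set vs")
      case False
      then show ?thesis using x fE degree_off_cycle[OF False I] by (auto simp: leaf_edges_def)
    next
      case True
      then show ?thesis
      proof (cases rule: in_vsE)
        case 1
        then show ?thesis using x(3) degree_v[OF I'] degree_v_ge by simp
      next
        case (2 i)
        then have "card ({i - 1, i} - {..j}) = 1" using degree_nth[OF 2(1,2) I] x(3) by simp
        moreover have "{i - 1, i} - {..j} = (if j < i - 1 then {i - 1, i} else if j < i then {i} else {})"
          by auto
        ultimately have i: "i = Suc j" using 2(1) by (auto split: if_splits)
        have "f \<in> {e \<in> del {..j}. vs ! i \<in> e}" using x 2(3) by simp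
        then have "f \<in> ce ` ({i - 1, i} - {..j})" unfolding edges_at_nth[OF 2(1,2) I] .
        then show ?thesis using i by auto
      qed
    qed
  qed
qed

definition Q :: rat where
  "Q = (\<Prod>x | deep_vertex V E x \<and> x \<notin> set vs. 1 - of_nat (degree E x))"

lemma deep_del_atMost:
  assumes j: "Suc j < c"
  shows "{x. deep_vertex V (del {..j}) x} = {x. deep_vertex V E x \<and> x \<notin> set vs} \<union>
    ((if deep_vertex V E v \<and> j < c - 2 then {v} else {}) \<union> (!) vs ` {j + 3..<c})"
proof -
  have I: "{..j} \<subseteq> {..<c}" "{..j} \<subseteq> {..<c - 1}" using j by auto
  have iff: "deep_vertex V (del {..j}) x \<longleftrightarrow>
      x \<in> V \<and> 2 \<le> degree (del {..j}) x \<and> x \<notin> ce (Suc j) \<and> x \<notin> \<Union>L0" for x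
    unfolding deep_vertex_iff[OF simple_del] leaf_edges_del_atMost[OF j] by auto
  have off: "deep_vertex V (del {..j}) x \<longleftrightarrow> deep_vertex V E x" if "x \<notin> set vs" for x
    unfolding iff deep_vertex_iff[OF simple] degree_off_cycle[OF that I(1)]
    using ce_subset[OF j] that by auto
  have at_v: "deep_vertex V (del {..j}) v \<longleftrightarrow> deep_vertex V E v \<and> j < c - 2"
    unfolding iff deep_v_iff degree_v[OF I(2)] v_in_ce_iff[OF j]
    using degree_v_ge v_in j by auto
  have at: "deep_vertex V (del {..j}) (vs ! i) \<longleftrightarrow> j + 3 \<le> i" if i: "1 \<le> i" "i < c" for i
  proof -
    have "{i - 1, i} - {..j} = (if j < i - 1 then {i - 1, i} else if j < i then {i} else {})" by auto
    then have "2 \<le> degree (del {..j}) (vs ! i) \<longleftrightarrow> j < i - 1"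
      unfolding degree_nth[OF i I(1)] using i by auto
    then show ?thesis
      unfolding iff nth_in_ce_iff[OF j i] using isolated[OF i] nth_vs[OF i(2)] vsV by auto
  qed
  show ?thesis
  proof (intro set_eqI)
    fix x
    show "x \<in> {x. deep_vertex V (del {..j}) x} \<longleftrightarrow> x \<in> {x. deep_vertex V E x \<and> x \<notin> set vs} \<union>
      ((if deep_vertex V E v \<and> j < c - 2 then {v} else {}) \<union> (!) vs ` {j + 3..<c})"
    proof (cases "x \<in> set vs")
      case False
      then have "x \<notin> (!) vs ` {j + 3..<c}" "x \<noteq> v" using nth_vs v_in by auto
      then show ?thesis using off[OF False] False by auto
    next
      case True
      then show ?thesis
      proof (cases rule: in_vsE)
        case 1
        have "v \<notin> (!) vs ` {j + 3..<c}" by (rule v_notin_nths) simp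
        then show ?thesis using 1 at_v v_in by auto
      next
        case (2 i)
        have "vs ! i \<in> (!) vs ` {j + 3..<c} \<longleftrightarrow> j + 3 \<le> i"
          using 2 nth_eq by (auto simp: image_iff)
        then show ?thesis using 2 at[OF 2(1,2)] nth_ne_v[OF 2(1,2)] True by auto
      qed
    qed
  qed
qed

lemma prod_del_atMost:
  assumes j: "Suc j < c"
  shows "(\<Prod>x | deep_vertex V (del {..j}) x. 1 - rat_of_nat (degree (del {..j}) x)) =
    Q * ((if deep_vertex V E v \<and> j < c - 2 then 2 - of_nat (degree E v) else 1) * (- 1) ^ (c - (j + 3)))"
proof -
  have I: "{..j} \<subseteq> {..<c}" "{..j} \<subseteq> {..<c - 1}" using j by auto
  let ?w = "\<lambda>x. 1 - rat_of_nat (degree (del {..j}) x)"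
  let ?A = "{x. deep_vertex V E x \<and> x \<notin> set vs}" and ?B = "if deep_vertex V E v \<and> j < c - 2 then {v} else {}"
    and ?C = "(!) vs ` {j + 3..<c}"
  have finA: "finite ?A" by (rule finite_subset[OF _ fin(1)]) (auto simp: deep_vertex_def)
  have C: "?C \<subseteq> set vs" using nth_vs by auto
  have vC: "v \<notin> ?C" by (rule v_notin_nths) simp
  have "prod ?w {x. deep_vertex V (del {..j}) x} = prod ?w ?A * prod ?w (?B \<union> ?C)"
    unfolding deep_del_atMost[OF j] using finA C v_in by (intro prod.union_disjoint) auto
  also have "prod ?w (?B \<union> ?C) = prod ?w ?B * prod ?w ?C"
    using vC by (intro prod.union_disjoint) auto
  also have "prod ?w ?A = Q"
    unfolding Q_def by (intro prod.cong) (auto simp: degree_off_cycle[OF _ I(1)])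
  also have "prod ?w ?B = (if deep_vertex V E v \<and> j < c - 2 then 2 - of_nat (degree E v) else 1)"
    using degree_v[OF I(2)] degree_v_ge by (simp add: of_nat_diff)
  also have "prod ?w ?C = (- 1) ^ (c - (j + 3))"
  proof -
    have "prod ?w ?C = (\<Prod>i\<in>{j + 3..<c}. ?w (vs ! i))"
      by (rule prod.reindex_cong[where l = "(!) vs"]) (auto simp: inj_on_def nth_eq)
    also have "\<dots> = (\<Prod>i\<in>{j + 3..<c}. - 1)"
    proof (rule prod.cong)
      fix i assume i: "i \<in> {j + 3..<c}"
      then have "{i - 1, i} - {..j} = {i - 1, i}" by auto
      then have "degree (del {..j}) (vs ! i) = 2" using degree_nth[OF _ _ I(1), of i] i by simp
      then show "?w (vs ! i) = - 1" by simp
    qed simp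
    finally show ?thesis by simp
  qed
  finally show ?thesis .
qed

definition W :: rat where
  "W = (\<Prod>x | deep_vertex V (del {..0}) x. 1 - of_nat (degree (del {..0}) x))"

theorem star_lead_unicyclic:
  "star_lead (card V) (chrom_sym V E) lead_sizes
    ((of_nat c - 2) * W + (if deep_vertex V E v then (- 1) ^ c * Q else 0))"
proof -
  define X where "X I = chrom_sym V (del I)" for I
  define N where "N = Pow {..<c - 1} - {{}}"
  define val where "val j = (if j < c - 2 then (- 1) ^ j * W else if deep_vertex V E v then Q else 0)" for j
  define w where "w I = (if \<exists>j. I = {..j} then val (Max I) else 0)" for I
  have finN: "finite N" by (simp add: N_def)
  have "chrom_sym V E m = (\<Sum>I\<in>N. - ((- 1) ^ card I) * X I m)" for m
  proof -
    have "0 = (\<Sum>I\<in>Pow {..<c - 1}. (- 1) ^ card I * X I m)"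
      using chrom_sym_cycle_deletion[OF simple cycle c_def] by (simp add: X_def del_def)
    also have "\<dots> = (- 1) ^ card ({} :: nat set) * X {} m + (\<Sum>I\<in>N. (- 1) ^ card I * X I m)"
      unfolding N_def by (rule sum.remove) auto
    finally show ?thesis by (simp add: X_def del_def sum_negf)
  qed
  then have chrom: "chrom_sym V E = (\<lambda>m. \<Sum>I\<in>N. - ((- 1) ^ card I) * X I m)" by blast
  have lead: "star_lead (card V) (X I) lead_sizes (w I)" if "I \<in> N" for I
  proof -
    have I: "I \<subseteq> {..<c - 1}" "I \<noteq> {}" using that by (auto simp: N_def)
    then obtain k where k: "k \<in> I" "k < c" by fastforce
    have F: "star_lead (card V) (X I) (comp_sizes V (leaf_edges (del I)))
        (\<Prod>x | deep_vertex V (del I) x. 1 - of_nat (degree (del I) x))"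
      unfolding X_def by (rule star_lead_forest[OF simple_del forest_del[OF k]])
    show ?thesis
    proof (cases "\<exists>j. I = {..j}")
      case False
      then show ?thesis using star_lead_less[OF F del_less[OF I]] by (auto simp: w_def)
    next
      case True
      then obtain j where Ij: "I = {..j}" ..
      have j: "Suc j < c" using I(1) Ij by (cases "Suc j < c") auto
      have wI: "w I = val j" using Ij Max_eqI[of "{..j}" j] by (auto simp: w_def)
      note L = leaf_edges_del_atMost[OF j]
      show ?thesis
      proof (cases "j < c - 2")
        case True
        then have sizes: "comp_sizes V (leaf_edges (del I)) = lead_sizes"
          unfolding Ij L by (intro comp_sizes_ce_eq) auto
        have "(- 1) ^ (c - (j + 3)) = (- 1) ^ j * ((- 1) ^ (c - 3) :: rat)"
        proof -
          have "c - 3 = j + (c - (j + 3))" using True by simp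
          then have "(- 1) ^ j * ((- 1) ^ (c - 3) :: rat) = (- 1) ^ (j + j) * (- 1) ^ (c - (j + 3))"
            by (simp add: power_add)
          then show ?thesis by simp
        qed
        then have "(\<Prod>x | deep_vertex V (del I) x. 1 - rat_of_nat (degree (del I) x)) = val j"
          using prod_del_atMost[OF j] prod_del_atMost[of 0] c3 True unfolding Ij W_def val_def by simp
        then show ?thesis using F sizes wI by simp
      next
        case False
        then have jc: "j = c - 2" "Suc j = c - 1" using j by auto
        show ?thesis
        proof (cases "deep_vertex V E v")
          case True
          then have sizes: "comp_sizes V (leaf_edges (del I)) = lead_sizes"
            unfolding Ij L jc(2) by (rule comp_sizes_ce_last_deep)
          have "(\<Prod>x | deep_vertex V (del I) x. 1 - rat_of_nat (degree (del I) x)) = val j"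
            using prod_del_atMost[OF j] True jc unfolding Ij val_def by simp
          then show ?thesis using F sizes wI by simp
        next
          case nd: False
          then have "lead_sizes < comp_sizes V (leaf_edges (del I))"
            unfolding Ij L jc(2) by (rule comp_sizes_ce_last_less)
          then show ?thesis using star_lead_less[OF F] wI nd jc by (simp add: val_def)
        qed
      qed
    qed
  qed
  have "(\<Sum>I\<in>N. - ((- 1) ^ card I) * w I) = (\<Sum>I\<in>atMost ` {..<c - 1}. - ((- 1) ^ card I) * w I)"
  proof (rule sum.mono_neutral_right[OF finN])
    show "atMost ` {..<c - 1} \<subseteq> N" by (auto simp: N_def)
    show "\<forall>I\<in>N - atMost ` {..<c - 1}. - ((- 1) ^ card I) * w I = 0"
    proof
      fix I assume I: "I \<in> N - atMost ` {..<c - 1}"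
      have "\<nexists>j. I = {..j}"
      proof
        assume "\<exists>j. I = {..j}"
        then obtain j where "I = {..j}" ..
        moreover from this have "j < c - 1" using I by (auto simp: N_def)
        ultimately show False using I by blast
      qed
      then show "- ((- 1) ^ card I) * w I = 0" by (simp add: w_def)
    qed
  qed
  also have "\<dots> = (\<Sum>j<c - 1. - ((- 1) ^ card {..j}) * w {..j})"
    by (subst sum.reindex) (auto simp: inj_on_def)
  also have "\<dots> = (\<Sum>j<c - 1. (- 1) ^ j * val j)"
  proof (rule sum.cong)
    fix j
    have "w {..j} = val j" using Max_eqI[of "{..j}" j] by (auto simp: w_def)
    then show "- ((- 1) ^ card {..j}) * w {..j} = (- 1) ^ j * val j" by simp
  qed simp
  also have "\<dots> = (\<Sum>j<c - 2. (- 1) ^ j * val j) + (- 1) ^ (c - 2) * val (c - 2)"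
  proof -
    have "c - 1 = Suc (c - 2)" using c3 by simp
    then show ?thesis by simp
  qed
  also have "(\<Sum>j<c - 2. (- 1) ^ j * val j) = (\<Sum>j<c - 2. W)"
    by (rule sum.cong) (auto simp: val_def mult.assoc[symmetric] power_add[symmetric])
  also have "\<dots> = (of_nat c - 2) * W" using c3 by (simp add: of_nat_diff)
  also have "(- 1) ^ (c - 2) * val (c - 2) = (if deep_vertex V E v then (- 1) ^ c * Q else 0)"
  proof -
    have "(- 1) ^ c = ((- 1) ^ (c - 2) :: rat)" using c3 by (simp add: minus_one_power_iff)
    then show ?thesis by (simp add: val_def)
  qed
  finally have total: "(\<Sum>I\<in>N. - ((- 1) ^ card I) * w I) =
      (of_nat c - 2) * W + (if deep_vertex V E v then (- 1) ^ c * Q else 0)" .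
  have "star_lead (card V) (\<lambda>m. \<Sum>I\<in>N. - ((- 1) ^ card I) * X I m) lead_sizes (\<Sum>I\<in>N. - ((- 1) ^ card I) * w I)"
    using finN lead by (rule star_lead_sum)
  then show ?thesis unfolding chrom[symmetric] total .
qed

end


lemma prod_one_minus:
  fixes f :: "'b \<Rightarrow> rat"
  shows "(\<Prod>i\<in>A. 1 - f i) = (- 1) ^ card A * (\<Prod>i\<in>A. f i - 1)"
proof -
  have "(\<Prod>i\<in>A. 1 - f i) = (\<Prod>i\<in>A. (- 1) * (f i - 1))" by (intro prod.cong) auto
  then show ?thesis unfolding prod.distrib by simp
qed

theorem theorem6p3:
  fixes V :: "'a set" and E E' :: "'a set set" and vs :: "'a list" and v :: 'a
    and \<epsilon> :: "nat \<Rightarrow> 'a set" and c p :: nat and u :: "nat \<Rightarrow> 'a" and d :: "nat \<Rightarrow> nat"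
  assumes "simple_graph V E" and "connected_graph V E" and "unicyclic V E"
    and "is_cycle V E vs" and "c = length vs"
    and "{x \<in> set vs. card (component V (E - cycle_edges vs) x) > 1} = {v}"
    and "vs ! 0 = v"
    and "\<forall>i\<in>{1..c}. \<epsilon> i = cycle_edge vs (i - 1)"
    and "E' = E - {\<epsilon> 1}"
    and "bij_betw u {1..p} {x. deep_vertex V E' x}"
    and "\<forall>i\<in>{1..p}. d i = degree E' (u i)"
  shows "(sprout V E v \<longrightarrow> u 1 = v \<longrightarrow>
            lead_coeff (card V) (chrom_sym V E) =
              (-1) ^ p * ((of_nat c - 2) * (\<Prod>i=1..p. (of_nat (d i) - 1))
                          + (\<Prod>i=2..p. (of_nat (d i) - 1))))
       \<and> (\<not> sprout V E v \<longrightarrow>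
            lead_coeff (card V) (chrom_sym V E) =
              (-1) ^ p * (of_nat c - 2) * (\<Prod>i=1..p. (of_nat (d i) - 1)))"
proof -
  interpret unicyclic_one_tree V E vs v c
    using assms by unfold_locales auto
  have E': "E' = del {..0}" using assms(8,9) c3 by (simp add: del_def)
  have sprout: "sprout V E v \<longleftrightarrow> deep_vertex V E v"
    using degree_v_ge cycle v_in(1) unfolding sprout_def by blast
  have W_prod: "W = (\<Prod>i=1..p. 1 - of_nat (d i))"
  proof -
    have "W = (\<Prod>x\<in>{x. deep_vertex V E' x}. 1 - of_nat (degree E' x))" unfolding W_def E' ..
    also have "\<dots> = (\<Prod>i=1..p. 1 - of_nat (degree E' (u i)))"
      by (rule prod.reindex_bij_betw[OF assms(10), symmetric])
    finally show ?thesis using assms(11) by simp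
  qed
  have "finite {x. deep_vertex V E' x}" by (rule finite_subset[OF _ fin(1)]) (auto simp: deep_vertex_def)
  moreover have "1 - rat_of_nat (degree E' x) \<noteq> 0" if "deep_vertex V E' x" for x
    using that by (auto simp: deep_vertex_def)
  ultimately have W0: "W \<noteq> 0" unfolding W_def E'[symmetric] by (subst prod_zero_iff) blast+
  have c2: "of_nat c - 2 \<ge> (1 :: rat)" using c3 by (simp add: of_nat_diff[symmetric])
  obtain l where l: "l \<in> partitions (card V)" "mset l = lead_sizes"
    unfolding lead_sizes_def using partition_of_kernel_sizes[OF fin(1)] by metis
  note lead = lead_coeff_eqI[OF star_lead_unicyclic[folded l(2)] l(1)]
  show ?thesis
  proof (intro conjI impI)
    assume "\<not> sprout V E v"
    then have "lead_coeff (card V) (chrom_sym V E) = (of_nat c - 2) * W"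
      using lead W0 c2 sprout by simp
    then show "lead_coeff (card V) (chrom_sym V E) =
        (-1) ^ p * (of_nat c - 2) * (\<Prod>i=1..p. (of_nat (d i) - 1))"
      unfolding W_prod prod_one_minus by simp
  next
    assume "sprout V E v" and u1: "u 1 = v"
    then have deep: "deep_vertex V E v" using sprout by simp
    define R where "R = (\<Prod>i=2..p. 1 - rat_of_nat (d i))"
    have "v \<in> {x. deep_vertex V E' x}" unfolding E' using deep_del_atMost[of 0] deep c3 by auto
    then have p: "1 \<le> p" using assms(10) by (cases p) (auto simp: bij_betw_def)
    have "degree E' v = degree E v - 1" using degree_v[of "{..0}"] c3 unfolding E' by auto
    then have d1: "rat_of_nat (d 1) = of_nat (degree E v) - 1"
      using assms(11) p u1 degree_v_ge by (simp add: of_nat_diff)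
    have ins: "{1..p} = insert 1 {2..p}" using p by auto
    have "W = (1 - of_nat (d 1)) * R" unfolding W_prod R_def ins by simp
    also have "1 - rat_of_nat (d 1) = 2 - of_nat (degree E v)" unfolding d1 by simp
    finally have WR: "W = (2 - of_nat (degree E v)) * R" .
    have v2: "2 - rat_of_nat (degree E v) \<le> - 1"
      using degree_v_ge by (simp add: le_diff_eq of_nat_diff)
    have "W = (2 - of_nat (degree E v)) * (Q * (- 1) ^ (c - 3))"
      using prod_del_atMost[of 0] deep c3 unfolding W_def by simp
    then have "Q * (- 1) ^ (c - 3) = R" using WR v2 by simp
    moreover have "(- 1) ^ c = - ((- 1) ^ (c - 3) :: rat)"
      using c3 by (simp add: minus_one_power_iff)
    ultimately have R: "(- 1) ^ c * Q = - R" by (simp add: mult.commute)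
    have "(of_nat c - 2) * (2 - rat_of_nat (degree E v)) \<le> 0"
      using c2 v2 by (intro mult_nonneg_nonpos) auto
    then have "((of_nat c - 2) * (2 - rat_of_nat (degree E v)) - 1) * R \<noteq> 0"
      using W0 WR by auto
    then have "(of_nat c - 2) * W + (- 1) ^ c * Q \<noteq> 0" unfolding R WR by (simp add: algebra_simps)
    then have "lead_coeff (card V) (chrom_sym V E) = (of_nat c - 2) * W - R"
      using lead deep R by simp
    moreover have "R = - ((-1) ^ p * (\<Prod>i=2..p. (of_nat (d i) - 1)))"
    proof -
      have "(- 1) ^ p = - ((- 1) ^ (p - 1) :: rat)" using p by (simp add: minus_one_power_iff)
      then show ?thesis unfolding R_def prod_one_minus using p by simp
    qed
    ultimately show "lead_coeff (card V) (chrom_sym V E) =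
        (-1) ^ p * ((of_nat c - 2) * (\<Prod>i=1..p. (of_nat (d i) - 1)) + (\<Prod>i=2..p. (of_nat (d i) - 1)))"
      unfolding W_prod prod_one_minus by (simp add: algebra_simps)
  qed
qed

end
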